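(* Let $0<\alpha<2$, $0\le\theta<2\pi$, and either $0<\phi\le\pi$ or $\phi=2\pi$. Let $\mathcal{X}_n$ be a set of $n$ independent uniformly distributed random points in $(0,1]^2$, and let $\mathcal{L}^\alpha(\mathcal{X}_n)$ be the total $\alpha$-power-weighted length of the minimal directed spanning forest on $\mathcal{X}_n$ under the partial order $\preccurlyeq_{\theta,\phi}$. Then, as $n\to\infty$, $$n^{(\alpha/2)-1}\mathcal{L}^\alpha(\mathcal{X}_n)\longrightarrow (2/\phi)^{\alpha/2}\,\Gamma(1+\alpha/2)\quad\text{in } L^1.$$ Moreover, when the partial order is $\preccurlyeq^*$ (the case $\theta=\phi=\pi/2$), the same convergence holds with $\mathcal{X}_n$ replaced by $\mathcal{X}_n^0:=\mathcal{X}_n\cup\{\mathbf{0}\}$, where $\mathbf{0}$ is the origin.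
   Context: For $\mathbf{x}\in\mathbb{R}^2$, $C_{\theta,\phi}(\mathbf{x})$ is the closed cone with vertex $\mathbf{x}$ bounded by the rays from $\mathbf{x}$ at angles $\theta$ and $\theta+\phi$, measured anticlockwise from the upwards vertical. The relation $\preccurlyeq_{\theta,\phi}$ is defined by $\mathbf{y}\preccurlyeq_{\theta,\phi}\mathbf{x}$ iff $\mathbf{y}\in C_{\theta,\phi}(\mathbf{x})$. The order $\preccurlyeq^*$ is the case $\theta=\phi=\pi/2$, i.e. $(u_1,u_2)\preccurlyeq^*(v_1,v_2)$ iff $u_1\le v_1$ and $u_2\le v_2$. For a finite set $\mathcal{S}\subset\mathbb{R}^2$ and $\mathbf{x}\in\mathcal{S}$, let $d(\mathbf{x};\mathcal{S})=\min\{\|\mathbf{x}-\mathbf{y}\|:\mathbf{y}\in\mathcal{S}\setminus\{\mathbf{x}\},\ \mathbf{y}\preccurlyeq\mathbf{x}\}$, with $\min\emptyset:=0$ and $\|\cdot\|$ the Euclidean norm. The minimal directed spanning forest (MDSF) on $\mathcal{S}$ joins each point to its directed nearest neighbour (almost surely unique for random uniform points). Its total weight with exponent $\alpha>0$ is $\mathcal{L}^\alpha(\mathcal{S})=\sum_{\mathbf{x}\in\mathcal{S}}d(\mathbf{x};\mathcal{S})^\alpha$. *)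

theory Defs
  imports "HOL-Probability.Probability"
begin

type_synonym pt = "real \<times> real"

text \<open>Closed cone with vertex x bounded by the rays from x at angles theta and
theta + phi, measured anticlockwise from the upward vertical. The direction at
angle t (anticlockwise from upwards) is (- sin t, cos t).\<close>
definition cone :: "real \<Rightarrow> real \<Rightarrow> pt \<Rightarrow> pt set" where
  "cone \<theta> \<phi> x = {y. \<exists>r t. r \<ge> 0 \<and> \<theta> \<le> t \<and> t \<le> \<theta> + \<phi> \<and>
        y = (fst x - r * sin t, snd x + r * cos t)}"

definition dpreceq :: "real \<Rightarrow> real \<Rightarrow> pt \<Rightarrow> pt \<Rightarrow> bool" where
  "dpreceq \<theta> \<phi> y x \<longleftrightarrow> y \<in> cone \<theta> \<phi> x"

definition dnn :: "real \<Rightarrow> real \<Rightarrow> pt \<Rightarrow> pt set \<Rightarrow> real" where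
  "dnn \<theta> \<phi> x S =
     (let C = {y \<in> S - {x}. dpreceq \<theta> \<phi> y x}
      in if C = {} then 0 else Min ((\<lambda>y. dist x y) ` C))"

definition mdsf_weight :: "real \<Rightarrow> real \<Rightarrow> real \<Rightarrow> pt set \<Rightarrow> real" where
  "mdsf_weight \<theta> \<phi> \<alpha> S = (\<Sum>x\<in>S. dnn \<theta> \<phi> x S powr \<alpha>)"

definition unif_sq :: "pt measure" where
  "unif_sq = uniform_measure lborel ({0<..1} \<times> {0<..1})"

definition sample_space :: "nat \<Rightarrow> (nat \<Rightarrow> pt) measure" where
  "sample_space n = PiM {..<n} (\<lambda>_. unif_sq)"

definition Xn :: "nat \<Rightarrow> (nat \<Rightarrow> pt) \<Rightarrow> pt set" where
  "Xn n \<omega> = \<omega> ` {..<n}"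

end

(* For a fixed point x at distance delta from the boundary of the square, the nearest neighbour in the
   cone is farther than t / sqrt n with probability about exp (- phi t^2 / 2), and for two distinct
   points these events are asymptotically independent. By the second moment method the fraction of
   points with sqrt n * d > t converges in mean to exp (- phi t^2 / 2) for each fixed t.
   The layer cake formula writes n^(alpha/2 - 1) times the total weight as the integral over v > 0 of the
   fraction of points with sqrt n * d > v^(1/alpha), and the limit as the same integral of the limiting
   tail, so it remains to dominate. If the nearest neighbour in the cone is farther than s, then the cone
   contains a far point of the square, so its part within distance s has area at least a constant times
   delta * s^2 (a parallelogram). Averaging exp (- const * delta * t^2) over the square gives a tail
   bound const / t^2 uniform in n, which is integrable at t = v^(1/alpha) precisely because alpha < 2. *)
theory Submission
  imports Defs
begin

section \<open>Area of circular sectors\<close>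

text \<open>The event that no sample point lies in the cone within distance s differs from the event
  s < d: a point whose cone contains no other point has d = 0 by convention, yet misses every
  region. Independence computes probabilities of the first kind of event (\<open>miss\<close>),
  while the weight sees only the second, so the proof carries a hypothesis \<open>miss_D\<close>
  saying that the two differ with vanishing probability. Without the origin it holds because the
  cone of an interior point has positive area in the square, so an empty cone becomes unlikely. With
  the origin added, the cone of almost every sample point contains the origin, and the events differ
  only when the point lies within s of it. Everything before the two verifications is stated for an
  abstract distance or for an abstract finite set of extra points, so that both cases share it.
  Convergence in L1 needs no separate uniform integrability argument: the layer cake bounds the mean
  error of the weight by the integral over v of the mean errors of the tail fractions, and dominated
  convergence applies to that integral.\<close>

lemma emeasure_lborel_translate:
  fixes c :: "'a::euclidean_space"
  assumes "A \<in> sets borel"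
  shows "emeasure lborel {y. y + c \<in> A} = emeasure lborel A"
proof -
  have "emeasure lborel A = emeasure (distr lborel borel ((+) c)) A"
    using lborel_affine[of 1 c] by (simp add: density_1)
  also have "\<dots> = emeasure lborel ((+) c -` A)"
    using assms by (simp add: emeasure_distr)
  also have "(+) c -` A = {y. y + c \<in> A}"
    by (auto simp: add.commute)
  finally show ?thesis ..
qed

section \<open>Invariance of plane area under shears and rotations\<close>

definition shear_snd :: "real \<Rightarrow> pt \<Rightarrow> pt" where
  "shear_snd k z = (fst z, snd z + k * fst z)"

definition shear_fst :: "real \<Rightarrow> pt \<Rightarrow> pt" where
  "shear_fst k z = (fst z + k * snd z, snd z)"

lemma shear_measurable [measurable]:
  "shear_snd k \<in> borel_measurable borel" "shear_fst k \<in> borel_measurable borel"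
  unfolding shear_snd_def[abs_def] shear_fst_def[abs_def] borel_prod[symmetric] by measurable

text \<open>A shear translates each slice with fixed first coordinate, so Fubini reduces the claim
  to translation invariance on the line.\<close>

lemma emeasure_shear_snd:
  assumes [measurable]: "A \<in> sets borel"
  shows "emeasure lborel (shear_snd k -` A) = emeasure lborel A"
proof -
  have A': "A \<in> sets (lborel \<Otimes>\<^sub>M lborel)" "shear_snd k -` A \<in> sets (lborel \<Otimes>\<^sub>M lborel)"
    using measurable_sets[OF shear_measurable(1) assms, of k] unfolding lborel_prod by (simp_all add: assms)
  have *: "emeasure lborel (Pair x -` shear_snd k -` A) = emeasure lborel (Pair x -` A)" for x
  proof -
    have "Pair x -` A \<in> sets borel"
      using sets_Pair1[OF A'(1)] by simp
    from emeasure_lborel_translate[OF this, of "k * x"] show ?thesis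
      by (simp add: shear_snd_def vimage_def)
  qed
  show ?thesis
    unfolding lborel_prod[symmetric]
    using A' by (simp add: lborel.emeasure_pair_measure_alt *)
qed

lemma emeasure_shear_fst:
  assumes [measurable]: "A \<in> sets borel"
  shows "emeasure lborel (shear_fst k -` A) = emeasure lborel A"
proof -
  have A': "A \<in> sets (lborel \<Otimes>\<^sub>M lborel)" "shear_fst k -` A \<in> sets (lborel \<Otimes>\<^sub>M lborel)"
    using measurable_sets[OF shear_measurable(2) assms, of k] unfolding lborel_prod by (simp_all add: assms)
  have *: "emeasure lborel ((\<lambda>x. (x, y)) -` shear_fst k -` A) = emeasure lborel ((\<lambda>x. (x, y)) -` A)" for y
  proof -
    have "(\<lambda>x. (x, y)) -` A \<in> sets borel"
      using sets_Pair2[OF A'(1)] by simp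
    from emeasure_lborel_translate[OF this, of "k * y"] show ?thesis
      by (simp add: shear_fst_def vimage_def)
  qed
  show ?thesis
    unfolding lborel_prod[symmetric]
    using A' by (simp add: lborel_pair.emeasure_pair_measure_alt2 *)
qed

definition rot :: "real \<Rightarrow> pt \<Rightarrow> pt" where
  "rot t z = (fst z * cos t - snd z * sin t, fst z * sin t + snd z * cos t)"

lemma rot_measurable [measurable]: "rot t \<in> borel_measurable borel"
  unfolding rot_def[abs_def] borel_prod[symmetric] by measurable

lemma rot_rot: "rot a (rot b z) = rot (a + b) z"
  by (simp add: rot_def cos_add sin_add algebra_simps)

text \<open>The classical factorisation of a plane rotation into three shears. It transfers area
  invariance from shears to rotations; the tangent of the half angle is the reason for the side
  condition.\<close>

lemma rot_eq_shears:
  assumes "cos (t / 2) \<noteq> 0"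
  shows "rot t z = shear_fst (- tan (t/2)) (shear_snd (sin t) (shear_fst (- tan (t/2)) z))"
proof -
  define s where "s = sin (t/2)"
  define c where "c = cos (t/2)"
  have st: "sin t = 2 * s * c" "cos t = 1 - 2 * s^2"
    using sin_double[of "t/2"] cos_double_sin[of "t/2"] by (simp_all add: s_def c_def)
  have c0: "c \<noteq> 0" using assms by (simp add: c_def)
  have c2: "c^2 = 1 - s^2" by (simp add: s_def c_def cos_squared_eq)
  have t: "tan (t/2) = s / c" by (simp add: tan_def s_def c_def)
  show ?thesis
    using c0 c2 unfolding rot_def shear_fst_def shear_snd_def st t fst_conv snd_conv prod.inject
    by (simp add: field_simps power2_eq_square) algebra
qed

lemma emeasure_rot:
  assumes A: "A \<in> sets borel"
  shows "emeasure lborel (rot t -` A) = emeasure lborel A"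
proof -
  have 1: "emeasure lborel (rot t -` A) = emeasure lborel A" if "cos (t / 2) \<noteq> 0" "A \<in> sets borel" for t A
  proof -
    let ?f = "shear_fst (- tan (t/2))" and ?g = "shear_snd (sin t)"
    have "rot t -` A = ?f -` (?g -` (?f -` A))"
      by (auto simp: rot_eq_shears[OF that(1)])
    moreover have m: "?f -` A \<in> sets borel" "?g -` (?f -` A) \<in> sets borel"
      using measurable_sets[OF shear_measurable(2) that(2)] measurable_sets[OF shear_measurable(1)]
      by simp_all
    ultimately show ?thesis
      using that by (simp add: emeasure_shear_fst emeasure_shear_snd)
  qed
  show ?thesis
  proof (cases "cos (t / 2) = 0")
    case False thus ?thesis using 1 A by simp
  next
    case True
    \<comment> \<open>A half turn is done as two rotations by \<open>t / 2\<close>. These have a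
      three-shear factorisation, because a vanishing \<open>cos (t / 4)\<close> would make
      \<open>cos (t / 2)\<close> equal to -1 instead of 0.\<close>
    have c: "cos (t / 2 / 2) \<noteq> 0"
    proof
      assume "cos (t / 2 / 2) = 0"
      then have "cos (2 * (t / 2 / 2)) = -1" unfolding cos_double_cos by simp
      then show False using True by simp
    qed
    have "rot t -` A = rot (t/2) -` (rot (t/2) -` A)"
      by (auto simp del: split_paired_All simp: rot_rot vimage_def)
    moreover have "rot (t/2) -` A \<in> sets borel"
      using measurable_sets[OF rot_measurable A] by simp
    ultimately show ?thesis using 1[OF c] A by simp
  qed
qed

section \<open>Sector area as a function of the opening angle\<close>

definition sector :: "real \<Rightarrow> real \<Rightarrow> real \<Rightarrow> pt set" where
  "sector a b s = (\<lambda>(r, t). (- r * sin t, r * cos t)) ` ({0..s} \<times> {a..b})"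

lemma compact_sector: "compact (sector a b s)"
  unfolding sector_def case_prod_unfold
  by (intro compact_continuous_image compact_Times compact_Icc continuous_intros)

lemma sector_borel [measurable]: "sector a b s \<in> sets borel"
  using compact_sector by (rule borel_compact)

lemma sectorI: "0 \<le> r \<Longrightarrow> r \<le> s \<Longrightarrow> a \<le> t \<Longrightarrow> t \<le> b \<Longrightarrow> (- r * sin t, r * cos t) \<in> sector a b s"
  unfolding sector_def by (intro image_eqI[of _ _ "(r, t)"]) auto

lemma sectorE:
  assumes "z \<in> sector a b s"
  obtains r t where "z = (- r * sin t, r * cos t)" "0 \<le> r" "r \<le> s" "a \<le> t" "t \<le> b"
  using assms unfolding sector_def by auto

lemma emeasure_sector_finite: "emeasure lborel (sector a b s) < \<infinity>"
  using compact_sector by (rule emeasure_compact_finite)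

lemma rot_vimage_sector: "rot c -` sector (a + c) (b + c) s = sector a b s"
proof (intro equalityI subsetI)
  fix z assume "z \<in> rot c -` sector (a + c) (b + c) s"
  then obtain r t where rt: "rot c z = (- r * sin t, r * cos t)" "0 \<le> r" "r \<le> s" "a + c \<le> t" "t \<le> b + c"
    by (auto elim: sectorE)
  have "z = rot (- c) (rot c z)"
    unfolding rot_rot by (simp add: rot_def)
  also have "\<dots> = (- r * sin (t - c), r * cos (t - c))"
    unfolding rt(1) by (simp add: rot_def sin_diff cos_diff algebra_simps)
  also have "\<dots> \<in> sector a b s" using rt by (intro sectorI) auto
  finally show "z \<in> sector a b s" .
next
  fix z assume "z \<in> sector a b s"
  then obtain r t where rt: "z = (- r * sin t, r * cos t)" "0 \<le> r" "r \<le> s" "a \<le> t" "t \<le> b"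
    by (auto elim: sectorE)
  have "rot c z = (- r * sin (t + c), r * cos (t + c))"
    unfolding rt(1) by (simp add: rot_def sin_add cos_add algebra_simps)
  also have "\<dots> \<in> sector (a + c) (b + c) s" using rt by (intro sectorI) auto
  finally show "z \<in> rot c -` sector (a + c) (b + c) s" by simp
qed

lemma measure_sector_shift: "measure lborel (sector (a + c) (b + c) s) = measure lborel (sector a b s)"
  using emeasure_rot[OF sector_borel[of "a + c" "b + c" s], of c]
  by (simp add: measure_def rot_vimage_sector)

lemma norm_sector: "norm (- r * sin t, r * cos t) = \<bar>r\<bar>"
proof -
  have "(r * sin t)\<^sup>2 + (r * cos t)\<^sup>2 = r\<^sup>2"
    using sin_cos_squared_add[of t] by (simp add: power_mult_distrib flip: distrib_left)
  then show ?thesis by (simp add: norm_prod_def)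
qed

lemma ray_null: "sector a a s \<in> null_sets lborel"
proof -
  have "sector a a s \<subseteq> {x. (cos a, sin a) \<bullet> x = 0}"
    by (auto elim!: sectorE simp: inner_prod_def)
  moreover have "(cos a, sin a) \<noteq> 0"
    using sin_cos_squared_add[of a] unfolding zero_prod_def by (metis Pair_inject add.right_neutral power_zero_numeral zero_neq_one)
  ultimately have "negligible (sector a a s)"
    using negligible_hyperplane[of "(cos a, sin a)" 0] negligible_subset by blast
  then show ?thesis
    by (simp add: negligible_iff_null_sets null_sets_completion_iff)
qed

lemma measure_sector_add:
  assumes "a \<le> b" "b \<le> c" "c - a \<le> 2 * pi"
  shows "measure lborel (sector a c s) = measure lborel (sector a b s) + measure lborel (sector b c s)"
proof -
  have U: "sector a c s = sector a b s \<union> sector b c s"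
    unfolding sector_def image_Un[symmetric] using assms by (intro arg_cong2[where f=image]) auto
  have I: "sector a b s \<inter> sector b c s \<subseteq> sector a a s \<union> sector b b s"
  proof
    fix z assume z: "z \<in> sector a b s \<inter> sector b c s"
    from z obtain r t where rt: "z = (- r * sin t, r * cos t)" "0 \<le> r" "r \<le> s" "a \<le> t" "t \<le> b"
      by (auto elim: sectorE)
    from z obtain r' t' where rt': "z = (- r' * sin t', r' * cos t')" "0 \<le> r'" "r' \<le> s" "b \<le> t'" "t' \<le> c"
      by (auto elim: sectorE)
    have "r = r'" using norm_sector[of r t] norm_sector[of r' t'] rt(1,2) rt'(1,2) by simp
    show "z \<in> sector a a s \<union> sector b b s"
    proof (cases "r = 0")
      case True then show ?thesis using rt sectorI[of 0 s a a a] by auto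
    next
      case False
      then have "sin t = sin t'" "cos t = cos t'" using rt(1) rt'(1) \<open>r = r'\<close> by auto
      \<comment> \<open>The polar angle is determined up to full turns, and \<open>t' - t\<close>
        lies between 0 and \<open>2 * pi\<close>. This leaves two values of \<open>n\<close>: 0 for
        the common ray at \<open>b\<close>, and -1 for a full opening, where the rays at
        \<open>a\<close> and \<open>c\<close> coincide.\<close>
      then obtain n where n: "t = t' + 2 * pi * of_int n" using sin_cos_eq_iff by metis
      have "t' - t \<le> 2 * pi" "t \<le> t'" using rt rt' assms by auto
      then have "pi * real_of_int n \<le> pi * 0" "pi * (- real_of_int n) \<le> pi * 1" using n by auto
      then have "real_of_int n \<le> 0" "- real_of_int n \<le> 1"
        by (metis mult_le_cancel_left_pos pi_gt_zero)+
      then have "n = 0 \<or> n = -1" by auto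
      then show ?thesis
      proof
        assume "n = 0" then have "t = b" using n rt rt' by auto
        then show ?thesis using rt sectorI[of r s b b b] by auto
      next
        assume "n = -1" then have "t = a" using n rt rt' assms by auto
        then show ?thesis using rt sectorI[of r s a a a] by auto
      qed
    qed
  qed
  have "sector a b s \<inter> sector b c s \<in> null_sets lborel"
    by (rule null_sets_subset[OF null_sets.Un[OF ray_null ray_null] _ I]) simp
  then show ?thesis
    unfolding U using emeasure_sector_finite
    by (subst measure_Un3) (auto simp: fmeasurable_def measure_eq_0_null_sets)
qed

lemma sector_full:
  assumes "0 \<le> s"
  shows "sector 0 (2 * pi) s = cball 0 s"
proof (intro equalityI subsetI)
  fix z assume "z \<in> sector 0 (2 * pi) s"
  then obtain r t where "z = (- r * sin t, r * cos t)" "0 \<le> r" "r \<le> s" by (rule sectorE)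
  then show "z \<in> cball 0 s" by (simp add: norm_sector[unfolded mult_minus_left])
next
  fix z :: pt assume z: "z \<in> cball 0 s"
  show "z \<in> sector 0 (2 * pi) s"
  proof (cases "z = 0")
    case True then show ?thesis using sectorI[of 0 s 0 0 "2*pi"] assms by (auto simp: zero_prod_def)
  next
    case False
    define r where "r = norm z"
    have r: "r > 0" "r \<le> s" using False z by (auto simp: r_def)
    have "r\<^sup>2 = (fst z)\<^sup>2 + (snd z)\<^sup>2" by (simp add: r_def norm_prod_def)
    then have "(snd z / r)\<^sup>2 + (- fst z / r)\<^sup>2 = 1"
    proof -
      have "(snd z / r)\<^sup>2 + (- fst z / r)\<^sup>2 = ((fst z)\<^sup>2 + (snd z)\<^sup>2) / r\<^sup>2"
        by (simp add: power_divide add_divide_distrib)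
      also have "\<dots> = 1" unfolding \<open>r\<^sup>2 = _\<close>[symmetric] using r by simp
      finally show ?thesis .
    qed
    then obtain t where t: "0 \<le> t" "t \<le> 2 * pi" "snd z / r = cos t" "- fst z / r = sin t"
      using sincos_total_2pi_le by blast
    then have "z = (- r * sin t, r * cos t)" using r by (auto simp: prod_eq_iff field_simps)
    then show ?thesis using sectorI[of r s 0 t "2*pi"] r t by auto
  qed
qed

text \<open>Additivity and monotonicity in the opening angle force the area to be linear in it, and
  the full disc fixes the slope; no polar change of variables enters.\<close>

lemma measure_sector:
  assumes "0 \<le> \<phi>" "\<phi> \<le> 2 * pi" "0 \<le> s"
  shows "measure lborel (sector a (a + \<phi>) s) = \<phi> * s\<^sup>2 / 2"
proof -
  define h where "h x = measure lborel (sector 0 x s)" for x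
  have shift: "measure lborel (sector b (b + x) s) = h x" for b x
    using measure_sector_shift[of 0 b x s] by (simp add: h_def add.commute)
  have add: "h (x + y) = h x + h y" if "0 \<le> x" "0 \<le> y" "x + y \<le> 2 * pi" for x y
    using measure_sector_add[of 0 x "x + y" s] that shift[of x y] by (simp add: h_def)
  have nn: "0 \<le> h x" for x by (simp add: h_def)
  have mono: "h x \<le> h y" if "0 \<le> x" "x \<le> y" "y \<le> 2 * pi" for x y
    using add[of x "y - x"] nn[of "y - x"] that by auto
  have full: "h (2 * pi) = pi * s\<^sup>2"
    unfolding h_def sector_full[OF assms(3)] using assms(3) by (simp add: content_cball unit_ball_vol_2 power2_eq_square)
  have "h 0 = 0" using add[of 0 0] by simp
  have mult: "h (real k * x) = real k * h x" if "0 \<le> x" "real k * x \<le> 2 * pi" for k x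
    using that
  proof (induction k)
    case (Suc k)
    then show ?case using add[of "real k * x" x] by (simp add: algebra_simps)
  qed (simp add: \<open>h 0 = 0\<close>)
  \<comment> \<open>\<open>\<phi>\<close> lies between consecutive multiples of
    \<open>2 * pi / n\<close>, where \<open>h\<close> is known exactly, so the deviation from
    linearity is at most the area of one cell. The full angle is split off because the upper
    multiple must not exceed \<open>2 * pi\<close>.\<close>
  have bd: "\<bar>h \<phi> - \<phi> * s\<^sup>2 / 2\<bar> \<le> pi * s\<^sup>2 / real n" if n: "n > 0" for n :: nat
  proof (cases "\<phi> = 2 * pi")
    case True then show ?thesis by (simp add: full)
  next
    case False
    define u where "u = 2 * pi / real n"
    have u: "u > 0" "real n * u = 2 * pi" using n by (simp_all add: u_def)
    have hu: "h u = u * s\<^sup>2 / 2" using mult[of u n] u n full by (simp add: field_simps u_def)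
    define k where "k = nat \<lfloor>\<phi> / u\<rfloor>"
    have fl: "real k \<le> \<phi> / u" "\<phi> / u < real k + 1"
      using assms u by (auto simp: k_def)
    then have k: "real k * u \<le> \<phi>" "\<phi> < real (Suc k) * u" using u by (simp_all add: field_simps)
    have "real k * u < real n * u" using k u False assms by simp
    then have "Suc k \<le> n" using u by (metis Suc_leI mult_less_cancel_right_pos of_nat_less_iff)
    then have "real (Suc k) * u \<le> 2 * pi" unfolding u(2)[symmetric] using u by (intro mult_right_mono) auto
    then have "real k * h u \<le> h \<phi>" "h \<phi> \<le> real (Suc k) * h u"
      using mono[of "real k * u" \<phi>] mono[of \<phi> "real (Suc k) * u"] mult[of u k] mult[of u "Suc k"] k u assms
      by (auto simp: algebra_simps)
    then have "(real k * u) * (s\<^sup>2/2) \<le> h \<phi>" "h \<phi> \<le> (real k * u + u) * (s\<^sup>2 / 2)"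
      unfolding hu by (simp_all add: algebra_simps)
    moreover have "(real k * u) * (s\<^sup>2/2) \<le> \<phi> * (s\<^sup>2/2)" "\<phi> * (s\<^sup>2/2) \<le> (real k * u + u) * (s\<^sup>2/2)"
      using k by (intro mult_right_mono; simp add: algebra_simps)+
    ultimately have "\<bar>h \<phi> - \<phi> * (s\<^sup>2 / 2)\<bar> \<le> u * (s\<^sup>2/2)"
      unfolding distrib_right by linarith
    moreover have "u * (s\<^sup>2/2) = pi * s\<^sup>2 / real n" "\<phi> * (s\<^sup>2 / 2) = \<phi> * s\<^sup>2 / 2"
      by (simp_all add: u_def)
    ultimately show ?thesis by metis
  qed
  have "\<bar>h \<phi> - \<phi> * s\<^sup>2 / 2\<bar> \<le> 0"
  proof (rule LIMSEQ_le_const)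
    show "(\<lambda>n. pi * s\<^sup>2 / real n) \<longlonglongrightarrow> 0" by (rule lim_const_over_n)
  qed (use bd in \<open>auto intro!: exI[of _ 1]\<close>)
  then show ?thesis by (simp add: shift)
qed

section \<open>Nearest-neighbour regions in the unit square\<close>

lemma emeasure_lborel_Times:
  assumes "A \<in> sets borel" "B \<in> sets borel"
  shows "emeasure (lborel :: pt measure) (A \<times> B) = emeasure lborel (A :: real set) * emeasure lborel (B :: real set)"
  using lborel.emeasure_pair_measure_Times[of A lborel B] assms unfolding lborel_prod by simp

section \<open>Directions, convexity of narrow cones, area of parallelograms\<close>

definition unit_dir :: "real \<Rightarrow> pt" where
  "unit_dir t = (- sin t, cos t)"

lemma norm_unit_dir [simp]: "norm (unit_dir t) = 1"
  by (simp add: unit_dir_def norm_prod_def)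

lemma mem_cone_iff: "y \<in> cone \<theta> \<phi> x \<longleftrightarrow> (\<exists>r t. 0 \<le> r \<and> \<theta> \<le> t \<and> t \<le> \<theta> + \<phi> \<and> y = x + r *\<^sub>R unit_dir t)"
  by (auto simp: cone_def unit_dir_def prod_eq_iff)

text \<open>Convexity of a cone of opening at most a right angle. In the frame turned by
  \<open>t\<close> the sum has coordinates \<open>(- p, q)\<close> with \<open>p\<close> and
  \<open>q\<close> positive, so its angle lies in the first quadrant and only the comparison with
  \<open>\<psi>\<close> remains.\<close>

lemma conic_combination:
  assumes "0 < a" "0 < b" "0 < \<psi>" "\<psi> \<le> pi / 2"
  obtains r t' where "0 \<le> r" "t \<le> t'" "t' \<le> t + \<psi>"
    "a *\<^sub>R unit_dir t + b *\<^sub>R unit_dir (t + \<psi>) = r *\<^sub>R unit_dir t'"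
proof -
  define p where "p = b * sin \<psi>"
  define q where "q = a + b * cos \<psi>"
  have p: "p > 0" using assms by (auto simp: p_def intro!: mult_pos_pos sin_gt_zero)
  have q: "q > 0" using assms by (auto simp: q_def intro!: add_pos_nonneg mult_nonneg_nonneg cos_ge_zero)
  define r where "r = sqrt (p\<^sup>2 + q\<^sup>2)"
  have r: "r > 0" "r\<^sup>2 = p\<^sup>2 + q\<^sup>2" using p q by (auto simp: r_def add_pos_nonneg)
  have "(q / r)\<^sup>2 + (p / r)\<^sup>2 = (p\<^sup>2 + q\<^sup>2) / r\<^sup>2"
    by (simp add: power_divide add_divide_distrib)
  also have "\<dots> = 1" unfolding r(2)[symmetric] using r(1) by simp
  finally obtain \<tau> where \<tau>: "0 \<le> \<tau>" "\<tau> \<le> pi / 2" "q / r = cos \<tau>" "p / r = sin \<tau>"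
    using sincos_total_pi_half[of "q / r" "p / r"] p q r by (auto simp: less_imp_le)
  have pq: "p = r * sin \<tau>" "q = r * cos \<tau>" using \<tau> r by (auto simp: field_simps)
  \<comment> \<open>The sign of \<open>sin (\<psi> - \<tau>)\<close> decides the comparison: the
    terms in \<open>b\<close> cancel and the positive \<open>a * sin \<psi>\<close> is left.\<close>
  have "r * sin (\<psi> - \<tau>) = sin \<psi> * q - cos \<psi> * p"
    by (simp add: pq sin_diff algebra_simps)
  also have "\<dots> = a * sin \<psi>" by (simp add: p_def q_def algebra_simps)
  also have "\<dots> > 0" using assms by (auto intro!: mult_pos_pos sin_gt_zero)
  finally have "sin (\<psi> - \<tau>) > 0" using r by (simp add: zero_less_mult_iff)
  then have "\<tau> \<le> \<psi>"
    using sin_ge_zero[of "\<tau> - \<psi>"] sin_minus[of "\<tau> - \<psi>"] \<tau>(2) assms(3) by (cases "\<tau> \<le> \<psi>") simp_all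
  moreover have "a *\<^sub>R unit_dir t + b *\<^sub>R unit_dir (t + \<psi>) = r *\<^sub>R unit_dir (t + \<tau>)"
  proof -
    have "a *\<^sub>R unit_dir t + b *\<^sub>R unit_dir (t + \<psi>) = rot t (- p, q)"
      by (simp add: unit_dir_def rot_def p_def q_def sin_add cos_add algebra_simps)
    also have "\<dots> = r *\<^sub>R unit_dir (t + \<tau>)"
      by (simp add: unit_dir_def rot_def pq sin_add cos_add algebra_simps)
    finally show ?thesis .
  qed
  ultimately show thesis using that[of r "t + \<tau>"] \<tau> r by auto
qed

definition parallelogram :: "real \<Rightarrow> real \<Rightarrow> real \<Rightarrow> real \<Rightarrow> pt set" where
  "parallelogram t \<psi> l m = {a *\<^sub>R unit_dir t + b *\<^sub>R unit_dir (t + \<psi>) | a b. 0 < a \<and> a < l \<and> 0 < b \<and> b < m}"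

text \<open>After turning back by \<open>t\<close>, a shear removes the component of the second side
  along the first and leaves a rectangle. The area then follows from rotation and shear invariance,
  without a determinant.\<close>

lemma parallelogram_eq:
  assumes "0 < sin \<psi>"
  shows "parallelogram t \<psi> l m =
    rot (- t) -` shear_snd (cos \<psi> / sin \<psi>) -` ({- m * sin \<psi><..<0} \<times> {0<..<l})" (is "_ = ?R")
proof (intro equalityI subsetI)
  fix z assume "z \<in> parallelogram t \<psi> l m"
  then obtain a b where ab: "z = a *\<^sub>R unit_dir t + b *\<^sub>R unit_dir (t + \<psi>)" "0 < a" "a < l" "0 < b" "b < m"
    by (auto simp: parallelogram_def)
  have "z = rot t (- b * sin \<psi>, a + b * cos \<psi>)"
    by (simp add: ab(1) unit_dir_def rot_def sin_add cos_add algebra_simps)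
  then have "rot (- t) z = (- b * sin \<psi>, a + b * cos \<psi>)"
    by (simp add: rot_rot) (simp add: rot_def)
  then show "z \<in> ?R" using ab assms by (simp add: shear_snd_def)
next
  fix z assume z: "z \<in> ?R"
  define w where "w = rot (- t) z"
  define a where "a = snd w + cos \<psi> / sin \<psi> * fst w"
  define b where "b = - fst w / sin \<psi>"
  have "w = (- b * sin \<psi>, a + b * cos \<psi>)"
    using assms by (simp add: a_def b_def prod_eq_iff)
  have "z = rot t w" unfolding w_def rot_rot by (simp add: rot_def)
  also have "\<dots> = a *\<^sub>R unit_dir t + b *\<^sub>R unit_dir (t + \<psi>)"
    unfolding \<open>w = (- b * sin \<psi>, _)\<close> by (simp add: unit_dir_def rot_def sin_add cos_add algebra_simps)
  finally have "z = \<dots>" .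
  moreover have "0 < a" "a < l" "0 < b" "b < m"
    using z assms by (auto simp: w_def[symmetric] shear_snd_def a_def b_def field_simps)
  ultimately show "z \<in> parallelogram t \<psi> l m" unfolding parallelogram_def by blast
qed

lemma parallelogram_borel:
  assumes "0 < sin \<psi>"
  shows "parallelogram t \<psi> l m \<in> sets borel"
proof -
  have "{- m * sin \<psi><..<0} \<times> {0<..<l} \<in> sets (borel :: pt measure)"
    by (intro borel_open open_Times) auto
  then show ?thesis
    using measurable_sets[OF shear_measurable(1)] measurable_sets[OF rot_measurable]
    unfolding parallelogram_eq[OF assms] by simp
qed

lemma emeasure_parallelogram:
  assumes "0 < sin \<psi>" "0 \<le> l" "0 \<le> m"
  shows "emeasure lborel (parallelogram t \<psi> l m) = ennreal (l * m * sin \<psi>)"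
proof -
  have 1: "{- m * sin \<psi><..<0} \<times> {0<..<l} \<in> sets (borel :: pt measure)"
    by (intro borel_open open_Times) auto
  moreover have "shear_snd (cos \<psi> / sin \<psi>) -` ({- m * sin \<psi><..<0} \<times> {0<..<l}) \<in> sets borel"
    using measurable_sets[OF shear_measurable(1) 1] by simp
  ultimately show ?thesis
    unfolding parallelogram_eq[OF assms(1)] using assms
    by (simp add: emeasure_rot emeasure_shear_snd emeasure_lborel_Times mult_nonneg_nonneg
        flip: ennreal_mult)
qed

section \<open>Cone neighbourhoods within the unit square\<close>

definition bdist :: "pt \<Rightarrow> real" where
  "bdist x = min (min (fst x) (1 - fst x)) (min (snd x) (1 - snd x))"

text \<open>The radius is inclusive, so that avoidance of this set matches the strict inequality
  \<open>s < d\<close> whenever the cone holds another point at all.\<close>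

definition nbr :: "real \<Rightarrow> real \<Rightarrow> real \<Rightarrow> pt \<Rightarrow> pt set" where
  "nbr \<theta> \<phi> s x = {y \<in> cone \<theta> \<phi> x. y \<noteq> x \<and> dist x y \<le> s}"

abbreviation usq :: "pt set" where "usq \<equiv> {0<..1} \<times> {0<..1}"

lemma usq_borel [measurable]: "usq \<in> sets borel"
  unfolding borel_prod[symmetric] by measurable

lemma emeasure_usq: "emeasure lborel usq = 1"
  by (simp add: emeasure_lborel_Times)

lemma sets_unif_sq [simp, measurable_cong]: "sets unif_sq = sets borel"
  by (simp add: unif_sq_def)

lemma space_unif_sq [simp]: "space unif_sq = UNIV"
  by (simp add: unif_sq_def)

lemma emeasure_unif_sq: "A \<in> sets borel \<Longrightarrow> emeasure unif_sq A = emeasure lborel (usq \<inter> A)"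
  by (simp add: unif_sq_def emeasure_usq divide_ennreal_def)

lemma measure_unif_sq: "A \<in> sets borel \<Longrightarrow> measure unif_sq A = measure lborel (usq \<inter> A)"
  by (simp add: measure_def emeasure_unif_sq)

lemma prob_space_unif_sq: "prob_space unif_sq"
  unfolding unif_sq_def by (rule prob_space_uniform_measure) (simp_all add: emeasure_usq)

interpretation unif_sq: prob_space unif_sq
  by (rule prob_space_unif_sq)

lemma nbr_eq: "nbr \<theta> \<phi> s x = {y. y - x \<in> sector \<theta> (\<theta> + \<phi>) s} - {x}"
proof -
  have "y \<in> nbr \<theta> \<phi> s x \<longleftrightarrow> y - x \<in> sector \<theta> (\<theta> + \<phi>) s \<and> y \<noteq> x" for y
  proof
    assume "y \<in> nbr \<theta> \<phi> s x"
    then obtain r t where rt: "0 \<le> r" "\<theta> \<le> t" "t \<le> \<theta> + \<phi>" "y = x + r *\<^sub>R unit_dir t" "y \<noteq> x" "dist x y \<le> s"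
      unfolding nbr_def mem_cone_iff by auto
    then have "r \<le> s" by (simp add: dist_norm)
    then show "y - x \<in> sector \<theta> (\<theta> + \<phi>) s \<and> y \<noteq> x"
      using sectorI[of r s \<theta> t] rt by (simp add: unit_dir_def)
  next
    assume *: "y - x \<in> sector \<theta> (\<theta> + \<phi>) s \<and> y \<noteq> x"
    then obtain r t where rt: "y - x = r *\<^sub>R unit_dir t" "0 \<le> r" "r \<le> s" "\<theta> \<le> t" "t \<le> \<theta> + \<phi>"
      by (auto elim!: sectorE simp: unit_dir_def)
    then have "y = x + r *\<^sub>R unit_dir t" by (simp add: algebra_simps)
    moreover from this have "dist x y \<le> s" using rt by (simp add: dist_norm)
    ultimately show "y \<in> nbr \<theta> \<phi> s x" using * rt unfolding nbr_def mem_cone_iff by blast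
  qed
  then show ?thesis by auto
qed

text \<open>Exhibits the cone as a countable union of compact sectors, which is what makes the order
  relation measurable.\<close>

lemma cone_eq_UN: "y \<in> cone \<theta> \<phi> x \<longleftrightarrow> (\<exists>n::nat. y - x \<in> sector \<theta> (\<theta> + \<phi>) (real n))"
proof
  assume "y \<in> cone \<theta> \<phi> x"
  then obtain r t where rt: "0 \<le> r" "\<theta> \<le> t" "t \<le> \<theta> + \<phi>" "y = x + r *\<^sub>R unit_dir t"
    unfolding mem_cone_iff by auto
  obtain n :: nat where "r \<le> real n" using real_arch_simple by blast
  then have "y - x \<in> sector \<theta> (\<theta> + \<phi>) (real n)"
    using sectorI[of r n \<theta> t] rt by (simp add: unit_dir_def)
  then show "\<exists>n::nat. y - x \<in> sector \<theta> (\<theta> + \<phi>) (real n)" ..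
next
  assume "\<exists>n::nat. y - x \<in> sector \<theta> (\<theta> + \<phi>) (real n)"
  then obtain n :: nat where "y - x \<in> sector \<theta> (\<theta> + \<phi>) (real n)" ..
  then obtain r t where rt: "y - x = r *\<^sub>R unit_dir t" "0 \<le> r" "\<theta> \<le> t" "t \<le> \<theta> + \<phi>"
    by (auto elim!: sectorE simp: unit_dir_def)
  then have "y = x + r *\<^sub>R unit_dir t" by (simp add: algebra_simps)
  then show "y \<in> cone \<theta> \<phi> x" using rt unfolding mem_cone_iff by blast
qed

lemma pred_sector [measurable]:
  assumes [measurable]: "f \<in> borel_measurable M" "g \<in> borel_measurable M"
  shows "Measurable.pred M (\<lambda>\<omega>. f \<omega> - g \<omega> \<in> sector a b s)"
  by measurable

lemma pred_cone [measurable (raw)]: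
  assumes [measurable]: "f \<in> borel_measurable M" "g \<in> borel_measurable M"
  shows "Measurable.pred M (\<lambda>\<omega>. f \<omega> \<in> cone \<theta> \<phi> (g \<omega>))"
  unfolding cone_eq_UN by measurable

lemma pred_nbr [measurable (raw)]:
  assumes [measurable]: "f \<in> borel_measurable M" "g \<in> borel_measurable M" "s \<in> borel_measurable M"
  shows "Measurable.pred M (\<lambda>\<omega>. f \<omega> \<in> nbr \<theta> \<phi> (s \<omega>) (g \<omega>))"
  unfolding nbr_def mem_Collect_eq by measurable

lemma nbr_borel [measurable]: "nbr \<theta> \<phi> s x \<in> sets borel"
proof -
  have "nbr \<theta> \<phi> s x = {y \<in> space borel. y \<in> nbr \<theta> \<phi> s x}" by simp
  also have "\<dots> \<in> sets borel" by measurable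
  finally show ?thesis .
qed

lemma dist_less_bdist:
  assumes "dist x y < bdist x"
  shows "y \<in> usq"
proof -
  have "\<bar>fst x - fst y\<bar> < bdist x" "\<bar>snd x - snd y\<bar> < bdist x"
    using dist_fst_le[of x y] dist_snd_le[of x y] assms by (auto simp: dist_real_def)
  then show ?thesis by (cases y) (auto simp: bdist_def)
qed

text \<open>Below the distance to the boundary the square cuts nothing off, and removing the vertex
  does not change the area, so the sector formula applies exactly.\<close>

lemma measure_nbr_interior:
  assumes "0 \<le> \<phi>" "\<phi> \<le> 2 * pi" "0 \<le> s" "s < bdist x"
  shows "measure unif_sq (nbr \<theta> \<phi> s x) = \<phi> * s\<^sup>2 / 2"
proof -
  have "nbr \<theta> \<phi> s x \<subseteq> usq"
    using assms by (auto simp: nbr_def intro!: dist_less_bdist[of x, THEN subsetD[OF equalityD1[OF refl]]] simp del: mem_Times_iff)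
  then have "measure unif_sq (nbr \<theta> \<phi> s x) = measure lborel (nbr \<theta> \<phi> s x)"
    by (simp add: measure_unif_sq Int_absorb1)
  also have "\<dots> = measure lborel {y. y - x \<in> sector \<theta> (\<theta> + \<phi>) s}"
  proof -
    have "{y. y - x \<in> sector \<theta> (\<theta> + \<phi>) s} = {y \<in> space borel. y - x \<in> sector \<theta> (\<theta> + \<phi>) s}" by simp
    also have "\<dots> \<in> sets borel" by measurable
    finally have m: "{y. y - x \<in> sector \<theta> (\<theta> + \<phi>) s} \<in> sets lborel" by simp
    show ?thesis unfolding nbr_eq measure_def
      by (subst emeasure_Diff_null_set) (use m in auto)
  qed
  also have "\<dots> = measure lborel (sector \<theta> (\<theta> + \<phi>) s)"
    using emeasure_lborel_translate[OF sector_borel, of "- x"] by (simp add: measure_def)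
  finally show ?thesis using assms by (simp add: measure_sector)
qed

section \<open>Lower bound for the area near the boundary\<close>

definition kappa :: "real \<Rightarrow> real" where
  "kappa \<phi> = sin (min \<phi> pi / 2) / 8"

lemma kappa_pos:
  assumes "0 < \<phi>" shows "0 < kappa \<phi>"
proof -
  have "min \<phi> pi / 2 < pi" using min.cobounded2[of \<phi> pi] pi_gt_zero by linarith
  then show ?thesis using assms by (simp add: kappa_def sin_gt_zero)
qed

lemma unit_dir_abs: "\<bar>fst (unit_dir t)\<bar> \<le> 1" "\<bar>snd (unit_dir t)\<bar> \<le> 1"
  by (auto simp: unit_dir_def abs_le_iff minus_le_iff)

text \<open>A far point y of the cone at x, together with a short segment in a second direction of the
  cone, spans a parallelogram inside the square; its area is linear in the distance of x from the
  boundary.\<close>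
lemma measure_nbr_ge:
  assumes \<phi>: "0 < \<phi>"
    and x: "0 < bdist x" and y: "y \<in> cone \<theta> \<phi> x" "y \<in> {0..1} \<times> {0..1}" and s: "0 < s" "s < dist x y"
  shows "kappa \<phi> * bdist x * s\<^sup>2 \<le> measure unif_sq (nbr \<theta> \<phi> s x)"
proof -
  \<comment> \<open>The half angle leaves room for a turn by \<open>\<psi>\<close> from every
    direction of the cone, forwards or backwards; the cap at \<open>pi\<close> keeps
    \<open>\<psi>\<close> at most a right angle, as the conic combination requires.\<close>
  define \<psi> where "\<psi> = min \<phi> pi / 2"
  have \<psi>: "0 < \<psi>" "\<psi> \<le> pi / 2" "2 * \<psi> \<le> \<phi>" using \<phi> by (auto simp: \<psi>_def)
  have sin_pos: "sin \<psi> > 0" using \<psi> by (intro sin_gt_zero) auto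
  define m where "m = min s (bdist x)"
  have m: "0 < m" "m \<le> s" "m \<le> bdist x" using s x by (auto simp: m_def)
  obtain R t where R: "0 \<le> R" "\<theta> \<le> t" "t \<le> \<theta> + \<phi>" and yR: "y = x + R *\<^sub>R unit_dir t"
    using y(1) unfolding mem_cone_iff by auto
  have "dist x y = R" using R by (simp add: yR dist_norm)
  then have Rs: "s < R" using s by simp
  have xs: "0 < fst x" "fst x < 1" "0 < snd x" "snd x < 1" using x by (auto simp: bdist_def)
  have "R \<le> 2"
  proof -
    have "dist x y \<le> \<bar>fst x - fst y\<bar> + \<bar>snd x - snd y\<bar>"
      unfolding dist_prod_def dist_real_def using sqrt_sum_squares_le_sum_abs by (metis power2_abs)
    also have "\<dots> \<le> 2" using xs y(2) by (cases y) auto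
    finally show ?thesis using \<open>dist x y = R\<close> by simp
  qed
  \<comment> \<open>The step along \<open>t\<close> moves \<open>x\<close> towards \<open>y\<close>
    by a fraction \<open>l\<close> of at most one half, so at least half of the margin
    \<open>bdist x\<close> to each side survives. The step shorter than \<open>m / 2\<close> in the
    other direction uses up less than that half.\<close>
  have sq: "x + a *\<^sub>R unit_dir t + b *\<^sub>R unit_dir t2 \<in> usq"
    if ab: "0 < a" "a < s / 2" "0 < b" "b < m / 2" for a b t2
  proof -
    define l where "l = a / R"
    have l: "0 \<le> l" "l \<le> 1 / 2" using ab Rs s by (auto simp: l_def field_simps)
    have z: "x + a *\<^sub>R unit_dir t = (1 - l) *\<^sub>R x + l *\<^sub>R y"
      using Rs s by (auto simp: yR l_def algebra_simps)
    have in01: "0 < p \<and> p \<le> 1" if "p = (1 - l) * u + l * v + b * d" "\<bar>d\<bar> \<le> 1" "0 \<le> v" "v \<le> 1"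
      "bdist x \<le> u" "bdist x \<le> 1 - u" for u v d p
    proof -
      have "\<bar>b * d\<bar> < bdist x / 2"
      proof -
        have "\<bar>b * d\<bar> \<le> b * 1" unfolding abs_mult using ab that by (intro mult_mono) auto
        then show ?thesis using ab m by simp
      qed
      moreover have "bdist x / 2 \<le> (1 - l) * u"
        using mult_mono[of "1/2" "1 - l" "bdist x" u] l that x by simp
      moreover have "0 \<le> l * v" using l that by simp
      moreover have "bdist x / 2 \<le> (1 - l) * (1 - u)"
        using mult_mono[of "1/2" "1 - l" "bdist x" "1 - u"] l that x by simp
      moreover have "0 \<le> l * (1 - v)" using l that by simp
      moreover have "1 - p = (1 - l) * (1 - u) + l * (1 - v) - b * d"
        unfolding that(1) by (simp add: algebra_simps)
      ultimately show ?thesis using that(1) by linarith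
    qed
    have "fst y \<in> {0..1}" "snd y \<in> {0..1}" using y(2) by (cases y; simp)+
    then show ?thesis
      unfolding z mem_Times_iff
      using in01[of _ "fst x" "fst y" "fst (unit_dir t2)"] in01[of _ "snd x" "snd y" "snd (unit_dir t2)"]
      by (auto simp: unit_dir_abs bdist_def)
  qed
  have sub: "z \<in> nbr \<theta> \<phi> s x"
    if z: "z = x + (a *\<^sub>R unit_dir t0 + b *\<^sub>R unit_dir (t0 + \<psi>))" and ab: "0 < a" "0 < b" "a + b \<le> s"
      and t0: "\<theta> \<le> t0" "t0 + \<psi> \<le> \<theta> + \<phi>" for a b t0 z
  proof -
    obtain r t' where r: "0 \<le> r" "t0 \<le> t'" "t' \<le> t0 + \<psi>"
      "a *\<^sub>R unit_dir t0 + b *\<^sub>R unit_dir (t0 + \<psi>) = r *\<^sub>R unit_dir t'"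
      using conic_combination[OF ab(1,2) \<psi>(1,2)] by metis
    have "norm (r *\<^sub>R unit_dir t') \<le> norm (a *\<^sub>R unit_dir t0) + norm (b *\<^sub>R unit_dir (t0 + \<psi>))"
      unfolding r(4)[symmetric] by (rule norm_triangle_ineq)
    then have "r \<le> s" using ab r by simp
    moreover have "r *\<^sub>R unit_dir t' \<noteq> 0"
    proof
      assume "r *\<^sub>R unit_dir t' = 0"
      then have "rot (- t0) (a *\<^sub>R unit_dir t0 + b *\<^sub>R unit_dir (t0 + \<psi>)) = 0"
        unfolding r(4) by (simp add: rot_def zero_prod_def)
      moreover have "a *\<^sub>R unit_dir t0 + b *\<^sub>R unit_dir (t0 + \<psi>) = rot t0 (- b * sin \<psi>, a + b * cos \<psi>)"
        by (simp add: unit_dir_def rot_def sin_add cos_add algebra_simps)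
      ultimately have "b * sin \<psi> = 0"
        by (simp add: rot_rot) (simp add: rot_def zero_prod_def)
      then show False using ab sin_pos by simp
    qed
    ultimately show ?thesis
      unfolding nbr_def mem_cone_iff z r(4) mem_Collect_eq using r(1-3) t0
      by (intro conjI exI[of _ r] exI[of _ t']) (auto simp: dist_norm)
  qed
  \<comment> \<open>If the turn forwards leaves the cone, then \<open>t\<close> is far enough from
    \<open>\<theta>\<close> for a turn backwards. \<open>t0\<close> is the smaller of the two
    directions, and the long and the short side exchange roles accordingly.\<close>
  obtain t0 l1 l2 where t0: "\<theta> \<le> t0" "t0 + \<psi> \<le> \<theta> + \<phi>"
    and l: "0 < l1" "0 < l2" "l1 * l2 = s * m / 4" "l1 + l2 \<le> s"
    and sq': "\<And>a b. 0 < a \<Longrightarrow> a < l1 \<Longrightarrow> 0 < b \<Longrightarrow> b < l2 \<Longrightarrow>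
         x + (a *\<^sub>R unit_dir t0 + b *\<^sub>R unit_dir (t0 + \<psi>)) \<in> usq"
  proof (cases "t + \<psi> \<le> \<theta> + \<phi>")
    case True
    have "x + (a *\<^sub>R unit_dir t + b *\<^sub>R unit_dir (t + \<psi>)) \<in> usq"
      if "0 < a" "a < s / 2" "0 < b" "b < m / 2" for a b
      using sq[OF that, of "t + \<psi>"] by (simp only: add.assoc)
    with True R s m show ?thesis
      by (intro that[of t "s / 2" "m / 2"]) simp_all
  next
    case False
    have "x + (a *\<^sub>R unit_dir (t - \<psi>) + b *\<^sub>R unit_dir (t - \<psi> + \<psi>)) \<in> usq"
      if "0 < a" "a < m / 2" "0 < b" "b < s / 2" for a b
      using sq[OF that(3,4,1,2), of "t - \<psi>"] by (simp add: ac_simps)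
    with False R s m \<psi> show ?thesis
      by (intro that[of "t - \<psi>" "m / 2" "s / 2"]) simp_all
  qed
  define P where "P = {z. z + (- x) \<in> parallelogram t0 \<psi> l1 l2}"
  have par: "parallelogram t0 \<psi> l1 l2 \<in> sets borel" using sin_pos by (rule parallelogram_borel)
  have P: "P \<subseteq> usq \<inter> nbr \<theta> \<phi> s x"
  proof
    fix z assume "z \<in> P"
    then obtain a b where ab: "z + (- x) = a *\<^sub>R unit_dir t0 + b *\<^sub>R unit_dir (t0 + \<psi>)" "0 < a" "a < l1" "0 < b" "b < l2"
      unfolding P_def parallelogram_def by blast
    then have z: "z = x + (a *\<^sub>R unit_dir t0 + b *\<^sub>R unit_dir (t0 + \<psi>))" by (simp add: algebra_simps)
    show "z \<in> usq \<inter> nbr \<theta> \<phi> s x"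
      using sub[OF z] sq'[of a b] ab l t0 unfolding z by auto
  qed
  have "ennreal (l1 * l2 * sin \<psi>) = emeasure lborel P"
    unfolding P_def using l(1,2)
    by (simp only: emeasure_lborel_translate[OF par] emeasure_parallelogram[OF sin_pos] less_imp_le)
  also have "\<dots> \<le> emeasure lborel (usq \<inter> nbr \<theta> \<phi> s x)"
    using P by (intro emeasure_mono) auto
  also have "\<dots> = emeasure unif_sq (nbr \<theta> \<phi> s x)" by (simp add: emeasure_unif_sq)
  finally have "l1 * l2 * sin \<psi> \<le> measure unif_sq (nbr \<theta> \<phi> s x)"
    by (simp add: unif_sq.emeasure_eq_measure)
  \<comment> \<open>Origin of the 8 in \<open>kappa\<close>: the halved sides give 1/4, and
    replacing the minimum \<open>m\<close> by the product \<open>bdist x * s / 2\<close> gives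
    another 1/2. The replacement is allowed because \<open>bdist x\<close> is at most 1 and
    \<open>s\<close> is below the crude diameter bound 2.\<close>
  moreover have "kappa \<phi> * bdist x * s\<^sup>2 \<le> l1 * l2 * sin \<psi>"
  proof -
    have "bdist x * s / 2 \<le> m"
    proof -
      have "bdist x \<le> 1" "s \<le> 2" using xs Rs \<open>R \<le> 2\<close> by (auto simp: bdist_def)
      then have "bdist x * s \<le> 1 * s" "bdist x * s \<le> bdist x * 2"
        using s x by (intro mult_right_mono mult_left_mono; simp)+
      then show ?thesis using s x by (auto simp: m_def)
    qed
    then have "(sin \<psi> * s / 4) * (bdist x * s / 2) \<le> (sin \<psi> * s / 4) * m"
      using s sin_pos by (intro mult_left_mono) auto
    then show ?thesis unfolding l(3) by (simp add: kappa_def \<psi>_def[symmetric] power2_eq_square mult_ac)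
  qed
  ultimately show ?thesis by simp
qed

text \<open>Positivity of \<open>bdist\<close> characterises the open square, so only the two null
  sides \<open>fst x = 1\<close> and \<open>snd x = 1\<close> of the half-open square have to be
  discarded.\<close>

lemma AE_bdist_pos: "AE x in unif_sq. 0 < bdist x"
proof -
  have "{x :: pt. (1, 0) \<bullet> x = 1} \<in> null_sets lborel" "{x :: pt. (0, 1) \<bullet> x = 1} \<in> null_sets lborel"
    using negligible_hyperplane[of "(1, 0) :: pt" 1] negligible_hyperplane[of "(0, 1) :: pt" 1]
      closed_hyperplane[of "(1, 0) :: pt" 1] closed_hyperplane[of "(0, 1) :: pt" 1]
    by (simp_all add: negligible_iff_null_sets null_sets_completion_iff borel_closed zero_prod_def)
  then have "AE x::pt in lborel. fst x \<noteq> 1" "AE x::pt in lborel. snd x \<noteq> 1"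
    by (auto dest!: AE_not_in simp: inner_prod_def)
  then have "AE x in lborel. x \<in> usq \<longrightarrow> 0 < bdist x"
    by eventually_elim (auto simp: bdist_def)
  then show ?thesis
    unfolding unif_sq_def by (subst AE_uniform_measure) (simp_all add: emeasure_usq)
qed

lemma bdist_measurable [measurable]: "bdist \<in> borel_measurable borel"
  unfolding bdist_def[abs_def] borel_prod[symmetric] by measurable

lemma nn_integral_unif_sq:
  assumes [measurable]: "f \<in> borel_measurable borel"
  shows "integral\<^sup>N unif_sq f = (\<integral>\<^sup>+x. f x * indicator usq x \<partial>lborel)"
  unfolding unif_sq_def
  apply (subst nn_integral_uniform_measure) apply measurable[1] apply measurable[1] by (simp only: emeasure_usq divide_ennreal_def) simp

lemma nn_integral_exp_unit:
  assumes "k > 0"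
  shows "(\<integral>\<^sup>+u. ennreal (exp (- k * u)) * indicator {0<..1} u \<partial>lborel) \<le> ennreal (1 / k)"
    and "(\<integral>\<^sup>+u. ennreal (exp (- k * (1 - u))) * indicator {0<..1} u \<partial>lborel) \<le> ennreal (1 / k)"
proof -
  have *: "(\<integral>\<^sup>+u. ennreal (exp (- k * u)) * indicator {0..} u \<partial>lborel) = ennreal (0 - (- exp (- k * 0) / k))"
  proof (rule nn_integral_FTC_atLeast)
    show "((\<lambda>u. - exp (- k * u) / k) has_real_derivative exp (- k * u)) (at u)" for u
      using assms by (auto intro!: derivative_eq_intros)
    show "((\<lambda>u. - exp (- k * u) / k) \<longlongrightarrow> 0) at_top"
      using assms by real_asymp
  qed auto
  show 1: "(\<integral>\<^sup>+u. ennreal (exp (- k * u)) * indicator {0<..1} u \<partial>lborel) \<le> ennreal (1 / k)"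
    using * by (intro order.trans[OF nn_integral_mono order.eq_iff[THEN iffD1, THEN conjunct1, OF *[simplified]]])
      (auto split: split_indicator)
  have "(\<integral>\<^sup>+u. ennreal (exp (- k * (1 - u))) * indicator {0<..1} u \<partial>lborel)
     = (\<integral>\<^sup>+u. ennreal (exp (- k * u)) * indicator {0..<1} u \<partial>lborel)"
    by (subst nn_integral_real_affine[where c = "-1" and t = 1])
      (auto intro!: nn_integral_cong split: split_indicator)
  also have "\<dots> \<le> ennreal (1 / k)"
    using * by (intro order.trans[OF nn_integral_mono order.eq_iff[THEN iffD1, THEN conjunct1, OF *[simplified]]])
      (auto split: split_indicator)
  finally show "(\<integral>\<^sup>+u. ennreal (exp (- k * (1 - u))) * indicator {0<..1} u \<partial>lborel) \<le> ennreal (1 / k)" .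
qed

lemma nn_integral_unif_sq_marginals:
  assumes [measurable]: "f \<in> borel_measurable borel"
  shows "(\<integral>\<^sup>+x. f (fst x) \<partial>unif_sq) = (\<integral>\<^sup>+u. f u * indicator {0<..1} u \<partial>lborel)"
    and "(\<integral>\<^sup>+x. f (snd x) \<partial>unif_sq) = (\<integral>\<^sup>+u. f u * indicator {0<..1} u \<partial>lborel)"
proof -
  let ?i = "indicator {0<..1} :: real \<Rightarrow> ennreal"
  have i: "indicator usq x = ?i (fst x) * ?i (snd x)" for x :: pt
    by (cases x) (simp add: indicator_def)
  have m: "(\<lambda>x::pt. f (fst x)) \<in> borel_measurable borel" "(\<lambda>x::pt. f (snd x)) \<in> borel_measurable borel"
    unfolding borel_prod[symmetric] by measurable
  have "(\<integral>\<^sup>+x. f (fst x) \<partial>unif_sq) = (\<integral>\<^sup>+x. (\<lambda>(u, v). (f u * ?i u) * ?i v) x \<partial>(lborel \<Otimes>\<^sub>M lborel))"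
    unfolding nn_integral_unif_sq[OF m(1)] lborel_prod[symmetric] i by (simp add: case_prod_unfold mult.assoc)
  also have "\<dots> = (\<integral>\<^sup>+u. \<integral>\<^sup>+v. (f u * ?i u) * ?i v \<partial>lborel \<partial>lborel)"
    by (subst lborel.nn_integral_fst[symmetric]) simp_all
  also have "\<dots> = (\<integral>\<^sup>+u. f u * ?i u \<partial>lborel)"
    by (subst nn_integral_cmult) simp_all
  finally show "(\<integral>\<^sup>+x. f (fst x) \<partial>unif_sq) = (\<integral>\<^sup>+u. f u * ?i u \<partial>lborel)" .
  have "(\<integral>\<^sup>+x. f (snd x) \<partial>unif_sq) = (\<integral>\<^sup>+x. (\<lambda>(u, v). ?i u * (f v * ?i v)) x \<partial>(lborel \<Otimes>\<^sub>M lborel))"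
    unfolding nn_integral_unif_sq[OF m(2)] lborel_prod[symmetric] i by (simp add: case_prod_unfold mult.left_commute)
  also have "\<dots> = (\<integral>\<^sup>+u. \<integral>\<^sup>+v. ?i u * (f v * ?i v) \<partial>lborel \<partial>lborel)"
    by (subst lborel.nn_integral_fst[symmetric]) simp_all
  also have "\<dots> = (\<integral>\<^sup>+u. ?i u * (\<integral>\<^sup>+v. f v * ?i v \<partial>lborel) \<partial>lborel)"
    by (subst nn_integral_cmult) simp_all
  also have "\<dots> = (\<integral>\<^sup>+v. f v * ?i v \<partial>lborel)"
    by (subst nn_integral_multc) simp_all
  finally show "(\<integral>\<^sup>+x. f (snd x) \<partial>unif_sq) = (\<integral>\<^sup>+u. f u * ?i u \<partial>lborel)" .
qed

text \<open>\<open>bdist\<close> is a minimum of four coordinate distances, so the exponential is at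
  most the sum of four exponentials, each of which integrates to at most \<open>1 / k\<close>. With
  \<open>k\<close> of order t^2 this becomes the tail bound of the domination.\<close>

lemma nn_integral_exp_bdist:
  assumes k: "k > 0"
  shows "(\<integral>\<^sup>+x. ennreal (exp (- k * bdist x)) \<partial>unif_sq) \<le> ennreal (4 / k)"
proof -
  let ?f = "\<lambda>u. ennreal (exp (- k * u))" and ?g = "\<lambda>u. ennreal (exp (- k * (1 - u)))"
  have [measurable]: "(\<lambda>x. ?f (fst x)) \<in> borel_measurable (borel :: pt measure)" "(\<lambda>x. ?g (fst x)) \<in> borel_measurable (borel :: pt measure)"
    "(\<lambda>x. ?f (snd x)) \<in> borel_measurable (borel :: pt measure)" "(\<lambda>x. ?g (snd x)) \<in> borel_measurable (borel :: pt measure)"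
    unfolding borel_prod[symmetric] by measurable
  have "(\<integral>\<^sup>+x. ennreal (exp (- k * bdist x)) \<partial>unif_sq)
      \<le> (\<integral>\<^sup>+x. (?f (fst x) + ?g (fst x)) + (?f (snd x) + ?g (snd x)) \<partial>unif_sq)"
  proof (rule nn_integral_mono)
    fix x
    have "exp (- k * bdist x) \<le> (exp (- k * fst x) + exp (- k * (1 - fst x))) + (exp (- k * snd x) + exp (- k * (1 - snd x)))"
      unfolding bdist_def min_def by (auto simp: add_increasing add_increasing2)
    then show "ennreal (exp (- k * bdist x)) \<le> (?f (fst x) + ?g (fst x)) + (?f (snd x) + ?g (snd x))"
      by (simp flip: ennreal_plus add: ennreal_leI)
  qed
  also have "\<dots> = ((\<integral>\<^sup>+x. ?f (fst x) \<partial>unif_sq) + (\<integral>\<^sup>+x. ?g (fst x) \<partial>unif_sq)) + ((\<integral>\<^sup>+x. ?f (snd x) \<partial>unif_sq) + (\<integral>\<^sup>+x. ?g (snd x) \<partial>unif_sq))"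
    by (subst nn_integral_add, measurable, subst nn_integral_add, measurable, subst nn_integral_add, measurable)
  also have "\<dots> \<le> (ennreal (1 / k) + ennreal (1 / k)) + (ennreal (1 / k) + ennreal (1 / k))"
    using nn_integral_exp_unit[OF k]
      nn_integral_unif_sq_marginals[of ?f] nn_integral_unif_sq_marginals[of ?g]
    by (intro add_mono) simp_all
  also have "\<dots> = ennreal (4 / k)"
    using k by (simp flip: ennreal_plus)
  finally show ?thesis .
qed

section \<open>Empty regions for independent uniform points\<close>

interpretation unif_prod: product_prob_space "\<lambda>_::nat. unif_sq" UNIV
  by unfold_locales

interpretation sample_space: prob_space "sample_space n" for n
  unfolding sample_space_def by (rule prob_space_PiM) (rule prob_space_unif_sq)

lemma sample_space_component [measurable]:
  "i < n \<Longrightarrow> (\<lambda>\<omega>. \<omega> i) \<in> borel_measurable (sample_space n)"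
  using measurable_component_singleton[of i "{..<n}" "\<lambda>_. unif_sq"]
  by (simp add: sample_space_def measurable_cong_sets[OF refl sets_unif_sq])

lemma pred_family:
  assumes "Measurable.pred (borel \<Otimes>\<^sub>M borel) (\<lambda>z. snd z \<in> V (fst z))"
    and "g \<in> borel_measurable M" "f \<in> borel_measurable M"
  shows "Measurable.pred M (\<lambda>\<omega>. f \<omega> \<in> V (g \<omega>))"
  using measurable_compose[OF measurable_Pair[OF assms(2,3)] assms(1)] by simp

text \<open>Conditioning on point \<open>i\<close>: given its position, the other
  \<open>n - 1\<close> points avoid the region independently. Index \<open>i\<close> is exempted
  explicitly so that families with \<open>x\<close> in \<open>V x\<close> are covered as
  well.\<close>

lemma nn_integral_sample_space_others:
  fixes V :: "pt \<Rightarrow> pt set" and g :: "pt \<Rightarrow> ennreal"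
  assumes i: "i < n"
    and g [measurable]: "g \<in> borel_measurable borel"
    and V: "Measurable.pred (borel \<Otimes>\<^sub>M borel) (\<lambda>z. snd z \<in> V (fst z))"
  shows "(\<integral>\<^sup>+\<omega>. g (\<omega> i) * indicator {\<omega>. \<forall>j<n. j \<noteq> i \<longrightarrow> \<omega> j \<notin> V (\<omega> i)} \<omega> \<partial>sample_space n) =
         (\<integral>\<^sup>+x. g x * ennreal ((1 - measure unif_sq (V x)) ^ (n - 1)) \<partial>unif_sq)"
proof -
  define I where "I = {..<n} - {i}"
  have I: "finite I" "i \<notin> I" "{..<n} = insert i I" "card I = n - 1" using i by (auto simp: I_def)
  note pred_family[OF V, measurable (raw)]
  have V1: "V x \<in> sets borel" for x
  proof -
    have "V x = {y \<in> space borel. y \<in> V x}" by simp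
    also have "\<dots> \<in> sets borel" by measurable
    finally show ?thesis .
  qed
  have [measurable]: "(\<lambda>\<omega>. g (\<omega> i) * indicator {\<omega>. \<forall>j<n. j \<noteq> i \<longrightarrow> \<omega> j \<notin> V (\<omega> i)} \<omega>) \<in> borel_measurable (sample_space n)"
    using i unfolding indicator_def by measurable
  have "(\<integral>\<^sup>+\<omega>. g (\<omega> i) * indicator {\<omega>. \<forall>j<n. j \<noteq> i \<longrightarrow> \<omega> j \<notin> V (\<omega> i)} \<omega> \<partial>sample_space n) =
     (\<integral>\<^sup>+y. (\<integral>\<^sup>+x. g ((x(i := y)) i) * indicator {\<omega>. \<forall>j<n. j \<noteq> i \<longrightarrow> \<omega> j \<notin> V (\<omega> i)} (x(i := y)) \<partial>Pi\<^sub>M I (\<lambda>_. unif_sq)) \<partial>unif_sq)"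
    unfolding sample_space_def I(3)
    by (subst unif_prod.product_nn_integral_insert_rev[OF I(1,2)])
      (simp_all flip: I(3) add: sample_space_def[symmetric])
  also have "\<dots> = (\<integral>\<^sup>+y. g y * ennreal ((1 - measure unif_sq (V y)) ^ (n - 1)) \<partial>unif_sq)"
  proof (rule nn_integral_cong)
    fix y
    have "indicator {\<omega>. \<forall>j<n. j \<noteq> i \<longrightarrow> \<omega> j \<notin> V (\<omega> i)} (x(i := y)) = (\<Prod>j\<in>I. indicator (- V y) (x j) :: ennreal)" for x
    proof (cases "\<forall>j\<in>I. x j \<notin> V y")
      case True
      then show ?thesis by (auto simp: indicator_def I_def)
    next
      case False
      then obtain j where "j \<in> I" "x j \<in> V y" by auto
      moreover from this have "(\<Prod>j\<in>I. indicator (- V y) (x j) :: ennreal) = 0"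
        using I(1) by (intro prod_zero bexI[of _ j]) auto
      ultimately show ?thesis by (auto simp: indicator_def I_def)
    qed
    then have "(\<integral>\<^sup>+x. g ((x(i := y)) i) * indicator {\<omega>. \<forall>j<n. j \<noteq> i \<longrightarrow> \<omega> j \<notin> V (\<omega> i)} (x(i := y)) \<partial>Pi\<^sub>M I (\<lambda>_. unif_sq))
       = (\<integral>\<^sup>+x. g y * (\<Prod>j\<in>I. indicator (- V y) (x j)) \<partial>Pi\<^sub>M I (\<lambda>_. unif_sq))"
      by simp
    also have "\<dots> = g y * (\<integral>\<^sup>+x. (\<Prod>j\<in>I. indicator (- V y) (x j)) \<partial>Pi\<^sub>M I (\<lambda>_. unif_sq))"
    proof (intro nn_integral_cmult borel_measurable_prod_ennreal)
      fix j assume "j \<in> I"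
      have "(indicator (- V y) :: pt \<Rightarrow> ennreal) \<in> borel_measurable unif_sq"
        using V1 by (intro borel_measurable_indicator) auto
      then show "(\<lambda>x. indicator (- V y) (x j) :: ennreal) \<in> borel_measurable (Pi\<^sub>M I (\<lambda>_. unif_sq))"
        by (rule measurable_compose[OF measurable_component_singleton[OF \<open>j \<in> I\<close>]])
    qed
    also have "(\<integral>\<^sup>+x. (\<Prod>j\<in>I. indicator (- V y) (x j)) \<partial>Pi\<^sub>M I (\<lambda>_. unif_sq)) = (\<Prod>j\<in>I. emeasure unif_sq (- V y))"
      using I(1) nn_integral_indicator[of "- V y" unif_sq] borel_comp[OF V1]
      by (subst unif_prod.product_nn_integral_prod) (auto intro!: borel_measurable_indicator borel_comp V1)
    also have "emeasure unif_sq (- V y) = ennreal (1 - measure unif_sq (V y))"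
      using unif_sq.prob_compl[of "V y"] V1 by (simp add: unif_sq.emeasure_eq_measure Compl_eq_Diff_UNIV)
    also have "(\<Prod>j\<in>I. ennreal (1 - measure unif_sq (V y))) = ennreal ((1 - measure unif_sq (V y)) ^ (n - 1))"
      by (simp add: I(4) ennreal_power)
    finally show "(\<integral>\<^sup>+x. g ((x(i := y)) i) * indicator {\<omega>. \<forall>j<n. j \<noteq> i \<longrightarrow> \<omega> j \<notin> V (\<omega> i)} (x(i := y)) \<partial>Pi\<^sub>M I (\<lambda>_. unif_sq))
       = g y * ennreal ((1 - measure unif_sq (V y)) ^ (n - 1))" .
  qed
  finally show ?thesis .
qed

lemma nn_integral_sample_space_miss:
  fixes V :: "pt \<Rightarrow> pt set" and g :: "pt \<Rightarrow> ennreal"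
  assumes i: "i < n" and irrefl: "\<And>x. x \<notin> V x"
    and g: "g \<in> borel_measurable borel"
    and V: "Measurable.pred (borel \<Otimes>\<^sub>M borel) (\<lambda>z. snd z \<in> V (fst z))"
  shows "(\<integral>\<^sup>+\<omega>. g (\<omega> i) * indicator {\<omega>. \<forall>j<n. \<omega> j \<notin> V (\<omega> i)} \<omega> \<partial>sample_space n) =
         (\<integral>\<^sup>+x. g x * ennreal ((1 - measure unif_sq (V x)) ^ (n - 1)) \<partial>unif_sq)"
proof -
  have "{\<omega>. \<forall>j<n. \<omega> j \<notin> V (\<omega> i)} = {\<omega>. \<forall>j<n. j \<noteq> i \<longrightarrow> \<omega> j \<notin> V (\<omega> i)}"
    using irrefl by metis
  then show ?thesis using nn_integral_sample_space_others[OF i g V] by simp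
qed

text \<open>Only an inequality, because the conditions that the points \<open>i\<close> and
  \<open>j\<close> avoid each other's regions are dropped; the second moment method asks for no more
  than an upper bound.\<close>

lemma nn_integral_sample_space_miss2:
  fixes V :: "pt \<Rightarrow> pt set"
  assumes ij: "i < n" "j < n" "i \<noteq> j"
    and V: "Measurable.pred (borel \<Otimes>\<^sub>M borel) (\<lambda>z. snd z \<in> V (fst z))"
  shows "(\<integral>\<^sup>+\<omega>. indicator {\<omega>. \<forall>k<n. \<omega> k \<notin> V (\<omega> i) \<union> V (\<omega> j)} \<omega> \<partial>sample_space n) \<le>
         (\<integral>\<^sup>+x. \<integral>\<^sup>+y. ennreal ((1 - measure unif_sq (V x \<union> V y)) ^ (n - 2)) \<partial>unif_sq \<partial>unif_sq)"
proof -
  define I where "I = {..<n} - {i, j}"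
  have I: "finite I" "i \<notin> I" "j \<notin> I" "{..<n} = insert i (insert j I)" "card I = n - 2"
    using ij by (auto simp: I_def card_Diff_subset)
  note pred_family[OF V, measurable (raw)]
  have V1: "V x \<in> sets borel" for x
  proof -
    have "V x = {y \<in> space borel. y \<in> V x}" by simp
    also have "\<dots> \<in> sets borel" by measurable
    finally show ?thesis .
  qed
  define f :: "(nat \<Rightarrow> pt) \<Rightarrow> ennreal" where "f = indicator {\<omega>. \<forall>k<n. \<omega> k \<notin> V (\<omega> i) \<union> V (\<omega> j)}"
  have f [measurable]: "f \<in> borel_measurable (sample_space n)"
    using ij unfolding indicator_def f_def Un_iff by measurable
  then have f' [measurable]: "f \<in> borel_measurable (PiM (insert i (insert j I)) (\<lambda>_. unif_sq))"
    unfolding sample_space_def I(4) .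
  have "integral\<^sup>N (sample_space n) f =
     (\<integral>\<^sup>+x. (\<integral>\<^sup>+w. f (w(i := x)) \<partial>Pi\<^sub>M (insert j I) (\<lambda>_. unif_sq)) \<partial>unif_sq)"
    unfolding sample_space_def I(4) using I(1,2) ij(3) f'
    by (subst unif_prod.product_nn_integral_insert_rev) simp_all
  also have "\<dots> = (\<integral>\<^sup>+x. \<integral>\<^sup>+y. \<integral>\<^sup>+w. f (w(j := y, i := x)) \<partial>Pi\<^sub>M I (\<lambda>_. unif_sq) \<partial>unif_sq \<partial>unif_sq)"
  proof (rule nn_integral_cong)
    fix x
    have [measurable]: "(\<lambda>w. w(i := x)) \<in> PiM (insert j I) (\<lambda>_. unif_sq) \<rightarrow>\<^sub>M PiM (insert i (insert j I)) (\<lambda>_. unif_sq)"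
      by (rule measurable_fun_upd[of _ "insert j I"]) auto
    show "(\<integral>\<^sup>+w. f (w(i := x)) \<partial>Pi\<^sub>M (insert j I) (\<lambda>_. unif_sq)) =
       (\<integral>\<^sup>+y. \<integral>\<^sup>+w. f (w(j := y, i := x)) \<partial>Pi\<^sub>M I (\<lambda>_. unif_sq) \<partial>unif_sq)"
      using I(1,3) by (subst unif_prod.product_nn_integral_insert_rev) simp_all
  qed
  also have "\<dots> \<le> (\<integral>\<^sup>+x. \<integral>\<^sup>+y. ennreal ((1 - measure unif_sq (V x \<union> V y)) ^ (n - 2)) \<partial>unif_sq \<partial>unif_sq)"
  proof (intro nn_integral_mono)
    fix x y
    have "f (w(j := y, i := x)) \<le> (\<Prod>k\<in>I. indicator (- (V x \<union> V y)) (w k))" for w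
    proof (cases "\<forall>k\<in>I. w k \<notin> V x \<union> V y")
      case True
      then show ?thesis by (auto simp: indicator_def f_def)
    next
      case False
      then obtain k where "k \<in> I" "w k \<in> V x \<union> V y" by auto
      then have "f (w(j := y, i := x)) = 0" using ij by (auto simp: f_def indicator_def I_def)
      then show ?thesis by simp
    qed
    then have "(\<integral>\<^sup>+w. f (w(j := y, i := x)) \<partial>Pi\<^sub>M I (\<lambda>_. unif_sq))
       \<le> (\<integral>\<^sup>+w. (\<Prod>k\<in>I. indicator (- (V x \<union> V y)) (w k)) \<partial>Pi\<^sub>M I (\<lambda>_. unif_sq))"
      by (intro nn_integral_mono)
    also have "\<dots> = (\<Prod>j\<in>I. emeasure unif_sq (- (V x \<union> V y)))"
      using V1 I(1) by (subst unif_prod.product_nn_integral_prod) (auto simp del: Compl_Un intro!: borel_measurable_indicator)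
    also have "emeasure unif_sq (- (V x \<union> V y)) = ennreal (1 - measure unif_sq (V x \<union> V y))"
      using unif_sq.prob_compl[of "V x \<union> V y"] V1
      by (simp add: unif_sq.emeasure_eq_measure Compl_eq_Diff_UNIV sets.Un del: Compl_Un)
    also have "(\<Prod>j\<in>I. ennreal (1 - measure unif_sq (V x \<union> V y))) = ennreal ((1 - measure unif_sq (V x \<union> V y)) ^ (n - 2))"
      by (simp add: I(5) ennreal_power)
    finally show "(\<integral>\<^sup>+w. f (w(j := y, i := x)) \<partial>Pi\<^sub>M I (\<lambda>_. unif_sq))
       \<le> ennreal ((1 - measure unif_sq (V x \<union> V y)) ^ (n - 2))" .
  qed
  finally show ?thesis unfolding f_def .
qed

lemma measure_family_measurable:
  fixes W :: "'a \<Rightarrow> pt set"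
  assumes W: "Measurable.pred (M \<Otimes>\<^sub>M borel) (\<lambda>z. snd z \<in> W (fst z))"
  shows "(\<lambda>x. measure unif_sq (W x)) \<in> borel_measurable M"
proof -
  have "{z \<in> space (M \<Otimes>\<^sub>M borel). snd z \<in> W (fst z)} \<in> sets (M \<Otimes>\<^sub>M borel)"
    using W by measurable
  then have "{z \<in> space (M \<Otimes>\<^sub>M borel). snd z \<in> W (fst z)} \<in> sets (M \<Otimes>\<^sub>M unif_sq)"
    using sets_pair_measure_cong[OF refl sets_unif_sq, of M] by simp
  then have "(\<lambda>x. emeasure unif_sq (Pair x -` {z \<in> space (M \<Otimes>\<^sub>M borel). snd z \<in> W (fst z)})) \<in> borel_measurable M"
    by (rule unif_sq.measurable_emeasure_Pair)
  then have "(\<lambda>x. emeasure unif_sq (W x)) \<in> borel_measurable M"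
    by (rule measurable_cong[THEN iffD1, rotated]) (auto simp: space_pair_measure intro!: arg_cong[where f = "emeasure unif_sq"])
  then show ?thesis unfolding measure_def by measurable
qed

lemma measure_nbr_measurable [measurable]:
  "(\<lambda>x. measure unif_sq (nbr \<theta> \<phi> s x)) \<in> borel_measurable borel"
  by (rule measure_family_measurable) measurable

lemma measure_nbr_Un_measurable [measurable]:
  "(\<lambda>z. measure unif_sq (nbr \<theta> \<phi> s (fst z) \<union> nbr \<theta> \<phi> s (snd z))) \<in> borel_measurable (borel \<Otimes>\<^sub>M borel)"
  by (rule measure_family_measurable) (unfold Un_iff, measurable)

section \<open>Limiting avoidance probabilities and the second moment method\<close>

lemma one_minus_over_power_limit: "(\<lambda>n. (1 - c / real n) ^ (n - k)) \<longlonglongrightarrow> exp (- c)"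
proof -
  have 1: "(\<lambda>n. (1 + (- c) / real n) ^ n) \<longlonglongrightarrow> exp (- c)"
    by (rule tendsto_exp_limit_sequentially)
  have "(\<lambda>n. (1 - c / real n) ^ k) \<longlonglongrightarrow> (1 - 0) ^ k"
    by (intro tendsto_intros lim_const_over_n)
  with 1 have 2: "(\<lambda>n. (1 + (- c) / real n) ^ n / (1 - c / real n) ^ k) \<longlonglongrightarrow> exp (- c) / 1"
    by (intro tendsto_divide) auto
  have "eventually (\<lambda>n. c / real n < 1) sequentially"
    using lim_const_over_n[of c] by (rule order_tendstoD) simp
  then have "eventually (\<lambda>n. (1 + (- c) / real n) ^ n / (1 - c / real n) ^ k = (1 - c / real n) ^ (n - k)) sequentially"
    using eventually_ge_at_top[of k]
    by eventually_elim (subst power_diff, auto)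
  from Lim_transform_eventually[OF 2 this] show ?thesis by simp
qed

lemma scaled_radius_less:
  assumes "0 < d"
  shows "eventually (\<lambda>n. t / sqrt (real n) < d) sequentially"
proof -
  have "(\<lambda>n. t / sqrt (real n)) \<longlonglongrightarrow> 0" by real_asymp
  then show ?thesis using assms by (rule order_tendstoD)
qed

lemma scaled_radius_square: "(t / sqrt (real n))\<^sup>2 = t\<^sup>2 / real n"
  by (simp add: power_divide)

text \<open>For almost every \<open>x\<close> the shrinking radius is eventually below
  \<open>bdist x\<close>. From then on the area is exact and the integrand has the form
  \<open>(1 - c / n) ^ (n - 1)\<close>; the bound 1 allows passing to the limit under the
  integral.\<close>

lemma limit_miss_one:
  assumes \<phi>: "0 < \<phi>" "\<phi> \<le> 2 * pi" and t: "0 < t"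
  shows "(\<lambda>n. \<integral>\<^sup>+x. ennreal ((1 - measure unif_sq (nbr \<theta> \<phi> (t / sqrt (real n)) x)) ^ (n - 1)) \<partial>unif_sq)
    \<longlonglongrightarrow> ennreal (exp (- (\<phi> * t\<^sup>2 / 2)))"
proof -
  have "(\<lambda>n. \<integral>\<^sup>+x. ennreal ((1 - measure unif_sq (nbr \<theta> \<phi> (t / sqrt (real n)) x)) ^ (n - 1)) \<partial>unif_sq)
    \<longlonglongrightarrow> (\<integral>\<^sup>+x. ennreal (exp (- (\<phi> * t\<^sup>2 / 2))) \<partial>unif_sq)"
  proof (rule nn_integral_dominated_convergence[where w = "\<lambda>_. 1"])
    show "AE x in unif_sq. (\<lambda>n. ennreal ((1 - measure unif_sq (nbr \<theta> \<phi> (t / sqrt (real n)) x)) ^ (n - 1)))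
       \<longlonglongrightarrow> ennreal (exp (- (\<phi> * t\<^sup>2 / 2)))"
      using AE_bdist_pos
    proof eventually_elim
      case (elim x)
      have "eventually (\<lambda>n. (1 - (\<phi> * t\<^sup>2 / 2) / real n) ^ (n - 1) =
          (1 - measure unif_sq (nbr \<theta> \<phi> (t / sqrt (real n)) x)) ^ (n - 1)) sequentially"
        using scaled_radius_less[OF elim, of t]
        by eventually_elim (use \<phi> t in \<open>simp add: measure_nbr_interior scaled_radius_square mult.commute\<close>)
      from Lim_transform_eventually[OF one_minus_over_power_limit this] show ?case
        by (intro tendsto_ennrealI)
    qed
    show "(\<integral>\<^sup>+y. 1 \<partial>unif_sq) < \<infinity>" using unif_sq.emeasure_space_1 by simp
  qed (auto intro!: always_eventually power_le_one simp: unif_sq.prob_le_1)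
  then show ?thesis by (simp add: unif_sq.emeasure_space_1[simplified])
qed

lemma AE_unif_sq_neq: "AE y in unif_sq. y \<noteq> x"
proof -
  have "emeasure unif_sq {x} \<le> emeasure lborel {x}"
    unfolding emeasure_unif_sq[OF borel_singleton[OF sets.empty_sets]] by (intro emeasure_mono) auto
  then have "{x} \<in> null_sets unif_sq" by (auto simp: null_sets_def)
  from AE_not_in[OF this] show ?thesis by simp
qed

text \<open>Distinct points have disjoint regions once the radius is below half their distance; then
  the areas add and the limit is the square of the one-point limit. The diagonal is null, and
  dominated convergence is applied to the inner and to the outer integral.\<close>

lemma limit_miss_two:
  assumes \<phi>: "0 < \<phi>" "\<phi> \<le> 2 * pi" and t: "0 < t"
  shows "(\<lambda>n. \<integral>\<^sup>+x. \<integral>\<^sup>+y. ennreal ((1 - measure unif_sq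
         (nbr \<theta> \<phi> (t / sqrt (real n)) x \<union> nbr \<theta> \<phi> (t / sqrt (real n)) y)) ^ (n - 2)) \<partial>unif_sq \<partial>unif_sq)
    \<longlonglongrightarrow> ennreal ((exp (- (\<phi> * t\<^sup>2 / 2)))\<^sup>2)" (is "(\<lambda>n. \<integral>\<^sup>+x. \<integral>\<^sup>+y. ?u n x y \<partial>_ \<partial>_) \<longlonglongrightarrow> ?c")
proof -
  have u1: "?u n x y \<le> 1" for n x y
    by (auto intro!: power_le_one simp: unif_sq.prob_le_1)
  have [measurable]: "(\<lambda>z. ?u n (fst z) (snd z)) \<in> borel_measurable (borel \<Otimes>\<^sub>M borel)" for n
    by measurable
  then have um [measurable]: "(\<lambda>z. ?u n (fst z) (snd z)) \<in> borel_measurable (unif_sq \<Otimes>\<^sub>M unif_sq)" for n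
    by measurable
  then have u1m: "?u n x \<in> borel_measurable unif_sq" for n x
    using measurable_compose[OF measurable_Pair1', of x unif_sq "\<lambda>z. ?u n (fst z) (snd z)" unif_sq borel] by simp
  have int1: "(\<integral>\<^sup>+y. 1 \<partial>unif_sq) = 1"
    by (simp add: unif_sq.emeasure_space_1[simplified])
  have inner: "(\<lambda>n. \<integral>\<^sup>+y. ?u n x y \<partial>unif_sq) \<longlonglongrightarrow> (\<integral>\<^sup>+y. ?c \<partial>unif_sq)" if x: "0 < bdist x" for x
  proof (rule nn_integral_dominated_convergence[where w = "\<lambda>_. 1"])
    show "AE y in unif_sq. (\<lambda>n. ?u n x y) \<longlonglongrightarrow> ?c"
      using AE_bdist_pos AE_unif_sq_neq[of x]
    proof eventually_elim
      case (elim y)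
      have "dist x y / 2 > 0" using elim by simp
      have "eventually (\<lambda>n. (1 - (\<phi> * t\<^sup>2) / real n) ^ (n - 2) =
          (1 - measure unif_sq (nbr \<theta> \<phi> (t / sqrt (real n)) x \<union> nbr \<theta> \<phi> (t / sqrt (real n)) y)) ^ (n - 2)) sequentially"
        using scaled_radius_less[OF elim(1), of t] scaled_radius_less[OF x, of t]
          scaled_radius_less[OF \<open>dist x y / 2 > 0\<close>, of t]
      proof eventually_elim
        case (elim n)
        have "nbr \<theta> \<phi> (t / sqrt (real n)) x \<inter> nbr \<theta> \<phi> (t / sqrt (real n)) y = {}"
        proof (rule ccontr)
          assume "\<not> ?thesis"
          then obtain z where "dist x z \<le> t / sqrt (real n)" "dist y z \<le> t / sqrt (real n)"
            by (auto simp: nbr_def)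
          then show False using dist_triangle2[of x y z] elim(3) by simp
        qed
        then have "measure unif_sq (nbr \<theta> \<phi> (t / sqrt (real n)) x \<union> nbr \<theta> \<phi> (t / sqrt (real n)) y) =
          measure unif_sq (nbr \<theta> \<phi> (t / sqrt (real n)) x) + measure unif_sq (nbr \<theta> \<phi> (t / sqrt (real n)) y)"
          by (intro unif_sq.finite_measure_Union) auto
        also have "\<dots> = (\<phi> * t\<^sup>2) / real n"
          using elim \<phi> t by (simp add: measure_nbr_interior scaled_radius_square)
        finally show ?case by simp
      qed
      from Lim_transform_eventually[OF one_minus_over_power_limit this] show ?case
        by (intro tendsto_ennrealI) (simp flip: exp_double)
    qed
    show "(\<integral>\<^sup>+y. 1 \<partial>unif_sq) < \<infinity>" unfolding int1 by simp
  qed (use u1 u1m in auto)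
  have "(\<lambda>n. \<integral>\<^sup>+x. \<integral>\<^sup>+y. ?u n x y \<partial>unif_sq \<partial>unif_sq) \<longlonglongrightarrow> (\<integral>\<^sup>+x. \<integral>\<^sup>+y. ?c \<partial>unif_sq \<partial>unif_sq)"
  proof (rule nn_integral_dominated_convergence[where w = "\<lambda>_. 1"])
    show "(\<lambda>x. \<integral>\<^sup>+y. ?u n x y \<partial>unif_sq) \<in> borel_measurable unif_sq" for n
      using unif_sq.borel_measurable_nn_integral_fst[OF um, of n] by simp
    show "AE x in unif_sq. (\<integral>\<^sup>+y. ?u n x y \<partial>unif_sq) \<le> 1" for n
      using nn_integral_mono[of unif_sq "?u n _" "\<lambda>_. 1"] u1 unfolding int1 by auto
    show "AE x in unif_sq. (\<lambda>n. \<integral>\<^sup>+y. ?u n x y \<partial>unif_sq) \<longlonglongrightarrow> (\<integral>\<^sup>+y. ?c \<partial>unif_sq)"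
      using AE_bdist_pos by eventually_elim (rule inner)
    show "(\<integral>\<^sup>+y. 1 \<partial>unif_sq) < \<infinity>" unfolding int1 by simp
  qed auto
  then show ?thesis by (simp add: unif_sq.emeasure_space_1[simplified])
qed

text \<open>True also when the cone at \<open>\<omega> i\<close> holds no other sample point, where
  the directed distance is 0 by convention. For positive \<open>s\<close> it therefore follows from
  a distance above \<open>s\<close> but does not imply it.\<close>

definition miss :: "real \<Rightarrow> real \<Rightarrow> real \<Rightarrow> nat \<Rightarrow> nat \<Rightarrow> (nat \<Rightarrow> pt) \<Rightarrow> bool" where
  "miss \<theta> \<phi> s n i \<omega> \<longleftrightarrow> (\<forall>j<n. \<omega> j \<notin> nbr \<theta> \<phi> s (\<omega> i))"

lemma miss_measurable [measurable]:
  "i < n \<Longrightarrow> Measurable.pred (sample_space n) (miss \<theta> \<phi> s n i)"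
  unfolding miss_def by measurable

lemma nbr_family: "Measurable.pred (borel \<Otimes>\<^sub>M borel) (\<lambda>z. snd z \<in> nbr \<theta> \<phi> s (fst z))"
  by measurable

lemma nbr_irrefl: "x \<notin> nbr \<theta> \<phi> s x"
  by (simp add: nbr_def)

text \<open>Nonnegativity of the variance of the absolute value of \<open>Z\<close>; the bound
  \<open>B\<close> secures integrability.\<close>

lemma (in prob_space) expectation_abs_le_sqrt:
  fixes Z :: "'a \<Rightarrow> real"
  assumes [measurable]: "Z \<in> borel_measurable M" and bd: "\<And>\<omega>. \<bar>Z \<omega>\<bar> \<le> B"
  shows "expectation (\<lambda>\<omega>. \<bar>Z \<omega>\<bar>) \<le> sqrt (expectation (\<lambda>\<omega>. (Z \<omega>)\<^sup>2))"
proof -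
  have 1: "integrable M (\<lambda>\<omega>. \<bar>Z \<omega>\<bar>)"
    by (rule integrable_const_bound[of _ B]) (use bd in auto)
  have 2: "integrable M (\<lambda>\<omega>. \<bar>Z \<omega>\<bar>\<^sup>2)"
    by (rule integrable_const_bound[of _ "B\<^sup>2"]) (use bd power_mono[OF bd, where n = 2] in auto)
  have "0 \<le> variance (\<lambda>\<omega>. \<bar>Z \<omega>\<bar>)" by (rule variance_positive)
  also have "\<dots> = expectation (\<lambda>\<omega>. (Z \<omega>)\<^sup>2) - (expectation (\<lambda>\<omega>. \<bar>Z \<omega>\<bar>))\<^sup>2"
    using variance_eq[OF 1 2] by simp
  finally show ?thesis by (intro real_le_rsqrt) simp
qed

text \<open>The mean absolute deviation from \<open>p\<close> is at most the root of the mean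
  square, which expands into the first two moments of the fraction. These are governed by the
  avoidance probabilities of one and of two points, with limits \<open>p\<close> and
  \<open>p^2\<close>.\<close>

lemma miss_mean_tendsto:
  assumes \<phi>: "0 < \<phi>" "\<phi> \<le> 2 * pi" and t: "0 < t"
  shows "(\<lambda>n. \<integral>\<omega>. \<bar>(\<Sum>i<n. of_bool (miss \<theta> \<phi> (t / sqrt (real n)) n i \<omega>)) / real n - exp (- (\<phi> * t\<^sup>2 / 2))\<bar> \<partial>sample_space n)
    \<longlonglongrightarrow> 0"
proof -
  define p where "p = exp (- (\<phi> * t\<^sup>2 / 2))"
  define J where "J n i \<omega> = (of_bool (miss \<theta> \<phi> (t / sqrt (real n)) n i \<omega>) :: real)" for n i \<omega>
  define Mn where "Mn n \<omega> = (\<Sum>i<n. J n i \<omega>) / real n" for n \<omega>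
  define e where "e n = (\<integral>\<^sup>+x. ennreal ((1 - measure unif_sq (nbr \<theta> \<phi> (t / sqrt (real n)) x)) ^ (n - 1)) \<partial>unif_sq)" for n
  define f where "f n = (\<integral>\<^sup>+x. \<integral>\<^sup>+y. ennreal ((1 - measure unif_sq
         (nbr \<theta> \<phi> (t / sqrt (real n)) x \<union> nbr \<theta> \<phi> (t / sqrt (real n)) y)) ^ (n - 2)) \<partial>unif_sq \<partial>unif_sq)" for n
  have e_lim: "e \<longlonglongrightarrow> ennreal p" unfolding e_def[abs_def] p_def by (rule limit_miss_one[OF \<phi> t])
  have f_lim: "f \<longlonglongrightarrow> ennreal (p\<^sup>2)" unfolding f_def[abs_def] p_def by (rule limit_miss_two[OF \<phi> t])
  have e_fin: "e n \<le> 1" for n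
  proof -
    have "e n \<le> (\<integral>\<^sup>+x. 1 \<partial>unif_sq)"
      unfolding e_def by (intro nn_integral_mono) (auto intro!: power_le_one simp: unif_sq.prob_le_1)
    then show ?thesis using unif_sq.emeasure_space_1 by simp
  qed
  have f_fin: "f n \<le> 1" for n
  proof -
    have "f n \<le> (\<integral>\<^sup>+x. \<integral>\<^sup>+y. 1 \<partial>unif_sq \<partial>unif_sq)"
      unfolding f_def by (intro nn_integral_mono) (auto intro!: power_le_one simp: unif_sq.prob_le_1)
    then show ?thesis using unif_sq.emeasure_space_1 by simp
  qed
  have e_lim': "(\<lambda>n. enn2real (e n)) \<longlonglongrightarrow> p"
    using tendsto_enn2real[OF e_lim] by (simp add: p_def)
  have f_lim': "(\<lambda>n. enn2real (f n)) \<longlonglongrightarrow> p\<^sup>2"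
    using tendsto_enn2real[OF f_lim] by (simp add: p_def)
  have Jm [measurable]: "J n i \<in> borel_measurable (sample_space n)" if "i < n" for n i
    using that unfolding J_def by measurable
  have J01: "0 \<le> J n i \<omega>" "J n i \<omega> \<le> 1" for n i \<omega> by (auto simp: J_def)
  have Ji: "integrable (sample_space n) (J n i)" if "i < n" for n i
    by (rule sample_space.integrable_const_bound[of _ 1]) (use that J01 in auto)
  have Jij: "integrable (sample_space n) (\<lambda>\<omega>. J n i \<omega> * J n j \<omega>)" if "i < n" "j < n" for n i j
    by (rule sample_space.integrable_const_bound[of _ 1]) (use that J01 in \<open>auto simp: abs_mult mult_le_one\<close>)
  have EJ: "(\<integral>\<omega>. J n i \<omega> \<partial>sample_space n) = enn2real (e n)" if "i < n" for n i
  proof -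
    have "(\<integral>\<omega>. J n i \<omega> \<partial>sample_space n) = enn2real (\<integral>\<^sup>+\<omega>. ennreal (J n i \<omega>) \<partial>sample_space n)"
      using that J01 by (intro integral_eq_nn_integral) auto
    also have "(\<integral>\<^sup>+\<omega>. ennreal (J n i \<omega>) \<partial>sample_space n) =
      (\<integral>\<^sup>+\<omega>. 1 * indicator {\<omega>. \<forall>j<n. \<omega> j \<notin> nbr \<theta> \<phi> (t / sqrt (real n)) (\<omega> i)} \<omega> \<partial>sample_space n)"
      by (intro nn_integral_cong) (auto simp: J_def miss_def indicator_def)
    also have "\<dots> = e n"
      unfolding e_def by (subst nn_integral_sample_space_miss[OF that nbr_irrefl _ nbr_family]) auto
    finally show ?thesis .
  qed
  have EJJ: "(\<integral>\<omega>. J n i \<omega> * J n j \<omega> \<partial>sample_space n) \<le> enn2real (f n)" if "i < n" "j < n" "i \<noteq> j" for n i j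
  proof -
    have "(\<integral>\<omega>. J n i \<omega> * J n j \<omega> \<partial>sample_space n) = enn2real (\<integral>\<^sup>+\<omega>. ennreal (J n i \<omega> * J n j \<omega>) \<partial>sample_space n)"
      using that J01 by (intro integral_eq_nn_integral) auto
    also have "(\<integral>\<^sup>+\<omega>. ennreal (J n i \<omega> * J n j \<omega>) \<partial>sample_space n) =
      (\<integral>\<^sup>+\<omega>. indicator {\<omega>. \<forall>k<n. \<omega> k \<notin> nbr \<theta> \<phi> (t / sqrt (real n)) (\<omega> i) \<union> nbr \<theta> \<phi> (t / sqrt (real n)) (\<omega> j)} \<omega> \<partial>sample_space n)"
      by (intro nn_integral_cong) (auto simp: J_def miss_def indicator_def)
    also have "enn2real \<dots> \<le> enn2real (f n)"
    proof (rule enn2real_mono)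
      show "f n < \<top>" using f_fin[of n] by (rule order.strict_trans1) simp
    qed (unfold f_def, rule nn_integral_sample_space_miss2[OF that nbr_family])
    finally show ?thesis .
  qed
  have M01: "0 \<le> Mn n \<omega>" "Mn n \<omega> \<le> 1" for n \<omega>
  proof -
    show "0 \<le> Mn n \<omega>" unfolding Mn_def using J01 by (intro divide_nonneg_nonneg sum_nonneg) auto
    have "(\<Sum>i<n. J n i \<omega>) \<le> (\<Sum>i<n. 1)" using J01 by (intro sum_mono) auto
    then show "Mn n \<omega> \<le> 1" unfolding Mn_def by (auto simp: divide_le_eq)
  qed
  have Mm [measurable]: "Mn n \<in> borel_measurable (sample_space n)" for n
    unfolding Mn_def by measurable
  have p01: "0 < p" "p \<le> 1" using \<phi> by (auto simp: p_def)
  \<comment> \<open>Upper bound for the mean square of \<open>Mn n - p\<close>: at most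
    \<open>1 / n\<close> beyond \<open>f n\<close> for the second moment, and the exact mean
    \<open>e n\<close> in the cross term. The limit is
    \<open>p^2 - 2 * p^2 + p^2 = 0\<close>.\<close>
  define q where "q n = 1 / real n + enn2real (f n) - 2 * p * enn2real (e n) + p\<^sup>2" for n
  have "(\<lambda>n. sqrt (q n)) \<longlonglongrightarrow> sqrt (0 + p\<^sup>2 - 2 * p * p + p\<^sup>2)"
    unfolding q_def by (intro tendsto_intros e_lim' f_lim' lim_1_over_n)
  then have q0: "(\<lambda>n. sqrt (q n)) \<longlonglongrightarrow> 0" by (simp add: power2_eq_square)
  have bound: "(\<integral>\<omega>. \<bar>Mn n \<omega> - p\<bar> \<partial>sample_space n) \<le> sqrt (q n)" if n: "n > 0" for n
  proof -
    have EM: "(\<integral>\<omega>. Mn n \<omega> \<partial>sample_space n) = enn2real (e n)"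
      unfolding Mn_def using n Ji EJ by (simp add: Bochner_Integration.integral_sum)
    have "(\<integral>\<omega>. (Mn n \<omega>)\<^sup>2 \<partial>sample_space n) = (\<Sum>i<n. \<Sum>j<n. \<integral>\<omega>. J n i \<omega> * J n j \<omega> \<partial>sample_space n) / (real n)\<^sup>2"
    proof -
      have "(\<integral>\<omega>. (\<Sum>i<n. \<Sum>j<n. J n i \<omega> * J n j \<omega>) \<partial>sample_space n) = (\<Sum>i<n. \<integral>\<omega>. (\<Sum>j<n. J n i \<omega> * J n j \<omega>) \<partial>sample_space n)"
        using Jij by (intro Bochner_Integration.integral_sum Bochner_Integration.integrable_sum) auto
      also have "\<dots> = (\<Sum>i<n. \<Sum>j<n. \<integral>\<omega>. J n i \<omega> * J n j \<omega> \<partial>sample_space n)"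
        using Jij by (intro sum.cong refl Bochner_Integration.integral_sum) auto
      finally show ?thesis
        unfolding Mn_def power_divide power2_eq_square[of "sum _ _"] sum_product by simp
    qed
    \<comment> \<open>Every pair is charged \<open>f n\<close>, the diagonal ones included, and each
      of the \<open>n\<close> diagonal pairs an extra 1; after division by \<open>n^2\<close> the
      diagonal costs only \<open>1 / n\<close>.\<close>
    also have "\<dots> \<le> (\<Sum>i<n. \<Sum>j<n. (if i = j then 1 else 0) + enn2real (f n)) / (real n)\<^sup>2"
    proof (intro divide_right_mono sum_mono)
      fix i j assume ij: "i \<in> {..<n}" "j \<in> {..<n}"
      show "(\<integral>\<omega>. J n i \<omega> * J n j \<omega> \<partial>sample_space n) \<le> (if i = j then 1 else 0) + enn2real (f n)"
      proof (cases "i = j")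
        case True
        have "(\<integral>\<omega>. J n i \<omega> * J n j \<omega> \<partial>sample_space n) \<le> (\<integral>\<omega>. 1 \<partial>sample_space n)"
          using ij Jij J01 by (intro integral_mono) (auto simp: mult_le_one)
        then show ?thesis using True sample_space.prob_space[of n] by (simp add: add_increasing2)
      qed (use EJJ ij in auto)
    qed simp
    also have "\<dots> = (real n + (real n)\<^sup>2 * enn2real (f n)) / (real n)\<^sup>2"
      by (simp add: sum.distrib power2_eq_square distrib_left)
    also have "\<dots> = 1 / real n + enn2real (f n)"
      using n by (simp add: add_divide_distrib power2_eq_square)
    finally have EM2: "(\<integral>\<omega>. (Mn n \<omega>)\<^sup>2 \<partial>sample_space n) \<le> 1 / real n + enn2real (f n)" .
    have i1: "integrable (sample_space n) (Mn n)"
      by (rule sample_space.integrable_const_bound[of _ 1]) (use M01 in auto)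
    have i2: "integrable (sample_space n) (\<lambda>\<omega>. (Mn n \<omega>)\<^sup>2)"
      by (rule sample_space.integrable_const_bound[of _ 1]) (use M01 in \<open>auto intro!: power_le_one\<close>)
    have "(\<integral>\<omega>. (Mn n \<omega> - p)\<^sup>2 \<partial>sample_space n) = (\<integral>\<omega>. (Mn n \<omega>)\<^sup>2 - 2 * p * Mn n \<omega> + p\<^sup>2 \<partial>sample_space n)"
      by (simp add: power2_eq_square algebra_simps)
    also have "\<dots> = (\<integral>\<omega>. (Mn n \<omega>)\<^sup>2 \<partial>sample_space n) - 2 * p * enn2real (e n) + p\<^sup>2"
      using i1 i2 EM sample_space.prob_space by simp
    also have "\<dots> \<le> q n" unfolding q_def using EM2 by simp
    finally have "sqrt (\<integral>\<omega>. (Mn n \<omega> - p)\<^sup>2 \<partial>sample_space n) \<le> sqrt (q n)" by simp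
    moreover have "\<bar>Mn n \<omega> - p\<bar> \<le> 1" for \<omega> using M01[of n \<omega>] p01 by (auto simp: abs_le_iff)
    then have "(\<integral>\<omega>. \<bar>Mn n \<omega> - p\<bar> \<partial>sample_space n) \<le> sqrt (\<integral>\<omega>. (Mn n \<omega> - p)\<^sup>2 \<partial>sample_space n)"
      by (intro sample_space.expectation_abs_le_sqrt) auto
    ultimately show ?thesis by (rule order.trans[rotated])
  qed
  have "(\<lambda>n. \<integral>\<omega>. \<bar>Mn n \<omega> - p\<bar> \<partial>sample_space n) \<longlonglongrightarrow> 0"
  proof (rule tendsto_sandwich[OF _ _ tendsto_const q0])
    show "eventually (\<lambda>n. (\<integral>\<omega>. \<bar>Mn n \<omega> - p\<bar> \<partial>sample_space n) \<le> sqrt (q n)) sequentially"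
      using eventually_gt_at_top[of 0] by eventually_elim (rule bound)
  qed (simp add: always_eventually)
  then show ?thesis by (simp add: Mn_def J_def p_def)
qed

section \<open>Tail estimates and the layer cake formula\<close>

lemma powr_less_base_iff:
  fixes x y a :: real
  assumes "0 < a" "0 \<le> x" "0 \<le> y"
  shows "x powr a < y powr a \<longleftrightarrow> x < y"
  using assms powr_less_mono2[of a x y] powr_mono2[of a y x] by linarith

lemma powr_inverse_less_iff:
  fixes \<alpha> v d :: real
  assumes "0 < \<alpha>" "0 < v" "0 \<le> d"
  shows "v powr (1 / \<alpha>) < d \<longleftrightarrow> v < d powr \<alpha>"
  using powr_less_base_iff[of \<alpha> "v powr (1 / \<alpha>)" d] assms by (simp add: powr_powr)

text \<open>The layer cake is taken in the variable of the power itself: \<open>v\<close> is below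
  \<open>d powr \<alpha>\<close> exactly when \<open>v powr (1 / \<alpha>)\<close> is below
  \<open>d\<close>. So no density appears, only Lebesgue measure on the half line.\<close>

lemma powr_layer_cake:
  fixes \<alpha> d :: real
  assumes "0 < \<alpha>" "0 \<le> d"
  shows "has_bochner_integral lborel (\<lambda>v. indicator {0<..} v * of_bool (v powr (1 / \<alpha>) < d)) (d powr \<alpha>)"
proof -
  have "has_bochner_integral lborel (indicator {0<..<d powr \<alpha>} :: real \<Rightarrow> real) (measure lborel {0<..<d powr \<alpha>})"
    by (rule has_bochner_integral_real_indicator) auto
  moreover have "indicator {0<..} v * of_bool (v powr (1 / \<alpha>) < d) = (indicator {0<..<d powr \<alpha>} v :: real)" for v
    using powr_inverse_less_iff[OF assms(1) _ assms(2), of v] by (auto simp: indicator_def)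
  ultimately show ?thesis by simp
qed

lemma nn_integral_exp_tail:
  "(\<integral>\<^sup>+u. ennreal (exp (- u)) * indicator {a..} u \<partial>lborel) = ennreal (exp (- a))"
proof -
  have "(\<integral>\<^sup>+u. ennreal (exp (- u)) * indicator {a..} u \<partial>lborel) = ennreal (0 - (- exp (- a)))"
  proof (rule nn_integral_FTC_atLeast)
    show "((\<lambda>u. - exp (- u)) has_real_derivative exp (- u)) (at u)" for u :: real
      by (auto intro!: derivative_eq_intros)
    show "((\<lambda>u::real. - exp (- u)) \<longlongrightarrow> 0) at_top" by real_asymp
  qed auto
  then show ?thesis by simp
qed

text \<open>The tail \<open>exp (- a)\<close> is written as the integral of \<open>exp (- u)\<close>
  over \<open>u \<ge> a\<close>. After exchanging the integrals, the one over \<open>v\<close> is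
  the length \<open>(2 * u / \<phi>) powr (\<alpha> / 2)\<close>, and what remains is the Gamma
  integral at \<open>1 + \<alpha> / 2\<close>.\<close>

lemma nn_integral_gaussian_tail:
  assumes "0 < \<alpha>" "0 < \<phi>"
  shows "(\<integral>\<^sup>+v. ennreal (exp (- (\<phi> * (v powr (1 / \<alpha>))\<^sup>2 / 2))) * indicator {0<..} v \<partial>lborel) =
    ennreal ((2 / \<phi>) powr (\<alpha> / 2) * Gamma (1 + \<alpha> / 2))"
proof -
  have iff: "\<phi> * (v powr (1 / \<alpha>))\<^sup>2 / 2 \<le> u \<longleftrightarrow> 0 \<le> u \<and> v \<le> (2 * u / \<phi>) powr (\<alpha> / 2)" if v: "0 < v" for u v
  proof (cases "0 \<le> u")
    case True
    have "\<phi> * (v powr (1 / \<alpha>))\<^sup>2 / 2 \<le> u \<longleftrightarrow> v powr (1 / (\<alpha> / 2)) \<le> 2 * u / \<phi>"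
      using assms by (simp add: field_simps power2_eq_square flip: powr_add)
    also have "\<dots> \<longleftrightarrow> v \<le> (2 * u / \<phi>) powr (\<alpha> / 2)"
    proof -
      have "0 \<le> 2 * u / \<phi>" using True assms by simp
      then have "(2 * u / \<phi>) powr (\<alpha> / 2) < v \<longleftrightarrow> 2 * u / \<phi> < v powr (1 / (\<alpha> / 2))"
        using powr_less_base_iff[of "\<alpha> / 2" "2 * u / \<phi>" "v powr (1 / (\<alpha> / 2))"] assms v
        by (simp add: powr_powr)
      then show ?thesis by (metis not_less)
    qed
    finally show ?thesis using True by simp
  next
    case False
    moreover have "0 \<le> \<phi> * (v powr (1 / \<alpha>))\<^sup>2 / 2" using assms by simp
    ultimately show ?thesis by linarith
  qed
  have "(\<integral>\<^sup>+v. ennreal (exp (- (\<phi> * (v powr (1 / \<alpha>))\<^sup>2 / 2))) * indicator {0<..} v \<partial>lborel) =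
    (\<integral>\<^sup>+v. \<integral>\<^sup>+u. ennreal (exp (- u)) * (indicator {\<phi> * (v powr (1 / \<alpha>))\<^sup>2 / 2..} u * indicator {0<..} v) \<partial>lborel \<partial>lborel)"
    by (intro nn_integral_cong) (simp add: nn_integral_exp_tail nn_integral_multc flip: mult.assoc)
  also have "\<dots> = (\<integral>\<^sup>+v. \<integral>\<^sup>+u. ennreal (exp (- u)) * (indicator {0..} u * indicator {0<..(2 * u / \<phi>) powr (\<alpha> / 2)} v) \<partial>lborel \<partial>lborel)"
    using iff by (intro nn_integral_cong) (auto simp: indicator_def)
  also have "\<dots> = (\<integral>\<^sup>+u. \<integral>\<^sup>+v. ennreal (exp (- u)) * (indicator {0..} u * indicator {0<..(2 * u / \<phi>) powr (\<alpha> / 2)} v) \<partial>lborel \<partial>lborel)"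
    unfolding indicator_def greaterThanAtMost_iff by (intro lborel_pair.Fubini') measurable
  also have "\<dots> = (\<integral>\<^sup>+u. ennreal ((2 / \<phi>) powr (\<alpha> / 2)) * ennreal (indicator {0..} u * u powr (1 + \<alpha> / 2 - 1) / exp u) \<partial>lborel)"
  proof (rule nn_integral_cong)
    fix u :: real
    have "(\<integral>\<^sup>+v. ennreal (exp (- u)) * (indicator {0..} u * indicator {0<..(2 * u / \<phi>) powr (\<alpha> / 2)} v) \<partial>lborel)
      = ennreal (exp (- u)) * (indicator {0..} u * ennreal ((2 * u / \<phi>) powr (\<alpha> / 2)))"
      by (simp add: nn_integral_cmult flip: mult.assoc)
    also have "\<dots> = ennreal ((2 / \<phi>) powr (\<alpha> / 2)) * ennreal (indicator {0..} u * u powr (1 + \<alpha> / 2 - 1) / exp u)"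
    proof (cases "0 \<le> u")
      case True
      then have "(2 * u / \<phi>) powr (\<alpha> / 2) = (2 / \<phi>) powr (\<alpha> / 2) * u powr (\<alpha> / 2)"
        using assms powr_mult[of "2 / \<phi>" u "\<alpha> / 2"] by simp
      then show ?thesis using True by (simp add: exp_minus field_simps flip: ennreal_mult)
    qed simp
    finally show "(\<integral>\<^sup>+v. ennreal (exp (- u)) * (indicator {0..} u * indicator {0<..(2 * u / \<phi>) powr (\<alpha> / 2)} v) \<partial>lborel)
      = ennreal ((2 / \<phi>) powr (\<alpha> / 2)) * ennreal (indicator {0..} u * u powr (1 + \<alpha> / 2 - 1) / exp u)" .
  qed
  also have "\<dots> = ennreal ((2 / \<phi>) powr (\<alpha> / 2)) * ennreal (Gamma (1 + \<alpha> / 2))"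
    using assms Gamma_conv_nn_integral_real[of "1 + \<alpha> / 2"] by (subst nn_integral_cmult) auto
  finally show ?thesis by (simp add: ennreal_mult')
qed

section \<open>Tail bound uniform in the number of points\<close>

lemma AE_sample_space_bdist: "i < n \<Longrightarrow> AE \<omega> in sample_space n. 0 < bdist (\<omega> i)"
  unfolding sample_space_def
  by (rule AE_PiM_component[of "{..<n}" "\<lambda>_. unif_sq"]) (auto simp: prob_space_unif_sq AE_bdist_pos)

text \<open>The far point supplied by \<open>E\<close> makes the empty region large in proportion to
  \<open>bdist\<close>, so its avoidance by the other \<open>n - 1\<close> points is exponentially
  unlikely away from the boundary; averaging over the position leaves order
  \<open>1 / t^2\<close>.\<close>

lemma exceedance_bound:
  assumes \<phi>: "0 < \<phi>" and n: "2 \<le> n" "i < n" and t: "0 < t"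
    and E: "AE \<omega> in sample_space n. E \<omega> \<longrightarrow> miss \<theta> \<phi> (t / sqrt (real n)) n i \<omega> \<and>
        (\<exists>y\<in>{0..1}\<times>{0..1}. y \<in> cone \<theta> \<phi> (\<omega> i) \<and> t / sqrt (real n) < dist (\<omega> i) y)"
  shows "(\<integral>\<^sup>+\<omega>. indicator {\<omega>. E \<omega>} \<omega> \<partial>sample_space n) \<le> ennreal (8 / (kappa \<phi> * t\<^sup>2))"
proof -
  define s where "s = t / sqrt (real n)"
  have s: "0 < s" "s\<^sup>2 = t\<^sup>2 / real n" using t n by (auto simp: s_def scaled_radius_square)
  \<comment> \<open>The far point may depend on the whole sample and is no longer available after
    conditioning on the position of point \<open>i\<close>. Its consequence, the area bound, depends
    on that position alone and is kept as membership in \<open>A\<close>.\<close>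
  define A where "A = {x. 0 < bdist x \<and> kappa \<phi> * bdist x * s\<^sup>2 \<le> measure unif_sq (nbr \<theta> \<phi> s x)}"
  have "A = {x \<in> space borel. 0 < bdist x \<and> kappa \<phi> * bdist x * s\<^sup>2 \<le> measure unif_sq (nbr \<theta> \<phi> s x)}"
    by (simp add: A_def)
  also have "\<dots> \<in> sets borel" by measurable
  finally have A: "A \<in> sets borel" .
  have "(\<integral>\<^sup>+\<omega>. indicator {\<omega>. E \<omega>} \<omega> \<partial>sample_space n) \<le>
     (\<integral>\<^sup>+\<omega>. indicator A (\<omega> i) * indicator {\<omega>. \<forall>j<n. \<omega> j \<notin> nbr \<theta> \<phi> s (\<omega> i)} \<omega> \<partial>sample_space n)"
  proof (rule nn_integral_mono_AE)
    show "AE \<omega> in sample_space n. indicator {\<omega>. E \<omega>} \<omega> \<le> (indicator A (\<omega> i) * indicator {\<omega>. \<forall>j<n. \<omega> j \<notin> nbr \<theta> \<phi> s (\<omega> i)} \<omega> :: ennreal)"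
      using E AE_sample_space_bdist[OF n(2)]
    proof eventually_elim
      case (elim \<omega>)
      show ?case
      proof (cases "E \<omega>")
        case True
        with elim obtain y where "miss \<theta> \<phi> s n i \<omega>" "y \<in> {0..1} \<times> {0..1}" "y \<in> cone \<theta> \<phi> (\<omega> i)" "s < dist (\<omega> i) y"
          by (auto simp: s_def)
        moreover from this have "\<omega> i \<in> A"
          using measure_nbr_ge[OF \<phi> elim(2), of y \<theta> s] s elim(2) by (auto simp: A_def)
        ultimately show ?thesis by (simp add: miss_def indicator_def)
      qed simp
    qed
  qed
  also have "\<dots> = (\<integral>\<^sup>+x. indicator A x * ennreal ((1 - measure unif_sq (nbr \<theta> \<phi> s x)) ^ (n - 1)) \<partial>unif_sq)"
    using A by (intro nn_integral_sample_space_miss[OF n(2) nbr_irrefl _ nbr_family]) auto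
  also have "\<dots> \<le> (\<integral>\<^sup>+x. ennreal (exp (- (kappa \<phi> * s\<^sup>2 * real (n - 1)) * bdist x)) \<partial>unif_sq)"
  proof (rule nn_integral_mono)
    fix x
    show "indicator A x * ennreal ((1 - measure unif_sq (nbr \<theta> \<phi> s x)) ^ (n - 1)) \<le>
        ennreal (exp (- (kappa \<phi> * s\<^sup>2 * real (n - 1)) * bdist x))"
    proof (cases "x \<in> A")
      case True
      define z where "z = kappa \<phi> * bdist x * s\<^sup>2"
      have "1 - measure unif_sq (nbr \<theta> \<phi> s x) \<le> exp (- z)"
        using True exp_ge_add_one_self[of "- z"] by (simp add: A_def z_def)
      then have "(1 - measure unif_sq (nbr \<theta> \<phi> s x)) ^ (n - 1) \<le> exp (- z) ^ (n - 1)"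
        by (intro power_mono) (simp_all add: unif_sq.prob_le_1)
      also have "\<dots> = exp (- (kappa \<phi> * s\<^sup>2 * real (n - 1)) * bdist x)"
        by (simp add: z_def flip: exp_of_nat_mult)
      finally show ?thesis using True by (simp add: ennreal_leI)
    qed simp
  qed
  also have "\<dots> \<le> ennreal (4 / (kappa \<phi> * s\<^sup>2 * real (n - 1)))"
    using kappa_pos[OF \<phi>] s(1) n by (intro nn_integral_exp_bdist mult_pos_pos) simp_all
  \<comment> \<open>The exponent \<open>n - 1\<close> in place of \<open>n\<close> costs the factor
    \<open>n / (n - 1)\<close>, at most 2 for two or more points; hence 8 in place of 4.\<close>
  also have "4 / (kappa \<phi> * s\<^sup>2 * real (n - 1)) \<le> 8 / (kappa \<phi> * t\<^sup>2)"
  proof -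
    have "4 / (kappa \<phi> * s\<^sup>2 * real (n - 1)) = (4 / (kappa \<phi> * t\<^sup>2)) * (real n / real (n - 1))"
      unfolding s(2) by simp
    also have "\<dots> \<le> (4 / (kappa \<phi> * t\<^sup>2)) * 2"
      using kappa_pos[OF \<phi>] n by (intro mult_left_mono) (auto simp: divide_le_eq)
    finally show ?thesis by simp
  qed
  finally show ?thesis by (simp add: ennreal_leI)
qed

section \<open>Domination and L1 convergence of the power sums\<close>

lemma nn_integral_power_tail:
  assumes "1 < \<beta>"
  shows "(\<integral>\<^sup>+v. ennreal (v powr (- \<beta>)) * indicator {1..} v \<partial>lborel) < \<infinity>"
proof -
  have "(\<integral>\<^sup>+v. ennreal (v powr (- \<beta>)) * indicator {1..} v \<partial>lborel) = ennreal (0 - 1 powr (1 - \<beta>) / (1 - \<beta>))"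
  proof (rule nn_integral_FTC_atLeast[where F = "\<lambda>v. v powr (1 - \<beta>) / (1 - \<beta>)"])
    show "((\<lambda>v. v powr (1 - \<beta>) / (1 - \<beta>)) has_real_derivative v powr (- \<beta>)) (at v)" if "1 \<le> v" for v :: real
      using DERIV_cdivide[OF has_real_derivative_powr[of v "1 - \<beta>"], of "1 - \<beta>"] that assms by simp
    show "((\<lambda>v::real. v powr (1 - \<beta>) / (1 - \<beta>)) \<longlongrightarrow> 0) at_top"
      using assms by real_asymp
  qed auto
  then show ?thesis by simp
qed

text \<open>Source of the scaling exponent: \<open>sqrt n powr \<alpha> / n\<close> equals
  \<open>n powr (\<alpha> / 2 - 1)\<close>.\<close>

lemma scaled_sum_layer_cake:
  assumes "0 < \<alpha>" "0 < n" and d: "\<And>i. i < n \<Longrightarrow> 0 \<le> d i"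
  shows "has_bochner_integral lborel (\<lambda>v. indicator {0<..} v * ((\<Sum>i<n. of_bool (v powr (1 / \<alpha>) < sqrt (real n) * d i)) / real n))
     (real n powr (\<alpha> / 2 - 1) * (\<Sum>i<n. d i powr \<alpha>))"
proof -
  have "has_bochner_integral lborel (\<lambda>v. (\<Sum>i<n. indicator {0<..} v * of_bool (v powr (1 / \<alpha>) < sqrt (real n) * d i)) / real n)
     ((\<Sum>i<n. (sqrt (real n) * d i) powr \<alpha>) / real n)"
    using d assms by (intro has_bochner_integral_divide_zero has_bochner_integral_sum powr_layer_cake) auto
  moreover have "(\<Sum>i<n. (sqrt (real n) * d i) powr \<alpha>) / real n = real n powr (\<alpha> / 2 - 1) * (\<Sum>i<n. d i powr \<alpha>)"
  proof -
    have "(sqrt (real n) * d i) powr \<alpha> = real n powr (\<alpha> / 2) * d i powr \<alpha>" if "i < n" for i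
      using d[OF that] by (simp add: powr_mult powr_half_sqrt[symmetric] powr_powr)
    then show ?thesis using assms by (simp add: sum_distrib_left[symmetric] powr_diff)
  qed
  ultimately show ?thesis
    unfolding sum_distrib_left[symmetric] times_divide_eq_right[symmetric] by simp
qed

text \<open>The fractions of misses and of exceedances differ by the fraction of indices that miss
  without exceeding. Its mean is at most \<open>h n\<close>, so the limit for misses carries
  over.\<close>

lemma empirical_tail_tendsto:
  fixes D :: "nat \<Rightarrow> nat \<Rightarrow> (nat \<Rightarrow> pt) \<Rightarrow> real"
  assumes \<phi>: "0 < \<phi>" "\<phi> \<le> 2 * pi" and t: "0 < t"
    and D [measurable]: "\<And>n i. i < n \<Longrightarrow> D n i \<in> borel_measurable (sample_space n)"
    and D_miss: "\<And>n. AE \<omega> in sample_space n. \<forall>i<n. t / sqrt (real n) < D n i \<omega> \<longrightarrow> miss \<theta> \<phi> (t / sqrt (real n)) n i \<omega>"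
    and h: "h \<longlonglongrightarrow> 0" "\<And>n i. 0 < n \<Longrightarrow> i < n \<Longrightarrow>
      measure (sample_space n) {\<omega> \<in> space (sample_space n). miss \<theta> \<phi> (t / sqrt (real n)) n i \<omega> \<and> \<not> t / sqrt (real n) < D n i \<omega>} \<le> h n"
  shows "(\<lambda>n. \<integral>\<omega>. \<bar>(\<Sum>i<n. of_bool (t < sqrt (real n) * D n i \<omega>)) / real n - exp (- (\<phi> * t\<^sup>2 / 2))\<bar> \<partial>sample_space n)
    \<longlonglongrightarrow> 0"
proof -
  define p where "p = exp (- (\<phi> * t\<^sup>2 / 2))"
  define N where "N n \<omega> = (\<Sum>i<n. of_bool (t < sqrt (real n) * D n i \<omega>)) / real n" for n \<omega>
  define Mn where "Mn n \<omega> = (\<Sum>i<n. of_bool (miss \<theta> \<phi> (t / sqrt (real n)) n i \<omega>)) / real n" for n \<omega>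
  define B where "B n i \<omega> \<longleftrightarrow> miss \<theta> \<phi> (t / sqrt (real n)) n i \<omega> \<and> \<not> t / sqrt (real n) < D n i \<omega>" for n i \<omega>
  have B [measurable]: "Measurable.pred (sample_space n) (B n i)" if "i < n" for n i
    using that unfolding B_def[abs_def] by measurable
  have [measurable]: "N n \<in> borel_measurable (sample_space n)" "Mn n \<in> borel_measurable (sample_space n)" for n
    unfolding N_def[abs_def] Mn_def[abs_def] by measurable
  have bd: "0 \<le> (\<Sum>i<n. of_bool (P i) :: real) / real n \<and> (\<Sum>i<n. of_bool (P i) :: real) / real n \<le> 1" for P n
  proof -
    have "(\<Sum>i<n. of_bool (P i) :: real) \<le> (\<Sum>i<n. 1)" by (intro sum_mono) auto
    then show ?thesis by (auto simp: divide_le_eq intro!: sum_nonneg)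
  qed
  have p01: "0 < p" "p \<le> 1" using \<phi> by (auto simp: p_def)
  have N01: "0 \<le> N n \<omega> \<and> N n \<omega> \<le> 1" for n \<omega> unfolding N_def by (rule bd)
  have M01: "0 \<le> Mn n \<omega> \<and> Mn n \<omega> \<le> 1" for n \<omega> unfolding Mn_def by (rule bd)
  have le: "(\<integral>\<omega>. \<bar>N n \<omega> - p\<bar> \<partial>sample_space n) \<le> (\<integral>\<omega>. \<bar>Mn n \<omega> - p\<bar> \<partial>sample_space n) + h n" if n: "0 < n" for n
  proof -
    have iB: "integrable (sample_space n) (\<lambda>\<omega>. of_bool (B n i \<omega>) :: real)" if "i < n" for i
      by (rule sample_space.integrable_const_bound[of _ 1]) (use that in auto)
    have abs1: "\<bar>Mn n \<omega> - p\<bar> \<le> 1" "\<bar>N n \<omega> - p\<bar> \<le> 1" for \<omega>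
      using M01[of n \<omega>] N01[of n \<omega>] p01 by linarith+
    have iM: "integrable (sample_space n) (\<lambda>\<omega>. \<bar>Mn n \<omega> - p\<bar>)"
      by (rule sample_space.integrable_const_bound[of _ 1]) (use abs1 in auto)
    have iN: "integrable (sample_space n) (\<lambda>\<omega>. \<bar>N n \<omega> - p\<bar>)"
      by (rule sample_space.integrable_const_bound[of _ 1]) (use abs1 in auto)
    have iS: "integrable (sample_space n) (\<lambda>\<omega>. (\<Sum>i<n. of_bool (B n i \<omega>) :: real) / real n)"
      by (rule integrable_divide_zero, rule Bochner_Integration.integrable_sum, rule iB, erule lessThan_iff[THEN iffD1])
    have "(\<integral>\<omega>. \<bar>N n \<omega> - p\<bar> \<partial>sample_space n) \<le> (\<integral>\<omega>. \<bar>Mn n \<omega> - p\<bar> + (\<Sum>i<n. of_bool (B n i \<omega>)) / real n \<partial>sample_space n)"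
    proof (rule integral_mono_AE)
      show "AE \<omega> in sample_space n. \<bar>N n \<omega> - p\<bar> \<le> \<bar>Mn n \<omega> - p\<bar> + (\<Sum>i<n. of_bool (B n i \<omega>)) / real n"
        using D_miss[of n]
      proof eventually_elim
        case (elim \<omega>)
        have "of_bool (miss \<theta> \<phi> (t / sqrt (real n)) n i \<omega>) = (of_bool (t < sqrt (real n) * D n i \<omega>) :: real) + of_bool (B n i \<omega>)" if "i < n" for i
          using elim that n by (auto simp: B_def field_simps)
        then have "Mn n \<omega> = N n \<omega> + (\<Sum>i<n. of_bool (B n i \<omega>)) / real n"
          unfolding Mn_def N_def by (simp add: sum.distrib add_divide_distrib)
        moreover have "0 \<le> (\<Sum>i<n. of_bool (B n i \<omega>) :: real) / real n" by (rule bd[THEN conjunct1])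
        ultimately show ?case by linarith
      qed
    qed (rule iN, rule Bochner_Integration.integrable_add[OF iM iS])
    also have "\<dots> = (\<integral>\<omega>. \<bar>Mn n \<omega> - p\<bar> \<partial>sample_space n) + (\<Sum>i<n. \<integral>\<omega>. of_bool (B n i \<omega>) \<partial>sample_space n) / real n"
      unfolding Bochner_Integration.integral_add[OF iM iS] integral_divide_zero
      by (subst Bochner_Integration.integral_sum, rule iB, erule lessThan_iff[THEN iffD1], rule refl)
    finally have 1: "(\<integral>\<omega>. \<bar>N n \<omega> - p\<bar> \<partial>sample_space n) \<le> (\<integral>\<omega>. \<bar>Mn n \<omega> - p\<bar> \<partial>sample_space n) +
      (\<Sum>i<n. \<integral>\<omega>. of_bool (B n i \<omega>) \<partial>sample_space n) / real n" .
    have "(\<Sum>i<n. \<integral>\<omega>. of_bool (B n i \<omega>) \<partial>sample_space n) \<le> (\<Sum>i<n. h n)"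
    proof (intro sum_mono)
      fix i assume i: "i \<in> {..<n}"
      have "(\<integral>\<omega>. of_bool (B n i \<omega>) \<partial>sample_space n) = (\<integral>\<omega>. indicator {\<omega> \<in> space (sample_space n). B n i \<omega>} \<omega> \<partial>sample_space n)"
        by (intro Bochner_Integration.integral_cong) (auto simp: indicator_def)
      also have "\<dots> = measure (sample_space n) {\<omega> \<in> space (sample_space n). B n i \<omega>}"
        using i by simp
      also have "\<dots> \<le> h n" using h(2)[OF n, of i] i by (simp add: B_def)
      finally show "(\<integral>\<omega>. of_bool (B n i \<omega>) \<partial>sample_space n) \<le> h n" .
    qed
    then have "(\<Sum>i<n. \<integral>\<omega>. of_bool (B n i \<omega>) \<partial>sample_space n) / real n \<le> h n"
      using n by (simp add: divide_le_eq mult.commute)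
    with 1 show ?thesis by linarith
  qed
  have "(\<lambda>n. (\<integral>\<omega>. \<bar>Mn n \<omega> - p\<bar> \<partial>sample_space n) + h n) \<longlonglongrightarrow> 0 + 0"
    using miss_mean_tendsto[OF \<phi> t, of \<theta>] h(1) unfolding Mn_def p_def by (intro tendsto_add)
  then have lim: "(\<lambda>n. (\<integral>\<omega>. \<bar>Mn n \<omega> - p\<bar> \<partial>sample_space n) + h n) \<longlonglongrightarrow> 0" by simp
  have "(\<lambda>n. \<integral>\<omega>. \<bar>N n \<omega> - p\<bar> \<partial>sample_space n) \<longlonglongrightarrow> 0"
  proof (rule tendsto_sandwich[OF _ _ tendsto_const lim])
    show "eventually (\<lambda>n. (\<integral>\<omega>. \<bar>N n \<omega> - p\<bar> \<partial>sample_space n) \<le> (\<integral>\<omega>. \<bar>Mn n \<omega> - p\<bar> \<partial>sample_space n) + h n) sequentially"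
      using eventually_gt_at_top[of 0] by eventually_elim (rule le)
  qed (simp_all add: always_eventually)
  then show ?thesis unfolding N_def p_def .
qed

text \<open>The distance is abstract so that the argument covers the sample with or without an added
  point. \<open>D_miss\<close> supplies the domination and one direction of the comparison with
  misses; \<open>miss_D\<close> supplies the other direction up to vanishing probability.\<close>

lemma directed_distance_weight_tendsto:
  fixes D :: "nat \<Rightarrow> nat \<Rightarrow> (nat \<Rightarrow> pt) \<Rightarrow> real" and \<alpha> \<theta> \<phi> :: real
  assumes \<alpha>: "0 < \<alpha>" "\<alpha> < 2" and \<phi>: "0 < \<phi>" "\<phi> \<le> 2 * pi"
    and D [measurable]: "\<And>n i. i < n \<Longrightarrow> D n i \<in> borel_measurable (sample_space n)"
    and D_nonneg: "\<And>n i \<omega>. 0 \<le> D n i \<omega>"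
    and D_miss: "\<And>n s. 0 < s \<Longrightarrow> AE \<omega> in sample_space n. \<forall>i<n. s < D n i \<omega> \<longrightarrow> miss \<theta> \<phi> s n i \<omega> \<and>
        (\<exists>y\<in>{0..1}\<times>{0..1}. y \<in> cone \<theta> \<phi> (\<omega> i) \<and> s < dist (\<omega> i) y)"
    and miss_D: "\<And>t. 0 < t \<Longrightarrow> \<exists>h. h \<longlonglongrightarrow> 0 \<and> (\<forall>n i. 0 < n \<longrightarrow> i < n \<longrightarrow>
      measure (sample_space n) {\<omega> \<in> space (sample_space n).
        miss \<theta> \<phi> (t / sqrt (real n)) n i \<omega> \<and> \<not> t / sqrt (real n) < D n i \<omega>} \<le> h n)"
  shows "(\<lambda>n. \<integral>\<^sup>+\<omega>. ennreal \<bar>real n powr (\<alpha> / 2 - 1) * (\<Sum>i<n. D n i \<omega> powr \<alpha>)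
     - (2 / \<phi>) powr (\<alpha> / 2) * Gamma (1 + \<alpha> / 2)\<bar> \<partial>sample_space n) \<longlonglongrightarrow> 0"
proof -
  define c where "c = (2 / \<phi>) powr (\<alpha> / 2) * Gamma (1 + \<alpha> / 2)"
  define p where "p v = exp (- (\<phi> * (v powr (1 / \<alpha>))\<^sup>2 / 2))" for v
  define N where "N n \<omega> v = (\<Sum>i<n. of_bool (v powr (1 / \<alpha>) < sqrt (real n) * D n i \<omega>)) / real n" for n \<omega> v
  define Y where "Y n \<omega> = real n powr (\<alpha> / 2 - 1) * (\<Sum>i<n. D n i \<omega> powr \<alpha>)" for n \<omega>
  define e where "e n v = (\<integral>\<^sup>+\<omega>. ennreal \<bar>N n \<omega> v - p v\<bar> \<partial>sample_space n)" for n v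
  have c_nonneg: "0 \<le> c" using \<alpha> by (simp add: c_def Gamma_real_nonneg)
  have [measurable]: "p \<in> borel_measurable borel" unfolding p_def[abs_def] by measurable
  have N_meas [measurable]: "(\<lambda>(v, \<omega>). N n \<omega> v) \<in> borel_measurable (lborel \<Otimes>\<^sub>M sample_space n)" for n
    unfolding N_def[abs_def] by measurable
  have p_int: "(\<integral>\<^sup>+v. ennreal (p v) * indicator {0<..} v \<partial>lborel) = ennreal c"
    unfolding p_def c_def by (rule nn_integral_gaussian_tail[OF \<alpha>(1) \<phi>(1)])
  have p_bochner: "has_bochner_integral lborel (\<lambda>v. indicator {0<..} v * p v) c"
  proof (rule has_bochner_integral_nn_integral)
    show "(\<integral>\<^sup>+v. ennreal (indicator {0<..} v * p v) \<partial>lborel) = ennreal c"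
      unfolding p_int[symmetric] by (intro nn_integral_cong) (simp add: indicator_def)
  qed (use c_nonneg in \<open>auto simp: p_def\<close>)
  have bd: "0 \<le> N n \<omega> v" "N n \<omega> v \<le> 1" for n \<omega> v
  proof -
    have "(\<Sum>i<n. of_bool (v powr (1 / \<alpha>) < sqrt (real n) * D n i \<omega>) :: real) \<le> (\<Sum>i<n. 1)" by (intro sum_mono) auto
    then show "0 \<le> N n \<omega> v" "N n \<omega> v \<le> 1" by (auto simp: N_def divide_le_eq intro!: sum_nonneg)
  qed
  have p01: "0 < p v" "p v \<le> 1" for v using \<phi> by (auto simp: p_def)

  \<comment> \<open>\<open>Y n \<omega>\<close> and \<open>c\<close> are integrals over the same
    half line, so the triangle inequality for integrals replaces the error of the power sum by the
    error of the tail at each level.\<close>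
  have pointwise: "ennreal \<bar>Y n \<omega> - c\<bar> \<le> (\<integral>\<^sup>+v. ennreal \<bar>N n \<omega> v - p v\<bar> * indicator {0<..} v \<partial>lborel)" if n: "0 < n" for n \<omega>
  proof -
    have "has_bochner_integral lborel (\<lambda>v. indicator {0<..} v * N n \<omega> v - indicator {0<..} v * p v) (Y n \<omega> - c)"
      unfolding N_def Y_def by (intro has_bochner_integral_diff scaled_sum_layer_cake p_bochner) (use \<alpha> n D_nonneg in auto)
    then have "ennreal (norm (Y n \<omega> - c)) \<le> (\<integral>\<^sup>+v. ennreal (norm (indicator {0<..} v * N n \<omega> v - indicator {0<..} v * p v)) \<partial>lborel)"
      by (rule has_bochner_integral_norm_bound)
    also have "\<dots> = (\<integral>\<^sup>+v. ennreal \<bar>N n \<omega> v - p v\<bar> * indicator {0<..} v \<partial>lborel)"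
      by (intro nn_integral_cong) (simp add: indicator_def)
    finally show ?thesis by simp
  qed

  have Y_le: "(\<integral>\<^sup>+\<omega>. ennreal \<bar>Y n \<omega> - c\<bar> \<partial>sample_space n) \<le> (\<integral>\<^sup>+v. e n v * indicator {0<..} v \<partial>lborel)" if n: "0 < n" for n
  proof -
    interpret P: pair_sigma_finite lborel "sample_space n"
      by unfold_locales
    have "(\<integral>\<^sup>+\<omega>. ennreal \<bar>Y n \<omega> - c\<bar> \<partial>sample_space n) \<le>
       (\<integral>\<^sup>+\<omega>. \<integral>\<^sup>+v. ennreal \<bar>N n \<omega> v - p v\<bar> * indicator {0<..} v \<partial>lborel \<partial>sample_space n)"
      by (intro nn_integral_mono pointwise n)
    also have "\<dots> = (\<integral>\<^sup>+v. \<integral>\<^sup>+\<omega>. ennreal \<bar>N n \<omega> v - p v\<bar> * indicator {0<..} v \<partial>sample_space n \<partial>lborel)"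
      by (rule P.Fubini') measurable
    also have "\<dots> = (\<integral>\<^sup>+v. e n v * indicator {0<..} v \<partial>lborel)"
      unfolding e_def by (intro nn_integral_cong nn_integral_multc) measurable
    finally show ?thesis .
  qed

  have e_meas [measurable]: "e n \<in> borel_measurable borel" for n
  proof -
    have "(\<lambda>(v, \<omega>). ennreal \<bar>N n \<omega> v - p v\<bar>) \<in> borel_measurable (lborel \<Otimes>\<^sub>M sample_space n)" by measurable
    from sample_space.borel_measurable_nn_integral_fst[OF this] show ?thesis by (simp add: e_def[abs_def])
  qed

  have e_lim: "(\<lambda>n. e n v) \<longlonglongrightarrow> 0" if v: "0 < v" for v
  proof -
    define t where "t = v powr (1 / \<alpha>)"
    have t: "0 < t" using v by (simp add: t_def)
    obtain h where h: "h \<longlonglongrightarrow> 0" "\<And>n i. 0 < n \<Longrightarrow> i < n \<Longrightarrow>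
      measure (sample_space n) {\<omega> \<in> space (sample_space n).
        miss \<theta> \<phi> (t / sqrt (real n)) n i \<omega> \<and> \<not> t / sqrt (real n) < D n i \<omega>} \<le> h n"
      using miss_D[OF t] by auto
    have "AE \<omega> in sample_space n. \<forall>i<n. t / sqrt (real n) < D n i \<omega> \<longrightarrow> miss \<theta> \<phi> (t / sqrt (real n)) n i \<omega>" for n
    proof (cases "n = 0")
      case False
      then have "0 < t / sqrt (real n)" using t by simp
      from D_miss[OF this, of n] show ?thesis by eventually_elim blast
    qed simp
    from empirical_tail_tendsto[OF \<phi> t D this h]
    have lim: "(\<lambda>n. \<integral>\<omega>. \<bar>N n \<omega> v - p v\<bar> \<partial>sample_space n) \<longlonglongrightarrow> 0"
      by (simp add: N_def p_def t_def)
    have "e n v = ennreal (\<integral>\<omega>. \<bar>N n \<omega> v - p v\<bar> \<partial>sample_space n)" for n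
      unfolding e_def
    proof (rule nn_integral_eq_integral)
      have [measurable]: "(\<lambda>\<omega>. N n \<omega> v) \<in> borel_measurable (sample_space n)"
        unfolding N_def[abs_def] by measurable
      have "\<bar>N n \<omega> v - p v\<bar> \<le> 1" for \<omega> using bd[where n=n and \<omega>=\<omega> and v=v] p01[of v] by linarith
      then show "integrable (sample_space n) (\<lambda>\<omega>. \<bar>N n \<omega> v - p v\<bar>)"
        by (intro sample_space.integrable_const_bound[of _ 1]) auto
    qed simp
    then show ?thesis using tendsto_ennrealI[OF lim] by simp
  qed

  define C where "C = 8 / kappa \<phi>"
  have C: "0 < C" using kappa_pos[OF \<phi>(1)] by (simp add: C_def)
  \<comment> \<open>Three pieces: the trivial bound 1 at levels below 1, the exceedance bound from
    level 1 on, where \<open>t^2\<close> equals \<open>v powr (2 / \<alpha>)\<close> and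
    \<open>C\<close> holds its constant, and the limiting tail itself.\<close>
  define w where "w v = ennreal (indicator {0<..<1} v) + ennreal C * (ennreal (v powr (- (2 / \<alpha>))) * indicator {1..} v)
       + ennreal (p v) * indicator {0<..} v" for v :: real
  have e_bound: "e n v * indicator {0<..} v \<le> w v" if n: "2 \<le> n" for n v
  proof (cases "0 < v")
    case True
    define t where "t = v powr (1 / \<alpha>)"
    have t: "0 < t" using True by (simp add: t_def)
    have [measurable]: "(\<lambda>\<omega>. N n \<omega> v) \<in> borel_measurable (sample_space n)"
      unfolding N_def[abs_def] by measurable
    have "e n v \<le> (\<integral>\<^sup>+\<omega>. ennreal (N n \<omega> v) + ennreal (p v) \<partial>sample_space n)"
      unfolding e_def
    proof (rule nn_integral_mono)
      fix \<omega>
      have "\<bar>N n \<omega> v - p v\<bar> \<le> N n \<omega> v + p v" using bd(1)[where n=n and \<omega>=\<omega> and v=v] p01[of v] by linarith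
      then show "ennreal \<bar>N n \<omega> v - p v\<bar> \<le> ennreal (N n \<omega> v) + ennreal (p v)"
        using bd(1)[where n=n and \<omega>=\<omega> and v=v] p01[of v] by (simp flip: ennreal_plus)
    qed
    also have "\<dots> = (\<integral>\<^sup>+\<omega>. ennreal (N n \<omega> v) \<partial>sample_space n) + ennreal (p v)"
      by (subst nn_integral_add) (simp_all add: sample_space.emeasure_space_1)
    also have "(\<integral>\<^sup>+\<omega>. ennreal (N n \<omega> v) \<partial>sample_space n) \<le> ennreal (indicator {0<..<1} v) + ennreal C * (ennreal (v powr (- (2 / \<alpha>))) * indicator {1..} v)"
    proof (cases "v < 1")
      case v1: True
      have "(\<integral>\<^sup>+\<omega>. ennreal (N n \<omega> v) \<partial>sample_space n) \<le> (\<integral>\<^sup>+\<omega>. 1 \<partial>sample_space n)"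
        using bd(2) by (intro nn_integral_mono) (simp add: ennreal_le_1)
      then show ?thesis using True v1 by (simp add: sample_space.emeasure_space_1)
    next
      case v1: False
      have one: "(\<integral>\<^sup>+\<omega>. indicator {\<omega>. t < sqrt (real n) * D n i \<omega>} \<omega> \<partial>sample_space n) \<le> ennreal (8 / (kappa \<phi> * t\<^sup>2))" if i: "i < n" for i
      proof (rule exceedance_bound[OF \<phi>(1) n i t, where \<theta> = \<theta>])
        have "0 < t / sqrt (real n)" using t n by simp
        from D_miss[OF this, of n]
        show "AE \<omega> in sample_space n. t < sqrt (real n) * D n i \<omega> \<longrightarrow> miss \<theta> \<phi> (t / sqrt (real n)) n i \<omega> \<and>
          (\<exists>y\<in>{0..1}\<times>{0..1}. y \<in> cone \<theta> \<phi> (\<omega> i) \<and> t / sqrt (real n) < dist (\<omega> i) y)"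
        proof eventually_elim
          case (elim \<omega>)
          have "t < sqrt (real n) * D n i \<omega> \<longleftrightarrow> t / sqrt (real n) < D n i \<omega>"
            using n by (simp add: divide_less_eq mult.commute)
          then show ?case using elim i by blast
        qed
      qed
      have "(\<integral>\<^sup>+\<omega>. ennreal (N n \<omega> v) \<partial>sample_space n) =
         (\<integral>\<^sup>+\<omega>. ennreal (1 / real n) * (\<Sum>i<n. indicator {\<omega>. t < sqrt (real n) * D n i \<omega>} \<omega>) \<partial>sample_space n)"
      proof (rule nn_integral_cong)
        fix \<omega>
        have "(\<Sum>i<n. indicator {\<omega>. t < sqrt (real n) * D n i \<omega>} \<omega>) = ennreal (\<Sum>i<n. of_bool (t < sqrt (real n) * D n i \<omega>))"
          by (subst sum_ennreal[symmetric]) (auto intro!: sum.cong simp: indicator_def ennreal_of_nat_eq_real_of_nat)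
        then show "ennreal (N n \<omega> v) = ennreal (1 / real n) * (\<Sum>i<n. indicator {\<omega>. t < sqrt (real n) * D n i \<omega>} \<omega>)"
          unfolding N_def t_def[symmetric] by (simp add: sum_nonneg flip: ennreal_mult del: sum_of_bool_eq)
      qed
      also have "\<dots> = ennreal (1 / real n) * (\<Sum>i<n. \<integral>\<^sup>+\<omega>. indicator {\<omega>. t < sqrt (real n) * D n i \<omega>} \<omega> \<partial>sample_space n)"
        unfolding indicator_def by (subst nn_integral_cmult, measurable, subst nn_integral_sum, measurable)
      also have "\<dots> \<le> ennreal (1 / real n) * (\<Sum>i<n. ennreal (8 / (kappa \<phi> * t\<^sup>2)))"
        using one by (intro mult_left_mono sum_mono) auto
      also have "\<dots> = ennreal (8 / (kappa \<phi> * t\<^sup>2))"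
        using n kappa_pos[OF \<phi>(1)] by (simp flip: ennreal_of_nat_eq_real_of_nat ennreal_mult)
          (simp add: ennreal_of_nat_eq_real_of_nat flip: ennreal_mult)
      also have "8 / (kappa \<phi> * t\<^sup>2) = C * v powr (- (2 / \<alpha>))"
      proof -
        have "t\<^sup>2 = v powr (2 / \<alpha>)" by (simp add: t_def power2_eq_square flip: powr_add)
        then show ?thesis by (simp add: C_def powr_minus divide_inverse)
      qed
      finally show ?thesis using v1 C by (simp flip: ennreal_mult)
    qed
    finally show ?thesis using True unfolding w_def by (simp add: add_mono)
  qed simp

  have w_fin: "(\<integral>\<^sup>+v. w v \<partial>lborel) < \<infinity>"
  proof -
    have "1 < 2 / \<alpha>" using \<alpha> by simp
    let ?a = "\<lambda>v::real. ennreal (indicator {0<..<1} v)" and ?b = "\<lambda>v. ennreal (v powr (- (2 / \<alpha>))) * indicator {1..} v"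
    have "(\<integral>\<^sup>+v. w v \<partial>lborel) = (\<integral>\<^sup>+v. ?a v + ennreal C * ?b v \<partial>lborel) + (\<integral>\<^sup>+v. ennreal (p v) * indicator {0<..} v \<partial>lborel)"
      unfolding w_def by (rule nn_integral_add) measurable
    also have "(\<integral>\<^sup>+v. ?a v + ennreal C * ?b v \<partial>lborel) = (\<integral>\<^sup>+v. ?a v \<partial>lborel) + (\<integral>\<^sup>+v. ennreal C * ?b v \<partial>lborel)"
      by (rule nn_integral_add) measurable
    also have "(\<integral>\<^sup>+v. ennreal C * ?b v \<partial>lborel) = ennreal C * (\<integral>\<^sup>+v. ?b v \<partial>lborel)"
      by (rule nn_integral_cmult) measurable
    also note p_int
    finally show ?thesis
      using nn_integral_power_tail[OF \<open>1 < 2 / \<alpha>\<close>] by (simp add: ennreal_indicator ennreal_mult_less_top)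
  qed

  \<comment> \<open>The shift by 2 makes the dominating function valid for every index, since the
    exceedance bound asks for at least two points; the offset is removed at the end.\<close>
  have "(\<lambda>n. \<integral>\<^sup>+v. e (n + 2) v * indicator {0<..} v \<partial>lborel) \<longlonglongrightarrow> (\<integral>\<^sup>+v. 0 \<partial>(lborel :: real measure))"
  proof (rule nn_integral_dominated_convergence[where w = w])
    show "AE v in lborel. (\<lambda>n. e (n + 2) v * indicator {0<..} v) \<longlonglongrightarrow> 0"
    proof (rule AE_I2)
      fix v :: real
      show "(\<lambda>n. e (n + 2) v * indicator {0<..} v) \<longlonglongrightarrow> 0"
        using LIMSEQ_ignore_initial_segment[OF e_lim[of v], of 2] by (cases "0 < v") simp_all
    qed
    show "w \<in> borel_measurable lborel" unfolding w_def[abs_def] by measurable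
  qed (use e_bound w_fin in auto)
  then have e0: "(\<lambda>n. \<integral>\<^sup>+v. e (n + 2) v * indicator {0<..} v \<partial>lborel) \<longlonglongrightarrow> 0" by simp
  have "(\<lambda>n. \<integral>\<^sup>+\<omega>. ennreal \<bar>Y (n + 2) \<omega> - c\<bar> \<partial>sample_space (n + 2)) \<longlonglongrightarrow> 0"
    by (rule tendsto_sandwich[OF _ _ tendsto_const e0]) (auto intro!: always_eventually Y_le)
  then show ?thesis unfolding Y_def c_def by (rule LIMSEQ_offset)
qed

section \<open>The minimal directed spanning forest\<close>

text \<open>The existence clause comes from the default value 0 of an empty minimum. It is the whole
  difference between exceeding \<open>s\<close> and finding no point of \<open>S\<close> in the
  region.\<close>

lemma dnn_greater_iff:
  assumes "finite S" "0 \<le> s"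
  shows "s < dnn \<theta> \<phi> x S \<longleftrightarrow> (\<exists>y\<in>S. y \<in> cone \<theta> \<phi> x \<and> y \<noteq> x) \<and> (\<forall>y\<in>S. y \<notin> nbr \<theta> \<phi> s x)"
proof (cases "{y \<in> S - {x}. dpreceq \<theta> \<phi> y x} = {}")
  case True
  then have "dnn \<theta> \<phi> x S = 0" by (simp add: dnn_def)
  moreover have "\<not> (\<exists>y\<in>S. y \<in> cone \<theta> \<phi> x \<and> y \<noteq> x)" using True by (auto simp: dpreceq_def)
  ultimately show ?thesis using assms by simp
next
  case False
  then have eq: "dnn \<theta> \<phi> x S = Min (dist x ` {y \<in> S - {x}. dpreceq \<theta> \<phi> y x})"
    unfolding dnn_def Let_def by (rule if_not_P)
  have "finite {y \<in> S - {x}. dpreceq \<theta> \<phi> y x}" using assms by simp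
  then have "s < dnn \<theta> \<phi> x S \<longleftrightarrow> (\<forall>y\<in>{y \<in> S - {x}. dpreceq \<theta> \<phi> y x}. s < dist x y)"
    unfolding eq using False by (subst Min_gr_iff) auto
  also have "\<dots> \<longleftrightarrow> (\<forall>y\<in>S. y \<notin> nbr \<theta> \<phi> s x)"
    by (auto simp: nbr_def dpreceq_def not_le)
  finally show ?thesis using False by (auto simp: dpreceq_def)
qed

lemma dnn_nonneg: "finite S \<Longrightarrow> 0 \<le> dnn \<theta> \<phi> x S"
  by (auto simp: dnn_def Let_def)

text \<open>Crude diameter bound of the square, for integrability of the weight at each fixed sample
  size.\<close>

lemma dnn_le:
  assumes "finite S" "x \<in> {0..1} \<times> {0..1}" "S \<subseteq> {0..1} \<times> {0..1}"
  shows "dnn \<theta> \<phi> x S \<le> 2"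
proof (rule ccontr)
  assume "\<not> ?thesis"
  then have "2 < dnn \<theta> \<phi> x S" by simp
  then obtain y where y: "y \<in> S" "y \<in> cone \<theta> \<phi> x" "y \<noteq> x" "y \<notin> nbr \<theta> \<phi> 2 x"
    using dnn_greater_iff[OF assms(1), of 2 \<theta> \<phi> x] by auto
  have "dist x y \<le> \<bar>fst x - fst y\<bar> + \<bar>snd x - snd y\<bar>"
    unfolding dist_prod_def dist_real_def using sqrt_sum_squares_le_sum_abs by (metis power2_abs)
  also have "\<dots> \<le> 1 + 1"
  proof -
    have "y \<in> {0..1} \<times> {0..1}" using y(1) assms(3) by blast
    then have "0 \<le> fst y" "fst y \<le> 1" "0 \<le> snd y" "snd y \<le> 1" by (cases y; simp)+
    moreover have "0 \<le> fst x" "fst x \<le> 1" "0 \<le> snd x" "snd x \<le> 1" using assms(2) by (cases x; simp)+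
    ultimately show ?thesis by (intro add_mono) (auto simp: abs_le_iff)
  qed
  finally show False using y by (simp add: nbr_def)
qed

section \<open>Measurability of the weight and distinctness of the sample points\<close>

lemma Xn_finite [simp]: "finite (Xn n \<omega>)"
  by (simp add: Xn_def)

lemma pred_pt_eq:
  fixes f g :: "'a \<Rightarrow> pt"
  assumes [measurable]: "f \<in> borel_measurable M" "g \<in> borel_measurable M"
  shows "Measurable.pred M (\<lambda>\<omega>. f \<omega> = g \<omega>)"
  by measurable

lemma dnn_measurable:
  assumes "finite F" and [measurable]: "g \<in> borel_measurable (sample_space n)"
  shows "(\<lambda>\<omega>. dnn \<theta> \<phi> (g \<omega>) (Xn n \<omega> \<union> F)) \<in> borel_measurable (sample_space n)"
  unfolding borel_measurable_iff_greater
proof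
  fix a :: real
  have fin: "finite (Xn n \<omega> \<union> F)" for \<omega> using assms by simp
  show "{\<omega> \<in> space (sample_space n). a < dnn \<theta> \<phi> (g \<omega>) (Xn n \<omega> \<union> F)} \<in> sets (sample_space n)"
  proof (cases "a < 0")
    case True
    then have "{\<omega> \<in> space (sample_space n). a < dnn \<theta> \<phi> (g \<omega>) (Xn n \<omega> \<union> F)} = space (sample_space n)"
      by (auto intro: less_le_trans[OF _ dnn_nonneg[OF fin]])
    then show ?thesis by simp
  next
    case False
    then have "{\<omega> \<in> space (sample_space n). a < dnn \<theta> \<phi> (g \<omega>) (Xn n \<omega> \<union> F)} =
      {\<omega> \<in> space (sample_space n).
        ((\<exists>j<n. \<omega> j \<in> cone \<theta> \<phi> (g \<omega>) \<and> \<omega> j \<noteq> g \<omega>) \<or> (\<exists>c\<in>F. c \<in> cone \<theta> \<phi> (g \<omega>) \<and> c \<noteq> g \<omega>)) \<and>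
        (\<forall>j<n. \<omega> j \<notin> nbr \<theta> \<phi> a (g \<omega>)) \<and> (\<forall>c\<in>F. c \<notin> nbr \<theta> \<phi> a (g \<omega>))}"
      unfolding dnn_greater_iff[OF fin leI[OF False]] by (auto simp: Xn_def)
    also have "\<dots> \<in> sets (sample_space n)"
    proof -
      have cone: "Measurable.pred (sample_space n) (\<lambda>\<omega>. f \<omega> \<in> cone \<theta> \<phi> (g \<omega>) \<and> f \<omega> \<noteq> g \<omega>)"
        and nbr: "Measurable.pred (sample_space n) (\<lambda>\<omega>. f \<omega> \<notin> nbr \<theta> \<phi> a (g \<omega>))"
        if "f \<in> borel_measurable (sample_space n)" for f
        using pred_cone[OF that assms(2)] pred_pt_eq[OF that assms(2)] pred_nbr[OF that assms(2) borel_measurable_const]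
        by (simp_all add: pred_intros_logic)
      have 1: "Measurable.pred (sample_space n) (\<lambda>\<omega>. \<exists>c\<in>F. c \<in> cone \<theta> \<phi> (g \<omega>) \<and> c \<noteq> g \<omega>)"
        by (rule pred_intros_finite(4)[OF \<open>finite F\<close>], rule cone) simp
      have 2: "Measurable.pred (sample_space n) (\<lambda>\<omega>. \<forall>c\<in>F. c \<notin> nbr \<theta> \<phi> a (g \<omega>))"
        by (rule pred_intros_finite(3)[OF \<open>finite F\<close>], rule nbr) simp
      have 3: "Measurable.pred (sample_space n) (\<lambda>\<omega>. \<exists>j\<in>{..<n}. \<omega> j \<in> cone \<theta> \<phi> (g \<omega>) \<and> \<omega> j \<noteq> g \<omega>)"
        by (rule pred_intros_finite(4)[OF finite_lessThan], rule cone) simp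
      have 4: "Measurable.pred (sample_space n) (\<lambda>\<omega>. \<forall>j\<in>{..<n}. \<omega> j \<notin> nbr \<theta> \<phi> a (g \<omega>))"
        by (rule pred_intros_finite(3)[OF finite_lessThan], rule nbr) simp
      from pred_intros_logic(3)[OF pred_intros_logic(5)[OF 3 1] pred_intros_logic(3)[OF 4 2]]
      show ?thesis unfolding pred_def Ball_def Bex_def lessThan_iff conj_assoc .
    qed
    finally show ?thesis .
  qed
qed

text \<open>Repeated values merge in an image set. Charging each value at its first index gives an
  indexed sum valid for every outcome, not merely almost every one, as measurability
  demands.\<close>

lemma sum_image_lessThan:
  fixes f :: "'a \<Rightarrow> 'b::comm_monoid_add" and \<omega> :: "nat \<Rightarrow> 'a"
  shows "sum f (\<omega> ` {..<n}) = (\<Sum>i<n. if \<exists>j<i. \<omega> j = \<omega> i then 0 else f (\<omega> i))"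
proof (induction n)
  case (Suc n)
  have "\<omega> ` {..<Suc n} = insert (\<omega> n) (\<omega> ` {..<n})" by (auto simp: lessThan_Suc)
  moreover have "\<omega> n \<in> \<omega> ` {..<n} \<longleftrightarrow> (\<exists>j<n. \<omega> j = \<omega> n)"
    by (metis imageE image_eqI lessThan_iff)
  ultimately show ?case using Suc by (simp add: insert_absorb add.commute)
qed simp

text \<open>Sample points are charged at their first index and extra points only when absent from
  the sample; this turns the sum over a random set into finite sums with measurable
  conditions.\<close>

lemma mdsf_weight_measurable:
  assumes F: "finite F"
  shows "(\<lambda>\<omega>. mdsf_weight \<theta> \<phi> \<alpha> (Xn n \<omega> \<union> F)) \<in> borel_measurable (sample_space n)"
proof -
  have "mdsf_weight \<theta> \<phi> \<alpha> (Xn n \<omega> \<union> F) =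
     (\<Sum>i<n. if \<exists>j<i. \<omega> j = \<omega> i then 0 else dnn \<theta> \<phi> (\<omega> i) (Xn n \<omega> \<union> F) powr \<alpha>) +
     (\<Sum>c\<in>F. if \<exists>j<n. \<omega> j = c then 0 else dnn \<theta> \<phi> c (Xn n \<omega> \<union> F) powr \<alpha>)" for \<omega>
  proof -
    let ?f = "\<lambda>x. dnn \<theta> \<phi> x (Xn n \<omega> \<union> F) powr \<alpha>"
    have "sum ?f (Xn n \<omega> \<union> F) = sum ?f (Xn n \<omega>) + sum ?f (F - Xn n \<omega>)"
      using F by (metis Diff_disjoint Un_Diff_cancel Xn_finite finite_Diff sum.union_disjoint)
    also have "sum ?f (F - Xn n \<omega>) = (\<Sum>c\<in>F. if \<exists>j<n. \<omega> j = c then 0 else ?f c)"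
    proof -
      have "(\<exists>j<n. \<omega> j = c) \<longleftrightarrow> c \<in> Xn n \<omega>" for c
        unfolding Xn_def by (metis imageE image_eqI lessThan_iff)
      then show ?thesis using F by (intro sum.mono_neutral_cong_left) auto
    qed
    also have "sum ?f (Xn n \<omega>) = (\<Sum>i<n. if \<exists>j<i. \<omega> j = \<omega> i then 0 else ?f (\<omega> i))"
      unfolding Xn_def by (rule sum_image_lessThan)
    finally show ?thesis by (simp add: mdsf_weight_def)
  qed
  moreover have "(\<lambda>\<omega>. (\<Sum>i<n. if \<exists>j<i. \<omega> j = \<omega> i then 0 else dnn \<theta> \<phi> (\<omega> i) (Xn n \<omega> \<union> F) powr \<alpha>))
     \<in> borel_measurable (sample_space n)"
  proof (intro borel_measurable_sum)
    fix i assume "i \<in> {..<n}"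
    then have i: "i < n" by simp
    have "Measurable.pred (sample_space n) (\<lambda>\<omega>. \<exists>j\<in>{..<i}. \<omega> j = \<omega> i)"
    proof (rule pred_intros_finite(4)[OF finite_lessThan], rule pred_pt_eq)
      fix j assume "j \<in> {..<i}"
      then have "j < n" using i by simp
      then show "(\<lambda>\<omega>. \<omega> j) \<in> borel_measurable (sample_space n)" by (rule sample_space_component)
    qed (rule sample_space_component[OF i])
    then have sets: "{\<omega> \<in> space (sample_space n). \<exists>j<i. \<omega> j = \<omega> i} \<in> sets (sample_space n)"
      unfolding pred_def Bex_def lessThan_iff .
    show "(\<lambda>\<omega>. if \<exists>j<i. \<omega> j = \<omega> i then 0 else dnn \<theta> \<phi> (\<omega> i) (Xn n \<omega> \<union> F) powr \<alpha>) \<in> borel_measurable (sample_space n)"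
      by (rule measurable_If[OF borel_measurable_const powr_real_measurable[OF dnn_measurable[OF F sample_space_component[OF i]] borel_measurable_const] sets])
  qed
  moreover have "(\<lambda>\<omega>. (\<Sum>c\<in>F. if \<exists>j<n. \<omega> j = c then 0 else dnn \<theta> \<phi> c (Xn n \<omega> \<union> F) powr \<alpha>))
     \<in> borel_measurable (sample_space n)"
  proof (intro borel_measurable_sum)
    fix c
    have "Measurable.pred (sample_space n) (\<lambda>\<omega>. \<exists>j\<in>{..<n}. \<omega> j = c)"
    proof (rule pred_intros_finite(4)[OF finite_lessThan], rule pred_pt_eq)
      fix j assume "j \<in> {..<n}"
      then have "j < n" by simp
      then show "(\<lambda>\<omega>. \<omega> j) \<in> borel_measurable (sample_space n)" by (rule sample_space_component)
    qed (rule borel_measurable_const)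
    then have sets: "{\<omega> \<in> space (sample_space n). \<exists>j<n. \<omega> j = c} \<in> sets (sample_space n)"
      unfolding pred_def Bex_def lessThan_iff .
    show "(\<lambda>\<omega>. if \<exists>j<n. \<omega> j = c then 0 else dnn \<theta> \<phi> c (Xn n \<omega> \<union> F) powr \<alpha>) \<in> borel_measurable (sample_space n)"
      by (rule measurable_If[OF borel_measurable_const powr_real_measurable[OF dnn_measurable[OF F borel_measurable_const] borel_measurable_const] sets])
  qed
  ultimately show ?thesis by simp
qed

text \<open>The avoidance formula for the family \<open>V x = {x}\<close>, whose members are null.
  The version exempting index \<open>i\<close> is required, because each member contains its own
  base point.\<close>

lemma AE_sample_space_inj: "AE \<omega> in sample_space n. inj_on \<omega> {..<n}"
proof -
  have "AE \<omega> in sample_space n. \<forall>j<n. j \<noteq> i \<longrightarrow> \<omega> j \<noteq> \<omega> i" if i: "i < n" for i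
  proof -
    have [simp]: "measure unif_sq {x} = 0" for x
      using AE_unif_sq_neq[of x] unif_sq.prob_eq_0[of "{x}"] by simp
    have fam: "Measurable.pred (borel \<Otimes>\<^sub>M borel) (\<lambda>z::pt \<times> pt. snd z \<in> {fst z})"
      unfolding singleton_iff by (rule pred_pt_eq[OF measurable_snd measurable_fst])
    have "Measurable.pred (sample_space n) (\<lambda>\<omega>. \<forall>j\<in>{..<n}. j \<noteq> i \<longrightarrow> \<omega> j \<noteq> \<omega> i)"
    proof (rule pred_intros_finite(3)[OF finite_lessThan])
      fix j assume "j \<in> {..<n}"
      then have "j < n" by simp
      then show "Measurable.pred (sample_space n) (\<lambda>\<omega>. j \<noteq> i \<longrightarrow> \<omega> j \<noteq> \<omega> i)"
        by (intro pred_intros_logic(2,4) measurable_const pred_pt_eq sample_space_component i) simp_all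
    qed
    then have m: "{\<omega> \<in> space (sample_space n). \<forall>j<n. j \<noteq> i \<longrightarrow> \<omega> j \<noteq> \<omega> i} \<in> sets (sample_space n)"
      unfolding pred_def Ball_def lessThan_iff .
    have "emeasure (sample_space n) {\<omega> \<in> space (sample_space n). \<forall>j<n. j \<noteq> i \<longrightarrow> \<omega> j \<noteq> \<omega> i} =
      (\<integral>\<^sup>+\<omega>. 1 * indicator {\<omega>. \<forall>j<n. j \<noteq> i \<longrightarrow> \<omega> j \<notin> {\<omega> i}} \<omega> \<partial>sample_space n)"
      unfolding nn_integral_indicator[OF m, symmetric] by (intro nn_integral_cong) (simp add: indicator_def)
    also have "\<dots> = (\<integral>\<^sup>+x. 1 * ennreal ((1 - measure unif_sq {x}) ^ (n - 1)) \<partial>unif_sq)"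
      by (rule nn_integral_sample_space_others[OF i _ fam]) simp
    also have "\<dots> = 1" using unif_sq.emeasure_space_1 by simp
    finally have "sample_space.prob n {\<omega> \<in> space (sample_space n). \<forall>j<n. j \<noteq> i \<longrightarrow> \<omega> j \<noteq> \<omega> i} = 1"
      by (simp add: measure_def)
    then show ?thesis using sample_space.prob_eq_1[OF m] by auto
  qed
  then have "AE \<omega> in sample_space n. \<forall>i\<in>{..<n}. \<forall>j<n. j \<noteq> i \<longrightarrow> \<omega> j \<noteq> \<omega> i"
    by (intro AE_finite_allI) auto
  then show ?thesis by eventually_elim (auto simp: inj_on_def)
qed

section \<open>From power sums to the weight of the forest\<close>

lemma AE_sample_space_all_bdist: "AE \<omega> in sample_space n. \<forall>i\<in>{..<n}. 0 < bdist (\<omega> i)"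
  by (intro AE_finite_allI) (auto intro: AE_sample_space_bdist)

lemma bdist_pos_mem: "0 < bdist x \<Longrightarrow> x \<in> {0..1} \<times> {0..1}"
  by (cases x) (auto simp: bdist_def)

text \<open>\<open>F\<close> is the set of fixed extra points, either empty or the origin alone in
  the applications. Lying off the open square, they almost surely differ from the sample points, and
  \<open>F0\<close> makes their own terms vanish, so the weight is almost surely an indexed sum over
  the sample.\<close>

lemma mdsf_weight_tendsto:
  assumes \<alpha>: "0 < \<alpha>" "\<alpha> < 2" and \<phi>: "0 < \<phi>" "\<phi> \<le> 2 * pi"
    and F: "finite F" "F \<subseteq> {0..1} \<times> {0..1}" "\<And>x. x \<in> F \<Longrightarrow> bdist x \<le> 0"
    and F0: "\<And>n. AE \<omega> in sample_space n. \<forall>x\<in>F. dnn \<theta> \<phi> x (Xn n \<omega> \<union> F) = 0"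
    and miss_D: "\<And>t. 0 < t \<Longrightarrow> \<exists>h. h \<longlonglongrightarrow> 0 \<and> (\<forall>n i. 0 < n \<longrightarrow> i < n \<longrightarrow>
      measure (sample_space n) {\<omega> \<in> space (sample_space n).
        miss \<theta> \<phi> (t / sqrt (real n)) n i \<omega> \<and> \<not> t / sqrt (real n) < dnn \<theta> \<phi> (\<omega> i) (Xn n \<omega> \<union> F)} \<le> h n)"
  shows "(\<forall>n. integrable (sample_space n) (\<lambda>\<omega>. real n powr (\<alpha>/2 - 1) * mdsf_weight \<theta> \<phi> \<alpha> (Xn n \<omega> \<union> F))) \<and>
     (\<lambda>n. \<integral>\<omega>. \<bar>real n powr (\<alpha>/2 - 1) * mdsf_weight \<theta> \<phi> \<alpha> (Xn n \<omega> \<union> F)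
                 - (2/\<phi>) powr (\<alpha>/2) * Gamma (1 + \<alpha>/2)\<bar> \<partial>sample_space n) \<longlonglongrightarrow> 0"
proof
  define S where "S n \<omega> = Xn n \<omega> \<union> F" for n \<omega>
  define D where "D n i \<omega> = dnn \<theta> \<phi> (\<omega> i) (S n \<omega>)" for n :: nat and i :: nat and \<omega>
  have fin: "finite (S n \<omega>)" for n \<omega> using F by (simp add: S_def)
  have [measurable]: "(\<lambda>\<omega>. mdsf_weight \<theta> \<phi> \<alpha> (S n \<omega>)) \<in> borel_measurable (sample_space n)" for n
    unfolding S_def by (rule mdsf_weight_measurable[OF F(1)])
  have sub: "S n \<omega> \<subseteq> {0..1} \<times> {0..1}" if "\<forall>i\<in>{..<n}. 0 < bdist (\<omega> i)" for n \<omega>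
    using that F(2) unfolding S_def Xn_def by (intro Un_least image_subsetI bdist_pos_mem) simp_all
  show "\<forall>n. integrable (sample_space n) (\<lambda>\<omega>. real n powr (\<alpha>/2 - 1) * mdsf_weight \<theta> \<phi> \<alpha> (Xn n \<omega> \<union> F))"
    unfolding S_def[symmetric]
  proof
    fix n
    show "integrable (sample_space n) (\<lambda>\<omega>. real n powr (\<alpha>/2 - 1) * mdsf_weight \<theta> \<phi> \<alpha> (S n \<omega>))"
    proof (rule integrable_mult_right, rule sample_space.integrable_const_bound)
      show "AE \<omega> in sample_space n. norm (mdsf_weight \<theta> \<phi> \<alpha> (S n \<omega>)) \<le> real (n + card F) * 2 powr \<alpha>"
        using AE_sample_space_all_bdist[of n]
      proof eventually_elim
        case (elim \<omega>)
        have "mdsf_weight \<theta> \<phi> \<alpha> (S n \<omega>) \<le> (\<Sum>x\<in>S n \<omega>. 2 powr \<alpha>)"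
          unfolding mdsf_weight_def
          using sub[OF elim] \<alpha> fin by (intro sum_mono powr_mono2 dnn_le dnn_nonneg) auto
        also have "\<dots> = real (card (S n \<omega>)) * 2 powr \<alpha>" by simp
        also have "\<dots> \<le> real (n + card F) * 2 powr \<alpha>"
        proof -
          have "card (S n \<omega>) \<le> card (Xn n \<omega>) + card F" unfolding S_def by (rule card_Un_le)
          moreover have "card (Xn n \<omega>) \<le> n" unfolding Xn_def using card_image_le[of "{..<n}" \<omega>] by simp
          ultimately show ?thesis by (intro mult_right_mono) auto
        qed
        finally show ?case by (simp add: mdsf_weight_def sum_nonneg)
      qed
    qed measurable
  qed
  have weight: "AE \<omega> in sample_space n. mdsf_weight \<theta> \<phi> \<alpha> (S n \<omega>) = (\<Sum>i<n. D n i \<omega> powr \<alpha>)" for n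
    using F0[of n] AE_sample_space_inj[of n] AE_sample_space_all_bdist[of n]
  proof eventually_elim
    case (elim \<omega>)
    have "Xn n \<omega> \<inter> F = {}" using elim(3) F(3) by (force simp: Xn_def)
    then have "mdsf_weight \<theta> \<phi> \<alpha> (S n \<omega>) = (\<Sum>x\<in>Xn n \<omega>. dnn \<theta> \<phi> x (S n \<omega>) powr \<alpha>) + (\<Sum>x\<in>F. dnn \<theta> \<phi> x (S n \<omega>) powr \<alpha>)"
      unfolding mdsf_weight_def S_def using F(1) by (subst sum.union_disjoint) auto
    also have "(\<Sum>x\<in>F. dnn \<theta> \<phi> x (S n \<omega>) powr \<alpha>) = 0" using elim(1) by (intro sum.neutral) (simp add: S_def)
    also have "(\<Sum>x\<in>Xn n \<omega>. dnn \<theta> \<phi> x (S n \<omega>) powr \<alpha>) = (\<Sum>i<n. D n i \<omega> powr \<alpha>)"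
      unfolding Xn_def D_def using elim(2) by (subst sum.reindex) auto
    finally show ?case by simp
  qed
  have "(\<lambda>n. \<integral>\<^sup>+\<omega>. ennreal \<bar>real n powr (\<alpha> / 2 - 1) * (\<Sum>i<n. D n i \<omega> powr \<alpha>)
     - (2 / \<phi>) powr (\<alpha> / 2) * Gamma (1 + \<alpha> / 2)\<bar> \<partial>sample_space n) \<longlonglongrightarrow> 0"
  proof (rule directed_distance_weight_tendsto[OF \<alpha> \<phi>])
    show "D n i \<in> borel_measurable (sample_space n)" if "i < n" for n i
      unfolding D_def S_def using that by (intro dnn_measurable F) simp
    show "0 \<le> D n i \<omega>" for n i \<omega> unfolding D_def by (rule dnn_nonneg[OF fin])
    show "AE \<omega> in sample_space n. \<forall>i<n. s < D n i \<omega> \<longrightarrow> miss \<theta> \<phi> s n i \<omega> \<and>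
        (\<exists>y\<in>{0..1}\<times>{0..1}. y \<in> cone \<theta> \<phi> (\<omega> i) \<and> s < dist (\<omega> i) y)" if s: "0 < s" for n s
      using AE_sample_space_all_bdist[of n]
    proof eventually_elim
      case (elim \<omega>)
      show ?case
      proof (intro allI impI)
        fix i assume i: "i < n" "s < D n i \<omega>"
        then obtain y where y: "y \<in> S n \<omega>" "y \<in> cone \<theta> \<phi> (\<omega> i)" "y \<noteq> \<omega> i" and none: "\<forall>y\<in>S n \<omega>. y \<notin> nbr \<theta> \<phi> s (\<omega> i)"
          using dnn_greater_iff[OF fin, of s \<theta> \<phi> "\<omega> i" n \<omega>] s unfolding D_def by auto
        from y none have "s < dist (\<omega> i) y" by (auto simp: nbr_def)
        moreover have "miss \<theta> \<phi> s n i \<omega>" using none by (auto simp: miss_def S_def Xn_def)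
        ultimately show "miss \<theta> \<phi> s n i \<omega> \<and> (\<exists>y\<in>{0..1}\<times>{0..1}. y \<in> cone \<theta> \<phi> (\<omega> i) \<and> s < dist (\<omega> i) y)"
          using y sub[OF elim] by blast
      qed
    qed
  qed (use miss_D in \<open>simp add: D_def S_def\<close>)
  from tendsto_enn2real[OF this[folded ennreal_0]]
  have lim: "(\<lambda>n. enn2real (\<integral>\<^sup>+\<omega>. ennreal \<bar>real n powr (\<alpha> / 2 - 1) * (\<Sum>i<n. D n i \<omega> powr \<alpha>)
     - (2 / \<phi>) powr (\<alpha> / 2) * Gamma (1 + \<alpha> / 2)\<bar> \<partial>sample_space n)) \<longlonglongrightarrow> 0" by simp
  have "(\<integral>\<omega>. \<bar>real n powr (\<alpha>/2 - 1) * mdsf_weight \<theta> \<phi> \<alpha> (S n \<omega>) - (2/\<phi>) powr (\<alpha>/2) * Gamma (1 + \<alpha>/2)\<bar> \<partial>sample_space n)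
    = enn2real (\<integral>\<^sup>+\<omega>. ennreal \<bar>real n powr (\<alpha> / 2 - 1) * (\<Sum>i<n. D n i \<omega> powr \<alpha>)
     - (2 / \<phi>) powr (\<alpha> / 2) * Gamma (1 + \<alpha> / 2)\<bar> \<partial>sample_space n)" for n
  proof -
    have "(\<integral>\<omega>. \<bar>real n powr (\<alpha>/2 - 1) * mdsf_weight \<theta> \<phi> \<alpha> (S n \<omega>) - (2/\<phi>) powr (\<alpha>/2) * Gamma (1 + \<alpha>/2)\<bar> \<partial>sample_space n)
      = enn2real (\<integral>\<^sup>+\<omega>. ennreal \<bar>real n powr (\<alpha> / 2 - 1) * mdsf_weight \<theta> \<phi> \<alpha> (S n \<omega>)
        - (2 / \<phi>) powr (\<alpha> / 2) * Gamma (1 + \<alpha> / 2)\<bar> \<partial>sample_space n)"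
      by (rule integral_eq_nn_integral) simp_all
    also have "(\<integral>\<^sup>+\<omega>. ennreal \<bar>real n powr (\<alpha> / 2 - 1) * mdsf_weight \<theta> \<phi> \<alpha> (S n \<omega>)
        - (2 / \<phi>) powr (\<alpha> / 2) * Gamma (1 + \<alpha> / 2)\<bar> \<partial>sample_space n) =
      (\<integral>\<^sup>+\<omega>. ennreal \<bar>real n powr (\<alpha> / 2 - 1) * (\<Sum>i<n. D n i \<omega> powr \<alpha>)
        - (2 / \<phi>) powr (\<alpha> / 2) * Gamma (1 + \<alpha> / 2)\<bar> \<partial>sample_space n)"
    proof (rule nn_integral_cong_AE)
      show "AE \<omega> in sample_space n. ennreal \<bar>real n powr (\<alpha> / 2 - 1) * mdsf_weight \<theta> \<phi> \<alpha> (S n \<omega>)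
        - (2 / \<phi>) powr (\<alpha> / 2) * Gamma (1 + \<alpha> / 2)\<bar> = ennreal \<bar>real n powr (\<alpha> / 2 - 1) * (\<Sum>i<n. D n i \<omega> powr \<alpha>)
        - (2 / \<phi>) powr (\<alpha> / 2) * Gamma (1 + \<alpha> / 2)\<bar>"
        using weight[of n] by eventually_elim simp
    qed
    finally show ?thesis .
  qed
  then show "(\<lambda>n. \<integral>\<omega>. \<bar>real n powr (\<alpha>/2 - 1) * mdsf_weight \<theta> \<phi> \<alpha> (Xn n \<omega> \<union> F)
                 - (2/\<phi>) powr (\<alpha>/2) * Gamma (1 + \<alpha>/2)\<bar> \<partial>sample_space n) \<longlonglongrightarrow> 0"
    using lim by (simp add: S_def)
qed

section \<open>Empty cones, the coordinate order and the final limits\<close>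

lemma punctured_cone_borel: "cone \<theta> \<phi> x - {x} \<in> sets borel"
proof -
  have "cone \<theta> \<phi> x - {x} = {y \<in> space borel. y \<in> cone \<theta> \<phi> x \<and> y \<noteq> x}" by auto
  also have "\<dots> \<in> sets borel" by measurable
  finally show ?thesis .
qed

lemma punctured_cone_family: "Measurable.pred (borel \<Otimes>\<^sub>M borel) (\<lambda>z. snd z \<in> cone \<theta> \<phi> (fst z) - {fst z})"
  unfolding Diff_iff singleton_iff
  by (intro pred_intros_logic pred_cone pred_pt_eq measurable_snd measurable_fst)

text \<open>The cone of a point of the open square contains a small sector inside the square and so
  has positive area there. The probability that all other points avoid it decays geometrically, and
  bounded convergence integrates this over the position.\<close>

lemma empty_cone_probability_tendsto:
  assumes \<phi>: "0 < \<phi>" "\<phi> \<le> 2 * pi"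
  shows "(\<lambda>n. \<integral>\<^sup>+x. ennreal ((1 - measure unif_sq (cone \<theta> \<phi> x - {x})) ^ (n - 1)) \<partial>unif_sq) \<longlonglongrightarrow> 0"
proof -
  note fam = punctured_cone_family
  have m: "(\<lambda>x. measure unif_sq (cone \<theta> \<phi> x - {x})) \<in> borel_measurable unif_sq"
    unfolding measurable_cong_sets[OF sets_unif_sq refl] by (rule measure_family_measurable[OF fam])
  have m': "(\<lambda>x. ennreal ((1 - measure unif_sq (cone \<theta> \<phi> x - {x})) ^ k)) \<in> borel_measurable unif_sq" for k
    by (rule measurable_compose[OF borel_measurable_power[OF borel_measurable_diff[OF borel_measurable_const m]] measurable_ennreal])
  have "(\<lambda>n. \<integral>\<^sup>+x. ennreal ((1 - measure unif_sq (cone \<theta> \<phi> x - {x})) ^ (n - 1)) \<partial>unif_sq)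
    \<longlonglongrightarrow> (\<integral>\<^sup>+x. 0 \<partial>unif_sq)"
  proof (rule nn_integral_dominated_convergence[where w = "\<lambda>_. 1"])
    show "AE x in unif_sq. (\<lambda>n. ennreal ((1 - measure unif_sq (cone \<theta> \<phi> x - {x})) ^ (n - 1))) \<longlonglongrightarrow> 0"
      using AE_bdist_pos
    proof eventually_elim
      case (elim x)
      have "measure unif_sq (nbr \<theta> \<phi> (bdist x / 2) x) \<le> measure unif_sq (cone \<theta> \<phi> x - {x})"
        using punctured_cone_borel by (intro unif_sq.finite_measure_mono) (auto simp: nbr_def)
      moreover have "0 < measure unif_sq (nbr \<theta> \<phi> (bdist x / 2) x)"
        using elim \<phi> by (subst measure_nbr_interior) auto
      ultimately have "norm (1 - measure unif_sq (cone \<theta> \<phi> x - {x})) < 1"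
        by (simp add: unif_sq.prob_le_1)
      then have "(\<lambda>n. (1 - measure unif_sq (cone \<theta> \<phi> x - {x})) ^ n) \<longlonglongrightarrow> 0"
        by (rule LIMSEQ_power_zero)
      then have "(\<lambda>n. (1 - measure unif_sq (cone \<theta> \<phi> x - {x})) ^ (n - 1)) \<longlonglongrightarrow> 0"
        using LIMSEQ_offset[of "\<lambda>n. (1 - measure unif_sq (cone \<theta> \<phi> x - {x})) ^ (n - 1)" 1 0]
        unfolding diff_add_inverse2 by blast
      from tendsto_ennrealI[OF this] show ?case by simp
    qed
    show "(\<integral>\<^sup>+x. 1 \<partial>unif_sq) < \<infinity>" using unif_sq.emeasure_space_1 by simp
    show "(\<lambda>x. ennreal ((1 - measure unif_sq (cone \<theta> \<phi> x - {x})) ^ (n - 1))) \<in> borel_measurable unif_sq" for n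
      by (rule m')
  qed (auto intro!: always_eventually power_le_one simp: unif_sq.prob_le_1)
  then show ?thesis by simp
qed

text \<open>Anticlockwise from the upward vertical, the angles from \<open>pi / 2\<close> to
  \<open>pi\<close> run from left to down, so the cone is the lower left quadrant of its
  vertex.\<close>

lemma lower_left_cone:
  assumes "0 < a" "0 < b"
  shows "(0, 0) \<in> cone (pi / 2) (pi / 2) (a, b)"
proof -
  define r where "r = sqrt (a\<^sup>2 + b\<^sup>2)"
  have r: "0 < r" "r\<^sup>2 = a\<^sup>2 + b\<^sup>2" using assms by (auto simp: r_def add_pos_pos)
  have "(b / r)\<^sup>2 + (a / r)\<^sup>2 = (a\<^sup>2 + b\<^sup>2) / r\<^sup>2"
    by (simp add: power_divide add_divide_distrib)
  also have "\<dots> = 1" unfolding r(2)[symmetric] using r(1) by simp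
  finally obtain \<tau> where \<tau>: "0 \<le> \<tau>" "\<tau> \<le> pi / 2" "b / r = cos \<tau>" "a / r = sin \<tau>"
    using sincos_total_pi_half[of "b / r" "a / r"] assms r(1) by (auto simp: less_imp_le)
  \<comment> \<open>\<open>\<tau>\<close> is measured from the downward vertical towards the left,
    while the cone counts from the upward vertical; hence \<open>pi - \<tau>\<close>.\<close>
  have "a = r * sin (pi - \<tau>)" "b = - r * cos (pi - \<tau>)" using \<tau> r(1) by (auto simp: field_simps)
  then show ?thesis unfolding cone_def
    using r(1) \<tau> by (intro CollectI exI[of _ r] exI[of _ "pi - \<tau>"]) auto
qed

lemma lower_left_cone_origin:
  assumes "y \<in> cone (pi / 2) (pi / 2) (0, 0)"
  shows "fst y \<le> 0"
proof -
  from assms obtain r t where "0 \<le> r" "pi / 2 \<le> t" "t \<le> pi" "fst y = - (r * sin t)"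
    by (auto simp: cone_def)
  moreover from this have "0 \<le> sin t" by (intro sin_ge_zero) (use pi_gt_zero in linarith)+
  ultimately show ?thesis by simp
qed

theorem theorem1:
  fixes \<alpha> \<theta> \<phi> :: real
  assumes "0 < \<alpha>" "\<alpha> < 2"
    and "0 \<le> \<theta>" "\<theta> < 2 * pi"
    and "(0 < \<phi> \<and> \<phi> \<le> pi) \<or> \<phi> = 2 * pi"
  shows "((\<forall>n. integrable (sample_space n)
            (\<lambda>\<omega>. real n powr (\<alpha>/2 - 1) * mdsf_weight \<theta> \<phi> \<alpha> (Xn n \<omega>))) \<and>
         (\<lambda>n. \<integral>\<omega>. \<bar>real n powr (\<alpha>/2 - 1) * mdsf_weight \<theta> \<phi> \<alpha> (Xn n \<omega>)
                 - (2/\<phi>) powr (\<alpha>/2) * Gamma (1 + \<alpha>/2)\<bar> \<partial>sample_space n)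
           \<longlonglongrightarrow> 0) \<and>
         ((\<forall>n. integrable (sample_space n)
            (\<lambda>\<omega>. real n powr (\<alpha>/2 - 1) * mdsf_weight (pi/2) (pi/2) \<alpha> (Xn n \<omega> \<union> {(0,0)}))) \<and>
         (\<lambda>n. \<integral>\<omega>. \<bar>real n powr (\<alpha>/2 - 1) * mdsf_weight (pi/2) (pi/2) \<alpha> (Xn n \<omega> \<union> {(0,0)})
                 - (2/(pi/2)) powr (\<alpha>/2) * Gamma (1 + \<alpha>/2)\<bar> \<partial>sample_space n)
           \<longlonglongrightarrow> 0)"
proof
  have \<phi>: "0 < \<phi>" "\<phi> \<le> 2 * pi" using assms(5) pi_gt_zero by linarith+
  have "\<exists>h. h \<longlonglongrightarrow> 0 \<and> (\<forall>n i. 0 < n \<longrightarrow> i < n \<longrightarrow>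
      measure (sample_space n) {\<omega> \<in> space (sample_space n).
        miss \<theta> \<phi> (t / sqrt (real n)) n i \<omega> \<and> \<not> t / sqrt (real n) < dnn \<theta> \<phi> (\<omega> i) (Xn n \<omega> \<union> {})} \<le> h n)" if t: "0 < t" for t
  proof (intro exI conjI allI impI)
    define h where "h n = (\<integral>\<^sup>+x. ennreal ((1 - measure unif_sq (cone \<theta> \<phi> x - {x})) ^ (n - 1)) \<partial>unif_sq)" for n
    have "h \<longlonglongrightarrow> ennreal 0" unfolding h_def[abs_def] using empty_cone_probability_tendsto[OF \<phi>] by simp
    from tendsto_enn2real[OF this] show "(\<lambda>n. enn2real (h n)) \<longlonglongrightarrow> 0" by simp
    fix n i :: nat assume n: "0 < n" "i < n"
    have fam: "Measurable.pred (borel \<Otimes>\<^sub>M borel) (\<lambda>z. snd z \<in> cone \<theta> \<phi> (fst z) - {fst z})"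
      by (rule punctured_cone_family)
    \<comment> \<open>Missing the region without a distance above its radius leaves one possibility:
      the cone holds no other sample point. \<open>A\<close> is that event, and its probability no
      longer involves \<open>t\<close>.\<close>
    define A where "A = {\<omega> \<in> space (sample_space n). \<forall>j<n. \<omega> j \<notin> cone \<theta> \<phi> (\<omega> i) - {\<omega> i}}"
    have "Measurable.pred (sample_space n) (\<lambda>\<omega>. \<forall>j\<in>{..<n}. \<omega> j \<notin> cone \<theta> \<phi> (\<omega> i) - {\<omega> i})"
    proof (rule pred_intros_finite(3)[OF finite_lessThan])
      fix j assume "j \<in> {..<n}"
      then have "j < n" by simp
      then show "Measurable.pred (sample_space n) (\<lambda>\<omega>. \<omega> j \<notin> cone \<theta> \<phi> (\<omega> i) - {\<omega> i})"
        using n by (intro pred_intros_logic(2) pred_family[OF fam] sample_space_component)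
    qed
    then have A: "A \<in> sets (sample_space n)" unfolding A_def pred_def Ball_def lessThan_iff .
    have "measure (sample_space n) {\<omega> \<in> space (sample_space n).
        miss \<theta> \<phi> (t / sqrt (real n)) n i \<omega> \<and> \<not> t / sqrt (real n) < dnn \<theta> \<phi> (\<omega> i) (Xn n \<omega> \<union> {})} \<le> measure (sample_space n) A"
    proof (rule sample_space.finite_measure_mono[OF _ A], rule subsetI)
      fix \<omega> assume \<omega>: "\<omega> \<in> {\<omega> \<in> space (sample_space n).
        miss \<theta> \<phi> (t / sqrt (real n)) n i \<omega> \<and> \<not> t / sqrt (real n) < dnn \<theta> \<phi> (\<omega> i) (Xn n \<omega> \<union> {})}"
      have "0 \<le> t / sqrt (real n)" using t by simp
      from dnn_greater_iff[OF Xn_finite this, of \<theta> \<phi> "\<omega> i" n \<omega>] \<omega> show "\<omega> \<in> A"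
        by (auto simp: A_def miss_def Xn_def)
    qed
    also have "\<dots> = enn2real (\<integral>\<^sup>+\<omega>. 1 * indicator {\<omega>. \<forall>j<n. \<omega> j \<notin> cone \<theta> \<phi> (\<omega> i) - {\<omega> i}} \<omega> \<partial>sample_space n)"
      unfolding measure_def nn_integral_indicator[OF A, symmetric]
      by (intro arg_cong[where f = enn2real] nn_integral_cong) (simp add: A_def indicator_def)
    also have "\<dots> = enn2real (h n)"
      unfolding h_def by (subst nn_integral_sample_space_miss[OF n(2) _ _ fam]) auto
    finally show "measure (sample_space n) {\<omega> \<in> space (sample_space n).
        miss \<theta> \<phi> (t / sqrt (real n)) n i \<omega> \<and> \<not> t / sqrt (real n) < dnn \<theta> \<phi> (\<omega> i) (Xn n \<omega> \<union> {})} \<le> enn2real (h n)" .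
  qed
  from mdsf_weight_tendsto[OF assms(1,2) \<phi> _ _ _ _ this]
  show "(\<forall>n. integrable (sample_space n)
            (\<lambda>\<omega>. real n powr (\<alpha>/2 - 1) * mdsf_weight \<theta> \<phi> \<alpha> (Xn n \<omega>))) \<and>
         (\<lambda>n. \<integral>\<omega>. \<bar>real n powr (\<alpha>/2 - 1) * mdsf_weight \<theta> \<phi> \<alpha> (Xn n \<omega>)
                 - (2/\<phi>) powr (\<alpha>/2) * Gamma (1 + \<alpha>/2)\<bar> \<partial>sample_space n)
           \<longlonglongrightarrow> 0" by simp
next
  \<comment> \<open>The cone at the origin lies in the half plane of nonpositive first coordinate,
    which almost surely contains no sample point; so the origin contributes 0.\<close>
  have far: "AE \<omega> in sample_space n. \<forall>x\<in>{(0,0)}. dnn (pi/2) (pi/2) x (Xn n \<omega> \<union> {(0,0)}) = 0" for n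
    using AE_sample_space_all_bdist[of n]
  proof eventually_elim
    case (elim \<omega>)
    have "y \<notin> cone (pi/2) (pi/2) (0, 0)" if "y \<in> Xn n \<omega>" for y
    proof -
      have "0 < bdist y" using that elim by (auto simp: Xn_def)
      then have "0 < fst y" by (simp add: bdist_def)
      then show ?thesis using lower_left_cone_origin[of y] by auto
    qed
    then have "{y \<in> Xn n \<omega> \<union> {(0,0)} - {(0,0)}. dpreceq (pi/2) (pi/2) y (0,0)} = {}"
      by (auto simp: dpreceq_def)
    then show ?case by (simp add: dnn_def Let_def)
  qed
  have "\<exists>h. h \<longlonglongrightarrow> 0 \<and> (\<forall>n i. 0 < n \<longrightarrow> i < n \<longrightarrow>
      measure (sample_space n) {\<omega> \<in> space (sample_space n).
        miss (pi/2) (pi/2) (t / sqrt (real n)) n i \<omega> \<and> \<not> t / sqrt (real n) < dnn (pi/2) (pi/2) (\<omega> i) (Xn n \<omega> \<union> {(0,0)})} \<le> h n)" if t: "0 < t" for t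
  proof (intro exI conjI allI impI)
    show "(\<lambda>n. pi * t\<^sup>2 / real n) \<longlonglongrightarrow> 0" by (rule lim_const_over_n)
    fix n i :: nat assume n: "0 < n" "i < n"
    define s where "s = t / sqrt (real n)"
    have s: "0 \<le> s" using t by (simp add: s_def)
    \<comment> \<open>The empty family turns the avoidance formula into the law of the single point
      \<open>\<omega> i\<close>.\<close>
    define V :: "pt \<Rightarrow> pt set" where "V = (\<lambda>_. {})"
    \<comment> \<open>Almost surely the origin lies in the cone at \<open>\<omega> i\<close>, so a
      miss of the sample without a distance above \<open>s\<close> means that the origin itself is
      within \<open>s\<close>. The disc has area \<open>pi * s^2\<close>, which is
      \<open>pi * t^2 / n\<close>.\<close>
    define B :: "pt set" where "B = cball (0, 0) s"
    have B: "B \<in> sets borel" by (simp add: B_def)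
    define A where "A = {\<omega> \<in> space (sample_space n). \<omega> i \<in> B}"
    have A: "A \<in> sets (sample_space n)" using n B unfolding A_def by measurable
    have fin: "finite (Xn n \<omega> \<union> {(0,0)})" for \<omega> by simp
    have "measure (sample_space n) {\<omega> \<in> space (sample_space n).
        miss (pi/2) (pi/2) s n i \<omega> \<and> \<not> s < dnn (pi/2) (pi/2) (\<omega> i) (Xn n \<omega> \<union> {(0,0)})} \<le> measure (sample_space n) A"
    proof (rule sample_space.finite_measure_mono_AE[OF _ A])
      show "AE \<omega> in sample_space n. \<omega> \<in> {\<omega> \<in> space (sample_space n).
        miss (pi/2) (pi/2) s n i \<omega> \<and> \<not> s < dnn (pi/2) (pi/2) (\<omega> i) (Xn n \<omega> \<union> {(0,0)})} \<longrightarrow> \<omega> \<in> A"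
        using AE_sample_space_bdist[OF n(2)]
      proof eventually_elim
        case (elim \<omega>)
        have pos: "0 < fst (\<omega> i)" "0 < snd (\<omega> i)" using elim by (auto simp: bdist_def)
        show ?case
        proof
          assume \<omega>: "\<omega> \<in> {\<omega> \<in> space (sample_space n).
            miss (pi/2) (pi/2) s n i \<omega> \<and> \<not> s < dnn (pi/2) (pi/2) (\<omega> i) (Xn n \<omega> \<union> {(0,0)})}"
          have "(0, 0) \<in> cone (pi/2) (pi/2) (\<omega> i)" "(0, 0) \<noteq> \<omega> i"
            using lower_left_cone[OF pos] pos by (cases "\<omega> i"; simp)+
          then have "\<exists>y\<in>Xn n \<omega> \<union> {(0,0)}. y \<in> nbr (pi/2) (pi/2) s (\<omega> i)"
            using \<omega> dnn_greater_iff[OF fin s, of "pi/2" "pi/2" "\<omega> i" \<omega>] by auto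
          then have "(0, 0) \<in> nbr (pi/2) (pi/2) s (\<omega> i)"
            using \<omega> by (auto simp: miss_def Xn_def)
          then show "\<omega> \<in> A" using \<omega> by (auto simp: A_def B_def nbr_def dist_commute)
        qed
      qed
    qed
    also have "\<dots> = enn2real (\<integral>\<^sup>+\<omega>. indicator B (\<omega> i) * indicator {\<omega>. \<forall>j<n. \<omega> j \<notin> V (\<omega> i)} \<omega> \<partial>sample_space n)"
      unfolding measure_def nn_integral_indicator[OF A, symmetric]
      by (intro arg_cong[where f = enn2real] nn_integral_cong) (simp add: A_def V_def indicator_def)
    also have "\<dots> = measure unif_sq B"
      using B by (subst nn_integral_sample_space_miss[OF n(2)]) (auto simp: V_def measure_def)
    also have "\<dots> \<le> measure lborel B"
      unfolding measure_unif_sq[OF B]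
      using emeasure_compact_finite[OF compact_cball[of "(0, 0) :: pt" s]]
      by (intro measure_mono_fmeasurable fmeasurableI) (auto simp: B_def)
    also have "\<dots> = pi * t\<^sup>2 / real n"
      using s by (simp add: B_def content_cball unit_ball_vol_2 s_def power2_eq_square[symmetric] scaled_radius_square)
    finally show "measure (sample_space n) {\<omega> \<in> space (sample_space n).
        miss (pi/2) (pi/2) (t / sqrt (real n)) n i \<omega> \<and> \<not> t / sqrt (real n) < dnn (pi/2) (pi/2) (\<omega> i) (Xn n \<omega> \<union> {(0,0)})} \<le> pi * t\<^sup>2 / real n"
      by (simp add: s_def)
  qed
  from mdsf_weight_tendsto[OF assms(1,2) _ _ _ _ _ far this]
  show "(\<forall>n. integrable (sample_space n)
            (\<lambda>\<omega>. real n powr (\<alpha>/2 - 1) * mdsf_weight (pi/2) (pi/2) \<alpha> (Xn n \<omega> \<union> {(0,0)}))) \<and>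
         (\<lambda>n. \<integral>\<omega>. \<bar>real n powr (\<alpha>/2 - 1) * mdsf_weight (pi/2) (pi/2) \<alpha> (Xn n \<omega> \<union> {(0,0)})
                 - (2/(pi/2)) powr (\<alpha>/2) * Gamma (1 + \<alpha>/2)\<bar> \<partial>sample_space n)
           \<longlonglongrightarrow> 0" using pi_gt_zero by (simp add: bdist_def)
qed

end
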